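(* Let $2\le p\le q$ be integers and let $g=\pm x^p\pm y^q$ be a two-variable Brieskorn polynomial. Then $p$ and $q$ are uniquely determined by the naive zeta function $Z_g(T)=\sum_{n\ge1}g_nT^n$. More precisely, $$p=\min\{n: g_n\neq0\},$$ and if $l=\min\{n: g_n\neq a_nu^n\}$, where $\sum_{n\ge1}a_nT^n$ denotes the naive zeta function of $\pm x^p$, then $$q=\begin{cases} l-1 & \text{if } p \text{ is odd, } p\mid l-1 \text{ and } g_l\neq(u-1)u^k \text{ for some } k\in\mathbb N,\\ l & \text{otherwise.}\end{cases}$$
   Context: Virtual Poincaré polynomial $\beta$. A semi-algebraic set $A\subset\mathbb P^n=\mathbb P^n(\mathbb R)$ is arc-symmetric if for every real analytic arc $\gamma:]-\epsilon,\epsilon[\to\mathbb P^n$ with $\gamma(]-\epsilon,0[)\subset A$ there is $\epsilon'>0$ with $\gamma(]0,\epsilon'[)\subset A$; $\mathcal{AS}$ is the class of such sets ($\mathbb R^n\subset\mathbb P^n$). It contains all Zariski constructible subsets of real algebraic varieties in $\mathbb P^n$. Two arc-symmetric sets $A,B$ are isomorphic if a biregular isomorphism between Zariski open subsets of their Zariski closures, containing $A$ and $B$, maps $A$ onto $B$. $\beta:\mathcal{AS}\to\mathbb Z[u]$ is the map invariant under isomorphism, additive ($\beta(A)=\beta(B)+\beta(A\setminus B)$ for $B\subset A$ in $\mathcal{AS}$), multiplicative on products, with $\beta(A)=\sum_i\dim H_i(A,\mathbb Z_2)u^i$ for $A$ a connected component of a compact nonsingular real algebraic variety. Naive zeta function.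 Let $\mathcal L_n(\mathbb R^d,0)=\{\gamma(t)=a_1t+\cdots+a_nt^n : a_i\in\mathbb R^d\}$. For an analytic germ $f:(\mathbb R^d,0)\to(\mathbb R,0)$ and $n\ge1$ put $\chi_n(f)=\{\gamma\in\mathcal L_n(\mathbb R^d,0): f\circ\gamma(t)=bt^n+\cdots,\ b\ne0\}$. The naive zeta function of $f$ is $$Z_f(T)=\sum_{n\ge1}\beta(\chi_n(f))u^{-nd}T^n.$$ In the claim, $d=2$ for $g$, and $\pm x^p$ is regarded as a function of the single variable $x$ ($d=1$).
   Formalization: In the formulas for l and q, g_n and a_n are taken without the factor u^{-nd}, i.e. g_n=β(χ_n(g)) and a_n=β(χ_n(±x^p)), since with that factor the formula fails (p=2, q=3 gives l=2); "g_l≠(u-1)u^k for some k" is read as: g_l equals (u-1)u^k for no k. *)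

theory Defs
  imports
    "HOL-Analysis.Analysis"
    "HOL-Homology.Homology"
    "HOL-Computational_Algebra.Formal_Laurent_Series"
    "HOL-Library.Nat_Bijection"
begin

section \<open>Real projective spaces\<close>

text \<open>
  The real affine space of dimension \<open>n\<close> is the carrier of \<^const>\<open>Euclidean_space\<close>: sequences
  vanishing from index \<open>n\<close> on.  A point of projective \<open>n\<close>-space is a line through the origin of the
  affine space of dimension \<open>n + 1\<close>.  Projective \<open>n\<close>-space is thereby literally a linear subspace
  of projective \<open>m\<close>-space for \<open>n \<le> m\<close>, and sets lying in projective spaces of different dimensions
  all have the type \<open>(nat \<Rightarrow> real) set set\<close>.
\<close>

abbreviation aff :: "nat \<Rightarrow> (nat \<Rightarrow> real) set" where
  "aff n \<equiv> topspace (Euclidean_space n)"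

definition pline :: "(nat \<Rightarrow> real) \<Rightarrow> (nat \<Rightarrow> real) set" where
  "pline x = range (\<lambda>c i. c * x i)"

definition pspace :: "nat \<Rightarrow> (nat \<Rightarrow> real) set set" where
  "pspace n = pline ` (aff (Suc n) - {\<lambda>i. 0})"

definition proj_topology :: "nat \<Rightarrow> (nat \<Rightarrow> real) set topology" where
  "proj_topology n = topology (\<lambda>U. U \<subseteq> pspace n \<and>
     openin (subtopology (Euclidean_space (Suc n)) (- {\<lambda>i. 0}))
       {x \<in> aff (Suc n) - {\<lambda>i. 0}. pline x \<in> U})"

lemma openin_proj_topology:
  "openin (proj_topology n) U \<longleftrightarrow> U \<subseteq> pspace n \<and>
     openin (subtopology (Euclidean_space (Suc n)) (- {\<lambda>i. 0}))
       {x \<in> aff (Suc n) - {\<lambda>i. 0}. pline x \<in> U}"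
proof -
  let ?T = "subtopology (Euclidean_space (Suc n)) (- {\<lambda>i. 0})"
  let ?D = "aff (Suc n) - {\<lambda>i. 0}"
  have "istopology (\<lambda>U. U \<subseteq> pspace n \<and> openin ?T {x \<in> ?D. pline x \<in> U})"
    unfolding istopology_def
  proof (intro conjI allI impI)
    fix S T
    assume a: "S \<subseteq> pspace n \<and> openin ?T {x \<in> ?D. pline x \<in> S}"
      and b: "T \<subseteq> pspace n \<and> openin ?T {x \<in> ?D. pline x \<in> T}"
    show "S \<inter> T \<subseteq> pspace n" using a by blast
    have "{x \<in> ?D. pline x \<in> S \<inter> T} = {x \<in> ?D. pline x \<in> S} \<inter> {x \<in> ?D. pline x \<in> T}"
      by blast
    then show "openin ?T {x \<in> ?D. pline x \<in> S \<inter> T}" 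
      using openin_Int[OF conjunct2[OF a] conjunct2[OF b]] by simp
  next
    fix K
    assume a: "\<forall>S\<in>K. S \<subseteq> pspace n \<and> openin ?T {x \<in> ?D. pline x \<in> S}"
    show "\<Union>K \<subseteq> pspace n" using a by blast
    have "openin ?T (\<Union>((\<lambda>S. {x \<in> ?D. pline x \<in> S}) ` K))"
      by (rule openin_Union) (use a in blast)
    moreover have "{x \<in> ?D. pline x \<in> \<Union>K} = \<Union>((\<lambda>S. {x \<in> ?D. pline x \<in> S}) ` K)"
      by blast
    ultimately show "openin ?T {x \<in> ?D. pline x \<in> \<Union>K}" by (simp only:)
  qed
  then show ?thesis
    unfolding proj_topology_def by simp
qed

lemma topspace_proj_topology: "topspace (proj_topology n) = pspace n"
proof
  show "topspace (proj_topology n) \<subseteq> pspace n"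
    using openin_proj_topology openin_topspace by blast
  have "{x \<in> aff (Suc n) - {\<lambda>i. 0}. pline x \<in> pspace n}
      = topspace (subtopology (Euclidean_space (Suc n)) (- {\<lambda>i. 0}))"
    unfolding pspace_def topspace_subtopology by blast
  then have "openin (proj_topology n) (pspace n)"
    unfolding openin_proj_topology by (metis openin_topspace order_refl)
  then show "pspace n \<subseteq> topspace (proj_topology n)"
    by (rule openin_subset)
qed

lemma quotient_map_pline:
  "quotient_map (subtopology (Euclidean_space (Suc n)) (- {\<lambda>i. 0})) (proj_topology n) pline"
proof -
  have *: "topspace (subtopology (Euclidean_space (Suc n)) (- {\<lambda>i. 0})) = aff (Suc n) - {\<lambda>i. 0}"
    by (simp add: Diff_eq)
  show ?thesis
    unfolding quotient_map_def topspace_proj_topology openin_proj_topology *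
    by (simp add: pspace_def)
qed

section \<open>Polynomials and algebraic sets\<close>

inductive_set polyfun :: "nat \<Rightarrow> ((nat \<Rightarrow> real) \<Rightarrow> real) set" for N :: nat where
  const: "(\<lambda>x. c) \<in> polyfun N"
| coord: "i < N \<Longrightarrow> (\<lambda>x. x i) \<in> polyfun N"
| add: "f \<in> polyfun N \<Longrightarrow> g \<in> polyfun N \<Longrightarrow> (\<lambda>x. f x + g x) \<in> polyfun N"
| mult: "f \<in> polyfun N \<Longrightarrow> g \<in> polyfun N \<Longrightarrow> (\<lambda>x. f x * g x) \<in> polyfun N"

definition hom_poly :: "nat \<Rightarrow> nat \<Rightarrow> ((nat \<Rightarrow> real) \<Rightarrow> real) \<Rightarrow> bool" where
  "hom_poly N k f \<longleftrightarrow> f \<in> polyfun N \<and> (\<forall>c x. f (\<lambda>i. c * x i) = c ^ k * f x)"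

definition vanishes_on :: "((nat \<Rightarrow> real) \<Rightarrow> real) \<Rightarrow> (nat \<Rightarrow> real) set \<Rightarrow> bool" where
  "vanishes_on f L \<longleftrightarrow> (\<forall>x\<in>L. f x = 0)"

definition zariski_closed :: "nat \<Rightarrow> (nat \<Rightarrow> real) set set \<Rightarrow> bool" where
  "zariski_closed n Z \<longleftrightarrow>
     (\<exists>S. (\<forall>f\<in>S. \<exists>k. hom_poly (Suc n) k f) \<and> Z = {L \<in> pspace n. \<forall>f\<in>S. vanishes_on f L})"

definition zariski_closure :: "nat \<Rightarrow> (nat \<Rightarrow> real) set set \<Rightarrow> (nat \<Rightarrow> real) set set" where
  "zariski_closure n A = \<Inter>{Z. zariski_closed n Z \<and> A \<subseteq> Z}"

definition zariski_open_in ::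
    "nat \<Rightarrow> (nat \<Rightarrow> real) set set \<Rightarrow> (nat \<Rightarrow> real) set set \<Rightarrow> bool" where
  "zariski_open_in n Y U \<longleftrightarrow> (\<exists>Z. zariski_closed n Z \<and> U = Y - Z)"

text \<open>Real algebraic varieties in projective \<open>n\<close>-space: the Zariski locally closed subsets.\<close>

definition alg_variety :: "nat \<Rightarrow> (nat \<Rightarrow> real) set set \<Rightarrow> bool" where
  "alg_variety n X \<longleftrightarrow> (\<exists>Y. zariski_closed n Y \<and> zariski_open_in n Y X)"

definition partial_deriv :: "((nat \<Rightarrow> real) \<Rightarrow> real) \<Rightarrow> nat \<Rightarrow> (nat \<Rightarrow> real) \<Rightarrow> real" where
  "partial_deriv f j v = deriv (\<lambda>s. f (v(j := s))) (v j)"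

text \<open>
  Every point of \<open>X\<close> is nonsingular, in some dimension \<open>d\<close> that may depend on the point: in a Zariski
  neighbourhood (the complement of \<open>Z\<close>) the set \<open>X\<close> is cut out by \<open>n - d\<close> homogeneous polynomials
  that vanish on \<open>X\<close> and whose gradients at the point are linearly independent.
\<close>

definition nonsingular :: "nat \<Rightarrow> (nat \<Rightarrow> real) set set \<Rightarrow> bool" where
  "nonsingular n X \<longleftrightarrow>
     (\<forall>v \<in> aff (Suc n). pline v \<in> X \<longrightarrow>
       (\<exists>d\<le>n. \<exists>P Z. zariski_closed n Z \<and> pline v \<notin> Z \<and>
          (\<forall>i<n - d. (\<exists>k. hom_poly (Suc n) k (P i)) \<and> (\<forall>L\<in>X. vanishes_on (P i) L)) \<and>
          X - Z = {L \<in> pspace n - Z. \<forall>i<n - d. vanishes_on (P i) L} \<and>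
          (\<forall>c :: nat \<Rightarrow> real.
             (\<forall>j\<le>n. (\<Sum>i<n - d. c i * partial_deriv (P i) j v) = 0) \<longrightarrow> (\<forall>i<n - d. c i = 0))))"

text \<open>Regular maps are given locally by homogeneous polynomials of one common degree.\<close>

definition regular_map ::
    "nat \<Rightarrow> nat \<Rightarrow> (nat \<Rightarrow> real) set set \<Rightarrow> (nat \<Rightarrow> real) set set
      \<Rightarrow> ((nat \<Rightarrow> real) set \<Rightarrow> (nat \<Rightarrow> real) set) \<Rightarrow> bool" where
  "regular_map n m U V \<phi> \<longleftrightarrow> \<phi> ` U \<subseteq> V \<and>
     (\<forall>L\<in>U. \<exists>W k F. zariski_open_in n U W \<and> L \<in> W \<and> (\<forall>j\<le>m. hom_poly (Suc n) k (F j)) \<and>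
        (\<forall>x. pline x \<in> W \<longrightarrow> (\<exists>j\<le>m. F j x \<noteq> 0) \<and>
             \<phi> (pline x) = pline (\<lambda>j. if j \<le> m then F j x else 0)))"

section \<open>Arc-symmetric sets\<close>

inductive_set semialg :: "nat \<Rightarrow> (nat \<Rightarrow> real) set set" for N :: nat where
  pos: "f \<in> polyfun N \<Longrightarrow> {x \<in> aff N. 0 < f x} \<in> semialg N"
| compl: "A \<in> semialg N \<Longrightarrow> aff N - A \<in> semialg N"
| union: "A \<in> semialg N \<Longrightarrow> B \<in> semialg N \<Longrightarrow> A \<union> B \<in> semialg N"

text \<open>A subset of projective space is semi-algebraic iff the punctured cone over it is.\<close>

definition proj_semialg :: "nat \<Rightarrow> (nat \<Rightarrow> real) set set \<Rightarrow> bool" where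
  "proj_semialg n A \<longleftrightarrow> A \<subseteq> pspace n \<and> {x \<in> aff (Suc n) - {\<lambda>i. 0}. pline x \<in> A} \<in> semialg (Suc n)"

definition real_analytic_at :: "(real \<Rightarrow> real) \<Rightarrow> real \<Rightarrow> bool" where
  "real_analytic_at f t \<longleftrightarrow>
     (\<exists>r>0. \<exists>a. \<forall>s. \<bar>s - t\<bar> < r \<longrightarrow> (\<lambda>k. a k * (s - t) ^ k) sums f s)"

text \<open>Analyticity of an arc in projective space, in terms of local analytic homogeneous coordinates.\<close>

definition analytic_arc :: "nat \<Rightarrow> real \<Rightarrow> (real \<Rightarrow> (nat \<Rightarrow> real) set) \<Rightarrow> bool" where
  "analytic_arc n \<epsilon> \<gamma> \<longleftrightarrow>
     (\<forall>t \<in> {-\<epsilon><..<\<epsilon>}. \<exists>x :: real \<Rightarrow> nat \<Rightarrow> real.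
        (\<forall>i. real_analytic_at (\<lambda>s. x s i) t) \<and>
        (\<forall>\<^sub>F s in nhds t. x s \<in> aff (Suc n) - {\<lambda>i. 0} \<and> \<gamma> s = pline (x s)))"

definition arc_symmetric :: "nat \<Rightarrow> (nat \<Rightarrow> real) set set \<Rightarrow> bool" where
  "arc_symmetric n A \<longleftrightarrow> proj_semialg n A \<and>
     (\<forall>\<epsilon>>0. \<forall>\<gamma>. analytic_arc n \<epsilon> \<gamma> \<longrightarrow> \<gamma> ` {-\<epsilon><..<0} \<subseteq> A \<longrightarrow>
        (\<exists>\<epsilon>'>0. \<epsilon>' \<le> \<epsilon> \<and> \<gamma> ` {0<..<\<epsilon>'} \<subseteq> A))"

definition AS :: "(nat \<Rightarrow> real) set set set" where
  "AS = {A. \<exists>n. arc_symmetric n A}"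

definition AS_isomorphic :: "(nat \<Rightarrow> real) set set \<Rightarrow> (nat \<Rightarrow> real) set set \<Rightarrow> bool" where
  "AS_isomorphic A B \<longleftrightarrow>
     (\<exists>n m U V \<phi> \<psi>. arc_symmetric n A \<and> arc_symmetric m B \<and>
        zariski_open_in n (zariski_closure n A) U \<and> A \<subseteq> U \<and>
        zariski_open_in m (zariski_closure m B) V \<and> B \<subseteq> V \<and>
        regular_map n m U V \<phi> \<and> regular_map m n V U \<psi> \<and>
        (\<forall>L\<in>U. \<psi> (\<phi> L) = L) \<and> (\<forall>M\<in>V. \<phi> (\<psi> M) = M) \<and>
        \<phi> ` A = B)"

text \<open>
  Products are formed by the Segre embedding.  The products \<open>x\<^sub>i y\<^sub>j\<close> of homogeneous coordinates are
  placed at the index coding the pair \<open>(i, j)\<close>, so that the embedding does not refer to the dimensions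
  of the two projective spaces.
\<close>

definition segre :: "(nat \<Rightarrow> real) \<Rightarrow> (nat \<Rightarrow> real) \<Rightarrow> nat \<Rightarrow> real" where
  "segre x y k = (case prod_decode k of (i, j) \<Rightarrow> x i * y j)"

definition segre_prod ::
    "(nat \<Rightarrow> real) set set \<Rightarrow> (nat \<Rightarrow> real) set set \<Rightarrow> (nat \<Rightarrow> real) set set" where
  "segre_prod A B = {pline (segre x y) |x y. pline x \<in> A \<and> pline y \<in> B}"

section \<open>Homology with coefficients in the field with two elements\<close>

text \<open>
  The mod 2 chain complex is the integral singular chain complex \<open>C\<close> modulo \<open>2C\<close>.  Its cycles and
  boundaries are represented by their preimages in \<open>C\<close>.
\<close>

definition mod2_cycles :: "nat \<Rightarrow> 'a topology \<Rightarrow> 'a chain set" where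
  "mod2_cycles p X = {c. singular_chain p X c \<and>
     (\<exists>e. singular_chain (p - 1) X e \<and> chain_boundary p c = frag_cmul 2 e)}"

definition mod2_boundaries :: "nat \<Rightarrow> 'a topology \<Rightarrow> 'a chain set" where
  "mod2_boundaries p X = {chain_boundary (Suc p) d + frag_cmul 2 e |d e.
     singular_chain (Suc p) X d \<and> singular_chain p X e}"

definition mod2_homology_group :: "nat \<Rightarrow> 'a topology \<Rightarrow> 'a chain set monoid" where
  "mod2_homology_group p X =
     subgroup_generated (chain_group p X) (mod2_cycles p X) Mod mod2_boundaries p X"

text \<open>
  Over the field with two elements the linear span of a set is the subgroup it generates, so the
  dimension is the least cardinality of a generating set.
\<close>

definition mod2_betti :: "nat \<Rightarrow> 'a topology \<Rightarrow> nat" where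
  "mod2_betti p X = (LEAST k. \<exists>S. finite S \<and> card S = k \<and>
     S \<subseteq> carrier (mod2_homology_group p X) \<and>
     generate (mod2_homology_group p X) S = carrier (mod2_homology_group p X))"

section \<open>The virtual Poincare polynomial\<close>

text \<open>
  The properties characterizing the virtual Poincare polynomial on \<^const>\<open>AS\<close>; values outside
  \<^const>\<open>AS\<close> are irrelevant.
\<close>

definition virtual_poincare :: "((nat \<Rightarrow> real) set set \<Rightarrow> int poly) \<Rightarrow> bool" where
  "virtual_poincare \<beta> \<longleftrightarrow>
     (\<forall>A\<in>AS. \<forall>B\<in>AS. AS_isomorphic A B \<longrightarrow> \<beta> A = \<beta> B) \<and>
     (\<forall>A\<in>AS. \<forall>B\<in>AS. B \<subseteq> A \<longrightarrow> \<beta> A = \<beta> B + \<beta> (A - B)) \<and>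
     (\<forall>A\<in>AS. \<forall>B\<in>AS. \<beta> (segre_prod A B) = \<beta> A * \<beta> B) \<and>
     (\<forall>n X A. alg_variety n X \<longrightarrow> compactin (proj_topology n) X \<longrightarrow> nonsingular n X \<longrightarrow>
        A \<in> connected_components_of (subtopology (proj_topology n) X) \<longrightarrow>
        (\<forall>i. poly.coeff (\<beta> A) i = int (mod2_betti i (subtopology (proj_topology n) A))))"

section \<open>Naive zeta functions\<close>

text \<open>
  A truncated arc \<open>a\<^sub>1 t + \<dots> + a\<^sub>n t\<^sup>n\<close> in affine \<open>d\<close>-space is given by the point \<open>a\<close> of affine
  \<open>n d\<close>-space whose coordinate \<open>(k - 1) d + i\<close> is the \<open>i\<close>-th component of \<open>a\<^sub>k\<close>.
\<close>

definition trunc_arc :: "nat \<Rightarrow> nat \<Rightarrow> (nat \<Rightarrow> real) \<Rightarrow> real \<Rightarrow> nat \<Rightarrow> real" where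
  "trunc_arc d n a t i = (if i < d then \<Sum>k=1..n. a ((k - 1) * d + i) * t ^ k else 0)"

definition chi :: "nat \<Rightarrow> ((nat \<Rightarrow> real) \<Rightarrow> real) \<Rightarrow> nat \<Rightarrow> (nat \<Rightarrow> real) set" where
  "chi d f n = {a \<in> aff (n * d). \<exists>b :: nat \<Rightarrow> real. (\<forall>k<n. b k = 0) \<and> b n \<noteq> 0 \<and>
     (\<forall>\<^sub>F t in nhds 0. (\<lambda>k. b k * t ^ k) sums f (trunc_arc d n a t))}"

definition affine_chart :: "(nat \<Rightarrow> real) \<Rightarrow> (nat \<Rightarrow> real) set" where
  "affine_chart x = pline (case_nat 1 x)"

text \<open>
  The coefficients \<open>\<beta>(\<chi>\<^sub>n(f)) u\<^sup>-\<^sup>n\<^sup>d\<close> are Laurent polynomials in \<open>u\<close> with integer coefficients, with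
  \<open>u\<close> represented by \<^const>\<open>fls_X\<close>; the power series variable is \<open>T\<close>.
\<close>

definition naive_zeta ::
    "((nat \<Rightarrow> real) set set \<Rightarrow> int poly) \<Rightarrow> nat \<Rightarrow> ((nat \<Rightarrow> real) \<Rightarrow> real) \<Rightarrow> int fls fps" where
  "naive_zeta \<beta> d f = Abs_fps (\<lambda>n. if n = 0 then 0
     else fps_to_fls (fps_of_poly (\<beta> (affine_chart ` chi d f n))) * fls_X_intpow (- int (n * d)))"

text \<open>
  The coefficients of a naive zeta function in \<open>d\<close> variables after clearing the factor \<open>u\<^sup>-\<^sup>n\<^sup>d\<close>,
  i.e. the polynomials \<open>\<beta>(\<chi>\<^sub>n(f))\<close> for \<open>n \<ge> 1\<close>.
\<close>

definition cleared_coeff :: "nat \<Rightarrow> int fls fps \<Rightarrow> nat \<Rightarrow> int fls" where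
  "cleared_coeff d Z n = fls_X ^ (n * d) * fps_nth Z n"

definition brieskorn :: "real \<Rightarrow> nat \<Rightarrow> real \<Rightarrow> nat \<Rightarrow> (nat \<Rightarrow> real) \<Rightarrow> real" where
  "brieskorn \<sigma> p \<tau> q x = \<sigma> * x 0 ^ p + \<tau> * x 1 ^ q"

end

theory Submission
  imports Defs "HOL-Complex_Analysis.Cauchy_Integral_Formula"
begin

text \<open>
  Let \<open>u\<close> be the class of the affine line; the mod 2 Betti numbers of the circle and the point give
  \<open>\<beta> = 1 + u\<close> for the projective line and \<open>\<beta> = 1\<close> for the point at infinity, so \<open>u\<close> is the variable.
  Write \<open>x = \<Sum> x\<^sub>j t\<^sup>j\<close> and \<open>y = \<Sum> y\<^sub>j t\<^sup>j\<close> for the components of an arc.  For \<open>n < q\<close> the summand \<open>\<plusminus>y\<^sup>q\<close>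
  does not contribute, and \<open>g\<^sub>n = a\<^sub>n u\<^sup>n\<close>, which is \<open>(u - 1) u\<^sup>m\<close> or \<open>0\<close> according to whether \<open>p\<close>
  divides \<open>n\<close>.  For \<open>n = q\<close> not divisible by \<open>p\<close> only \<open>y\<^sub>1 \<noteq> 0\<close> matters, so \<open>g\<^sub>q = (u - 1) u\<^sup>m\<close> while
  \<open>a\<^sub>q = 0\<close>.  For \<open>n = q = k p\<close> the condition is \<open>\<plusminus>x\<^sub>k\<^sup>p \<plusminus> y\<^sub>1\<^sup>k\<^sup>p \<noteq> 0\<close>; the excluded curve is a single
  graph if \<open>p\<close> is odd, and then \<open>g\<^sub>q = a\<^sub>q u\<^sup>q\<close>, but a point or a pair of crossing graphs if \<open>p\<close> is even.
  For \<open>p\<close> odd the next coefficient \<open>g\<^sub>q\<^sub>+\<^sub>1 = (u - 1)\<^sup>2 u\<^sup>m\<close> is the first to deviate, and its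
  second factor \<open>u - 1\<close> distinguishes this case from the one where \<open>p\<close> does not divide \<open>q\<close>.
\<close>

section \<open>Mod 2 Betti numbers\<close>

text \<open>Only the characterizing properties of \<open>\<beta>\<close> are available, so every
  value has to be reached from points and the projective line, the varieties whose homology is
  computed, by isomorphism, difference and product. For this each coefficient set is brought to one
  shape: some coordinates vanish, at most four satisfy a condition, the others are free and
  contribute a power of u. All sets involved are polynomially constructible in an affine space, and
  for that class membership in \<open>AS\<close> follows from the isolation of zeros of analytic
  functions. The comparison g_n = a_n u^n concerns cleared coefficients: for n < q the y-component
  of an arc is arbitrary and contributes u^n, a factor that the normalizations u^(-2n) and u^(-n)
  would cancel. The coefficient at q + 1 has two factors u - 1 because on the graph the next
  coefficient of the arc is a power of y_1 times a form linear in x_(k+1): both y_1 and that form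
  must be nonzero, and the form can serve as a coordinate. Evaluation at u = 1 separates one factor
  u - 1 from two. As a_n is the same for both signs of x^p, the exponents are recovered without
  knowledge of the signs.\<close>

lemma infinite_cyclic_homology_imp_index:
  assumes "homology_group (int p) X \<cong> integer_group"
  obtains \<psi> :: "'a chain \<Rightarrow> int" where
    "\<And>c d. singular_relcycle p X {} c \<Longrightarrow> singular_relcycle p X {} d \<Longrightarrow> \<psi> (c + d) = \<psi> c + \<psi> d"
    "\<And>c. singular_relcycle p X {} c \<Longrightarrow> \<psi> c = 0 \<longleftrightarrow> singular_relboundary p X {} c"
    "\<And>n. \<exists>c. singular_relcycle p X {} c \<and> \<psi> c = n"
proof -
  let ?H = "homology_group (int p) X"
  obtain f where f: "f \<in> iso ?H integer_group"
    using assms by (auto simp: is_iso_def)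
  then have hom: "f \<in> hom ?H integer_group" and bij: "bij_betw f (carrier ?H) UNIV"
    by (auto simp: iso_def integer_group_def)
  \<comment> \<open>The index of a cycle is its class read as an integer. It takes chains as
    arguments because mod 2 classes are represented by chains that need not be integral
    cycles.\<close>
  define \<psi> where "\<psi> c = f (homologous_rel_set p X {} c)" for c
  have carr: "homologous_rel_set p X {} c \<in> carrier ?H" if "singular_relcycle p X {} c" for c
    using that by (auto simp: carrier_relative_homology_group)
  have one: "f (singular_relboundary_set p X {}) = 0"
    using hom_one[OF hom group_relative_homology_group group_integer_group] by simp
  show thesis
  proof (rule that[of \<psi>])
    fix c d assume c: "singular_relcycle p X {} c" and d: "singular_relcycle p X {} d"
    have "homologous_rel_set p X {} c \<otimes>\<^bsub>?H\<^esub> homologous_rel_set p X {} d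
        = homologous_rel_set p X {} (c + d)"
    proof -
      have "homologous_rel p X {} c x \<Longrightarrow> homologous_rel p X {} d y
          \<Longrightarrow> homologous_rel p X {} (c + d) (x + y)" for x y
        by (rule homologous_rel_add)
      \<comment> \<open>For the converse inclusion, an element w of the coset of c + d is split as c
        plus w - c.\<close>
      moreover have "\<exists>x. homologous_rel p X {} c x \<and> (\<exists>y. homologous_rel p X {} d y \<and> w = x + y)"
        if "homologous_rel p X {} (c + d) w" for w
      proof (intro exI conjI)
        show "homologous_rel p X {} c c" by simp
        show "homologous_rel p X {} d (w - c)"
          using that by (simp add: homologous_rel_def algebra_simps)
      qed simp
      ultimately show ?thesis
        unfolding mult_relative_homology_group by auto
    qed
    then show "\<psi> (c + d) = \<psi> c + \<psi> d"
      unfolding \<psi>_def using hom_mult[OF hom carr[OF c] carr[OF d]] by simp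
  next
    fix c assume c: "singular_relcycle p X {} c"
    have "singular_relboundary_set p X {} \<in> carrier ?H"
      using group.is_monoid[OF group_relative_homology_group, THEN monoid.one_closed, of "int p" X "{}"]
      by simp
    then have "f (homologous_rel_set p X {} c) = f (singular_relboundary_set p X {})
        \<longleftrightarrow> homologous_rel_set p X {} c = singular_relboundary_set p X {}"
      using bij carr[OF c] by (auto simp: bij_betw_def inj_on_def)
    then show "\<psi> c = 0 \<longleftrightarrow> singular_relboundary p X {} c"
      unfolding \<psi>_def one homologous_rel_set_eq_relboundary .
  next
    fix n
    obtain C where "C \<in> carrier ?H" "f C = n"
      using bij by (metis UNIV_I bij_betw_imp_surj_on imageE)
    then show "\<exists>c. singular_relcycle p X {} c \<and> \<psi> c = n"
      by (auto simp: carrier_relative_homology_group \<psi>_def)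
  qed
qed

lemma trivial_homology_imp_boundary:
  assumes "trivial_group (homology_group (int p) X)" "singular_relcycle p X {} c"
  shows "singular_relboundary p X {} c"
proof -
  have "homologous_rel_set p X {} c \<in> carrier (homology_group (int p) X)"
    using assms(2) by (auto simp: carrier_relative_homology_group)
  then have "homologous_rel_set p X {} c = singular_relboundary_set p X {}"
    using assms(1) by (simp add: trivial_group_def)
  then show ?thesis
    by (simp only: homologous_rel_set_eq_relboundary)
qed

text \<open>The p-th homology group has no element of order 2. In degree p - 1 this is the vanishing
  of the Tor term with Z/2 that the universal coefficient theorem contributes to mod 2 homology in
  degree p.\<close>

definition no_two_torsion :: "nat \<Rightarrow> 'a topology \<Rightarrow> bool" where
  "no_two_torsion p X \<longleftrightarrow> (\<forall>e. singular_relcycle p X {} e \<longrightarrow>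
     singular_relboundary p X {} (e + e) \<longrightarrow> singular_relboundary p X {} e)"

lemma no_two_torsion_trivial: "trivial_group (homology_group (int p) X) \<Longrightarrow> no_two_torsion p X"
  by (simp add: no_two_torsion_def trivial_homology_imp_boundary)

lemma no_two_torsion_integer:
  assumes "homology_group (int p) X \<cong> integer_group"
  shows "no_two_torsion p X"
proof -
  obtain \<psi> :: "'a chain \<Rightarrow> int" where
    add: "\<And>c d. singular_relcycle p X {} c \<Longrightarrow> singular_relcycle p X {} d \<Longrightarrow> \<psi> (c + d) = \<psi> c + \<psi> d" and
    zero: "\<And>c. singular_relcycle p X {} c \<Longrightarrow> \<psi> c = 0 \<longleftrightarrow> singular_relboundary p X {} c"
    using infinite_cyclic_homology_imp_index[OF assms] by metis
  show ?thesis
    unfolding no_two_torsion_def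
  proof (intro allI impI)
    fix e assume e: "singular_relcycle p X {} e" and b: "singular_relboundary p X {} (e + e)"
    have "\<psi> (e + e) = 0"
      using zero[OF singular_relcycle_add[OF e e]] b by simp
    then show "singular_relboundary p X {} e"
      using add[OF e e] zero[OF e] by simp
  qed
qed

lemma frag_cmul_two: "frag_cmul 2 e = e + (e :: 'a chain)"
  using frag_cmul_distrib[of 1 1 e] by simp

text \<open>Chain groups are free abelian, so a factor 2 can be cancelled in an equation between
  chains.\<close>

lemma frag_double_eq_0: "e + e = (0 :: 'a chain) \<Longrightarrow> e = 0"
  by (rule poly_mapping_eqI) (metis double_zero lookup_add lookup_zero)

lemma subgroup_mod2_cycles: "subgroup (mod2_cycles p X) (chain_group p X)"
proof
  fix x y assume "x \<in> mod2_cycles p X" "y \<in> mod2_cycles p X"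
  then obtain e f where "singular_chain p X x" "singular_chain p X y"
    "singular_chain (p - 1) X e" "chain_boundary p x = frag_cmul 2 e"
    "singular_chain (p - 1) X f" "chain_boundary p y = frag_cmul 2 f"
    unfolding mod2_cycles_def by blast
  then show "x \<otimes>\<^bsub>chain_group p X\<^esub> y \<in> mod2_cycles p X"
    unfolding mod2_cycles_def
    by (auto simp: singular_chain_add chain_boundary_add frag_cmul_distrib2 intro!: exI[of _ "e + f"])
next
  fix x assume x: "x \<in> mod2_cycles p X"
  then obtain e where e: "singular_chain p X x"
    "singular_chain (p - 1) X e" "chain_boundary p x = frag_cmul 2 e"
    unfolding mod2_cycles_def by blast
  then have "inv\<^bsub>chain_group p X\<^esub> x = - x"
    by (simp add: singular_chain_def)
  with e show "inv\<^bsub>chain_group p X\<^esub> x \<in> mod2_cycles p X"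
    unfolding mod2_cycles_def
    by (auto simp: singular_chain_minus chain_boundary_minus frag_cmul_two intro!: exI[of _ "- e"])
qed (auto simp: mod2_cycles_def)

lemma mod2_boundaries_subset: "mod2_boundaries p X \<subseteq> mod2_cycles p X"
proof
  fix c assume "c \<in> mod2_boundaries p X"
  then obtain d e where d: "singular_chain (Suc p) X d" and e: "singular_chain p X e"
    and c: "c = chain_boundary (Suc p) d + frag_cmul 2 e"
    unfolding mod2_boundaries_def by blast
  have "chain_boundary p c = frag_cmul 2 (chain_boundary p e)"
    using chain_boundary_boundary[OF d] by (simp add: c chain_boundary_add chain_boundary_cmul)
  then show "c \<in> mod2_cycles p X"
    using d e unfolding mod2_cycles_def c
    by (auto intro!: singular_chain_add singular_chain_cmul singular_chain_boundary_alt singular_chain_boundary)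
qed

lemma subgroup_mod2_boundaries: "subgroup (mod2_boundaries p X) (chain_group p X)"
proof
  show "mod2_boundaries p X \<subseteq> carrier (chain_group p X)"
    using mod2_boundaries_subset[of p X] by (auto simp: mod2_cycles_def)
next
  fix x y assume "x \<in> mod2_boundaries p X" "y \<in> mod2_boundaries p X"
  then obtain d e d' e' where "singular_chain (Suc p) X d" "singular_chain p X e"
    "x = chain_boundary (Suc p) d + frag_cmul 2 e" "singular_chain (Suc p) X d'" "singular_chain p X e'"
    "y = chain_boundary (Suc p) d' + frag_cmul 2 e'"
    unfolding mod2_boundaries_def by blast
  then show "x \<otimes>\<^bsub>chain_group p X\<^esub> y \<in> mod2_boundaries p X"
    unfolding mod2_boundaries_def
    by (intro CollectI exI[of _ "d + d'"] exI[of _ "e + e'"])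
      (auto simp: singular_chain_add chain_boundary_add frag_cmul_distrib2)
next
  show "\<one>\<^bsub>chain_group p X\<^esub> \<in> mod2_boundaries p X"
    unfolding mod2_boundaries_def by (auto intro!: exI[of _ 0])
next
  fix x assume x: "x \<in> mod2_boundaries p X"
  then have "x \<in> mod2_cycles p X" using mod2_boundaries_subset by blast
  then have "inv\<^bsub>chain_group p X\<^esub> x = - x"
    by (simp add: mod2_cycles_def singular_chain_def)
  moreover obtain d e where "singular_chain (Suc p) X d" "singular_chain p X e"
    "x = chain_boundary (Suc p) d + frag_cmul 2 e"
    using x unfolding mod2_boundaries_def by blast
  then have "- x \<in> mod2_boundaries p X"
    unfolding mod2_boundaries_def
    by (intro CollectI exI[of _ "- d"] exI[of _ "- e"])
      (auto simp: singular_chain_minus chain_boundary_minus frag_cmul_two)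
  ultimately show "inv\<^bsub>chain_group p X\<^esub> x \<in> mod2_boundaries p X"
    by simp
qed

lemma group_mod2_homology_group: "group (mod2_homology_group p X)"
  and carrier_mod2_homology_group: "carrier (mod2_homology_group p X) =
    (\<lambda>c. (\<lambda>b. b + c) ` mod2_boundaries p X) ` mod2_cycles p X"
  and one_mod2_homology_group: "\<one>\<^bsub>mod2_homology_group p X\<^esub> = mod2_boundaries p X"
proof -
  let ?G = "subgroup_generated (chain_group p X) (mod2_cycles p X)"
  have carr: "carrier ?G = mod2_cycles p X"
    by (rule subgroup.carrier_subgroup_generated_subgroup[OF subgroup_mod2_cycles])
  have comm: "comm_group ?G"
    by (intro group.abelian_subgroup_generated group_chain_group abelian_chain_group)
  have "subgroup (mod2_boundaries p X) ?G"
    by (intro group.subgroup_of_subgroup_generated group_chain_group mod2_boundaries_subset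
        subgroup_mod2_boundaries)
  then have "mod2_boundaries p X \<lhd> ?G"
    using comm by (simp add: comm_group.normal_iff_subgroup)
  then show "group (mod2_homology_group p X)"
    unfolding mod2_homology_group_def by (rule normal.factorgroup_is_group)
  show "carrier (mod2_homology_group p X) =
    (\<lambda>c. (\<lambda>b. b + c) ` mod2_boundaries p X) ` mod2_cycles p X"
    unfolding mod2_homology_group_def
    by (auto simp: FactGroup_def RCOSETS_def r_coset_def carr)
  show "\<one>\<^bsub>mod2_homology_group p X\<^esub> = mod2_boundaries p X"
    by (simp add: mod2_homology_group_def FactGroup_def)
qed

text \<open>If the boundary of c is e + e, then e is a cycle whose double bounds. Without 2-torsion
  e itself bounds some f, and c - (f + f) is an integral cycle. In degree 0 every chain is already a
  cycle.\<close>

lemma mod2_cycle_lift: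
  assumes c: "c \<in> mod2_cycles p X" and tf: "p = 0 \<or> no_two_torsion (p - 1) X"
  obtains f z where "singular_chain p X f" "singular_relcycle p X {} z" "c = z + (f + f)"
proof -
  obtain e where e: "singular_chain p X c" "singular_chain (p - 1) X e"
      "chain_boundary p c = e + e"
    using c unfolding mod2_cycles_def frag_cmul_two by blast
  show ?thesis
  proof (cases "p = 0")
    case True
    then show ?thesis
      using e that[of 0 c] by (simp add: singular_cycle chain_boundary_def)
  next
    case False
    then obtain r where r: "p = Suc r" by (cases p) auto
    have "chain_boundary r (e + e) = 0"
      using chain_boundary_boundary_alt[of r X c] e r by simp
    then have "chain_boundary r e = 0"
      by (metis chain_boundary_add frag_double_eq_0)
    then have cyc: "singular_relcycle r X {} e"
      using e r by (simp add: singular_cycle)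
    moreover have "singular_relboundary r X {} (e + e)"
      using e r by (auto simp: singular_boundary)
    ultimately have "singular_relboundary r X {} e"
      using tf r by (simp add: no_two_torsion_def)
    then obtain f where f: "singular_chain p X f" "chain_boundary p f = e"
      by (auto simp: singular_boundary r)
    show ?thesis
      using f e by (intro that[of f "c - (f + f)"])
        (auto simp: singular_cycle chain_boundary_diff chain_boundary_add singular_chain_diff singular_chain_add)
  qed
qed

lemma mod2_boundaries_0: "0 \<in> mod2_boundaries p X"
  and mod2_boundaries_add:
    "c \<in> mod2_boundaries p X \<Longrightarrow> d \<in> mod2_boundaries p X \<Longrightarrow> c + d \<in> mod2_boundaries p X"
  and mod2_boundaries_double: "singular_chain p X c \<Longrightarrow> c + c \<in> mod2_boundaries p X"
  and mod2_boundaries_boundary: "singular_relboundary p X {} c \<Longrightarrow> c \<in> mod2_boundaries p X"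
  and mod2_boundaries_minus: "c \<in> mod2_boundaries p X \<Longrightarrow> - c \<in> mod2_boundaries p X"
proof -
  show "0 \<in> mod2_boundaries p X"
    using subgroup.one_closed[OF subgroup_mod2_boundaries[of p X]] by simp
  show "c \<in> mod2_boundaries p X \<Longrightarrow> d \<in> mod2_boundaries p X \<Longrightarrow> c + d \<in> mod2_boundaries p X"
    using subgroup.m_closed[OF subgroup_mod2_boundaries[of p X], of c d] by simp
  show "c \<in> mod2_boundaries p X" if "singular_relboundary p X {} c"
    using that unfolding mod2_boundaries_def singular_boundary
    by (force intro: exI[of _ 0])
  show "c + c \<in> mod2_boundaries p X" if "singular_chain p X c"
    using that unfolding mod2_boundaries_def frag_cmul_two
    by (force intro: exI[of _ 0])
  show "- c \<in> mod2_boundaries p X" if c: "c \<in> mod2_boundaries p X"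
  proof -
    have "inv\<^bsub>chain_group p X\<^esub> c = - c"
      using subsetD[OF mod2_boundaries_subset c]
      by (simp add: mod2_cycles_def singular_chain_def)
    then show ?thesis
      using subgroup.m_inv_closed[OF subgroup_mod2_boundaries c] by simp
  qed
qed

lemma mod2_coset_eq_iff:
  "(\<lambda>b. b + c) ` mod2_boundaries p X = (\<lambda>b. b + d) ` mod2_boundaries p X
    \<longleftrightarrow> c - d \<in> mod2_boundaries p X" (is "?L c = ?L d \<longleftrightarrow> _")
proof
  assume "?L c = ?L d"
  then have "0 + c \<in> ?L d"
    using mod2_boundaries_0 by blast
  then show "c - d \<in> mod2_boundaries p X"
    by (auto simp: algebra_simps)
next
  assume cd: "c - d \<in> mod2_boundaries p X"
  have sub: "?L c \<subseteq> ?L d" if "c - d \<in> mod2_boundaries p X" for c d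
  proof
    fix x assume "x \<in> ?L c"
    then obtain b where b: "b \<in> mod2_boundaries p X" "x = b + c" by blast
    then have "x = (b + (c - d)) + d" by simp
    then show "x \<in> ?L d"
      using mod2_boundaries_add[OF b(1) that] by blast
  qed
  have "d - c \<in> mod2_boundaries p X"
    using mod2_boundaries_minus[OF cd] by simp
  then show "?L c = ?L d"
    using sub cd by blast
qed

text \<open>A mod 2 cycle is an integral cycle plus a double by \<open>mod2_cycle_lift\<close>; the
  former bounds integrally, the latter is a mod 2 boundary.\<close>

lemma mod2_betti_trivial:
  assumes "trivial_group (homology_group (int p) X)" "p = 0 \<or> no_two_torsion (p - 1) X"
  shows "mod2_betti p X = 0"
proof -
  have B: "c \<in> mod2_boundaries p X" if c: "c \<in> mod2_cycles p X" for c
  proof -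
    obtain f z where f: "singular_chain p X f" "singular_relcycle p X {} z" "c = z + (f + f)"
      using mod2_cycle_lift[OF c assms(2)] .
    then show ?thesis
      by (auto intro: mod2_boundaries_add mod2_boundaries_double mod2_boundaries_boundary
          trivial_homology_imp_boundary[OF assms(1)])
  qed
  have "carrier (mod2_homology_group p X) = {\<one>\<^bsub>mod2_homology_group p X\<^esub>}"
  proof -
    have "(\<lambda>b. b + c) ` mod2_boundaries p X = mod2_boundaries p X" if "c \<in> mod2_cycles p X" for c
      using mod2_coset_eq_iff[of c p X 0] B[OF that] by simp
    moreover have "0 \<in> mod2_cycles p X"
      using mod2_boundaries_0 mod2_boundaries_subset by blast
    ultimately show ?thesis
      unfolding carrier_mod2_homology_group one_mod2_homology_group by auto
  qed
  then have "generate (mod2_homology_group p X) {} = carrier (mod2_homology_group p X)"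
    using group.generate_empty[OF group_mod2_homology_group] by metis
  then show ?thesis
    unfolding mod2_betti_def by (intro Least_eq_0 exI[of _ "{}"]) simp
qed

text \<open>The parity of the index decides the mod 2 class, so the group consists of the class
  \<open>B\<close> of boundaries and the class \<open>C\<close> of a cycle of index 1.\<close>

lemma mod2_betti_integer:
  assumes "homology_group (int p) X \<cong> integer_group" "p = 0 \<or> no_two_torsion (p - 1) X"
  shows "mod2_betti p X = 1"
proof -
  let ?M = "mod2_homology_group p X"
  obtain \<psi> :: "'a chain \<Rightarrow> int" where
    add: "\<And>c d. singular_relcycle p X {} c \<Longrightarrow> singular_relcycle p X {} d \<Longrightarrow> \<psi> (c + d) = \<psi> c + \<psi> d" and
    zero: "\<And>c. singular_relcycle p X {} c \<Longrightarrow> \<psi> c = 0 \<longleftrightarrow> singular_relboundary p X {} c" and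
    surj: "\<And>n. \<exists>c. singular_relcycle p X {} c \<and> \<psi> c = n"
    using infinite_cyclic_homology_imp_index[OF assms(1)] by metis
  obtain z where z: "singular_relcycle p X {} z" "\<psi> z = 1"
    using surj by blast
  have diff: "\<psi> (c - d) = \<psi> c - \<psi> d"
    if "singular_relcycle p X {} c" "singular_relcycle p X {} d" for c d
    using add[OF singular_relcycle_diff[OF that] that(2)] by simp
  define B where "B = mod2_boundaries p X"
  define C where "C = (\<lambda>b. b + z) ` mod2_boundaries p X"
  have zc: "z \<in> mod2_cycles p X"
    using z by (auto simp: singular_cycle mod2_cycles_def intro!: exI[of _ 0])
  have "z \<notin> B"
  proof
    assume "z \<in> B"
    then obtain d e where d: "singular_chain (Suc p) X d" and e: "singular_chain p X e"
      and eq: "z = chain_boundary (Suc p) d + (e + e)"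
      unfolding B_def mod2_boundaries_def frag_cmul_two by blast
    \<comment> \<open>Since z and the boundary of d are cycles, so is e, and then the index of z
      would be twice that of e.\<close>
    have "chain_boundary p (e + e) = 0"
      using z chain_boundary_boundary_alt[OF d]
      by (simp add: eq singular_cycle chain_boundary_add)
    then have "chain_boundary p e = 0"
      by (metis chain_boundary_add frag_double_eq_0)
    then have cyc: "singular_relcycle p X {} e"
      using e by (simp add: singular_cycle)
    have bd: "singular_relboundary p X {} (chain_boundary (Suc p) d)"
      using d by (auto simp: singular_boundary)
    then have bc: "singular_relcycle p X {} (chain_boundary (Suc p) d)"
      by (rule singular_relboundary_imp_relcycle)
    have "\<psi> z = 2 * \<psi> e"
      using add[OF bc singular_relcycle_add[OF cyc cyc]] add[OF cyc cyc] zero[OF bc] bd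
      by (simp add: eq)
    then show False
      using z by presburger
  qed
  then have "B \<noteq> C"
    using mod2_coset_eq_iff[of 0 p X z] mod2_boundaries_minus[of "- z" p X] by (auto simp: B_def C_def)
  have carr: "carrier ?M = {B, C}"
  proof
    show "carrier ?M \<subseteq> {B, C}"
    proof
      fix K assume "K \<in> carrier ?M"
      then obtain c where c: "c \<in> mod2_cycles p X" "K = (\<lambda>b. b + c) ` B"
        by (auto simp: carrier_mod2_homology_group B_def)
      obtain f y where f: "singular_chain p X f" and y: "singular_relcycle p X {} y"
        and cf: "c = y + (f + f)"
        using mod2_cycle_lift[OF c(1) assms(2)] .
      \<comment> \<open>Subtracting twice a cycle of half the index, rounded down, leaves an index
        of 0 or 1 without changing the mod 2 class.\<close>
      obtain w where w: "singular_relcycle p X {} w" "\<psi> w = \<psi> y div 2"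
        using surj by blast
      have wc: "singular_chain p X w"
        using w by (simp add: singular_cycle)
      have yw: "singular_relcycle p X {} (y - (w + w))" "\<psi> (y - (w + w)) = \<psi> y mod 2"
        using w y by (auto simp: singular_relcycle_diff singular_relcycle_add diff add
            minus_mult_div_eq_mod[symmetric])
      have eq: "y + (f + f) - g = (y - (w + w) - g) + ((w + w) + (f + f))" for g
        by simp
      have ww: "(w + w) + (f + f) \<in> B"
        unfolding B_def by (intro mod2_boundaries_add mod2_boundaries_double f wc)
      show "K \<in> {B, C}"
      proof (cases "even (\<psi> y)")
        case True
        then have "y - (w + w) - 0 \<in> B"
          using zero[OF yw(1)] yw(2) by (auto simp: B_def intro: mod2_boundaries_boundary)
        then have "c - 0 \<in> B"
          unfolding cf eq using ww unfolding B_def by (rule mod2_boundaries_add)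
        then have "K = B"
          using mod2_coset_eq_iff[of c p X 0] by (simp add: B_def c(2))
        then show ?thesis by simp
      next
        case False
        then have "\<psi> (y - (w + w) - z) = 0"
          using diff[OF yw(1) z(1)] yw(2) z(2) by presburger
        then have "y - (w + w) - z \<in> B"
          using zero[OF singular_relcycle_diff[OF yw(1) z(1)]]
          by (auto simp: B_def intro: mod2_boundaries_boundary)
        then have "c - z \<in> B"
          unfolding cf eq using ww unfolding B_def by (rule mod2_boundaries_add)
        then have "K = C"
          using mod2_coset_eq_iff[of c p X z] by (simp add: B_def C_def c(2))
        then show ?thesis by simp
      qed
    qed
    have "B = (\<lambda>b. b + 0) ` B" "0 \<in> mod2_cycles p X"
      using mod2_boundaries_0 mod2_boundaries_subset by (simp, blast)
    then show "{B, C} \<subseteq> carrier ?M"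
      using zc unfolding carrier_mod2_homology_group C_def B_def by blast
  qed
  have gen: "generate ?M {C} = carrier ?M"
  proof
    show "generate ?M {C} \<subseteq> carrier ?M"
      using carr by (intro group.generate_incl[OF group_mod2_homology_group]) simp
    have "B \<in> generate ?M {C}"
      using generate.one[of ?M "{C}"] by (simp add: one_mod2_homology_group B_def)
    then show "carrier ?M \<subseteq> generate ?M {C}"
      using carr by (auto intro: generate.incl)
  qed
  show ?thesis
    unfolding mod2_betti_def
  proof (rule Least_equality)
    show "\<exists>S. finite S \<and> card S = 1 \<and> S \<subseteq> carrier ?M \<and> generate ?M S = carrier ?M"
      using gen carr by (intro exI[of _ "{C}"]) simp
  next
    fix k assume "\<exists>S. finite S \<and> card S = k \<and> S \<subseteq> carrier ?M \<and> generate ?M S = carrier ?M"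
    then obtain S where S: "finite S" "card S = k" "generate ?M S = carrier ?M" by blast
    \<comment> \<open>The empty set generates only the trivial class, so a generating set has at
      least one element.\<close>
    have "generate ?M {} = {B}"
      using group.generate_empty[OF group_mod2_homology_group, of p X]
      by (simp add: one_mod2_homology_group B_def)
    then have "S \<noteq> {}"
      using S(3) carr \<open>B \<noteq> C\<close> by auto
    then show "1 \<le> k"
      using S by (metis One_nat_def Suc_leI card_gt_0_iff)
  qed
qed

section \<open>The projective line\<close>

lemma continuous_map_into_Euclidean_space:
  "continuous_map X (Euclidean_space n) f \<longleftrightarrow>
    f ` topspace X \<subseteq> aff n \<and> (\<forall>k. continuous_map X euclideanreal (\<lambda>x. f x k))"
  unfolding Euclidean_space_def continuous_map_in_subtopology continuous_map_componentwise_UNIV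
  by auto

lemma continuous_map_Euclidean_space_coord:
  "continuous_map (subtopology (Euclidean_space n) S) euclideanreal (\<lambda>x. x k)"
  unfolding Euclidean_space_def subtopology_subtopology
  by (rule continuous_map_from_subtopology) (rule continuous_map_product_projection, simp)

lemma pline_eq_iff:
  assumes "x \<noteq> (\<lambda>i. 0)"
  shows "pline x = pline y \<longleftrightarrow> (\<exists>c. c \<noteq> 0 \<and> y = (\<lambda>i. c * x i))"
proof
  assume eq: "pline x = pline y"
  have "x \<in> pline x"
    unfolding pline_def by (auto intro: image_eqI[of _ _ 1])
  then obtain d where d: "x = (\<lambda>i. d * y i)"
    unfolding eq by (auto simp: pline_def)
  with assms have "d \<noteq> 0" by auto
  then show "\<exists>c. c \<noteq> 0 \<and> y = (\<lambda>i. c * x i)"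
    using d by (intro exI[of _ "1 / d"]) (simp add: fun_eq_iff)
next
  assume "\<exists>c. c \<noteq> 0 \<and> y = (\<lambda>i. c * x i)"
  then obtain c where c: "c \<noteq> 0" "y = (\<lambda>i. c * x i)" by blast
  have "range (\<lambda>d i. d * x i) \<subseteq> range (\<lambda>d i. d * y i)"
    using c(1) by (auto simp: c(2) image_iff intro!: exI[of _ "_ / c"])
  moreover have "range (\<lambda>d i. d * y i) \<subseteq> range (\<lambda>d i. d * x i)"
    by (auto simp: c(2) image_iff mult.assoc[symmetric])
  ultimately show "pline x = pline y"
    unfolding pline_def by blast
qed

lemma aff_2_cases:
  obtains "i = 0" | "i = 1" | "\<And>x. x \<in> aff 2 \<Longrightarrow> x i = 0"
proof -
  consider "i = 0" | "i = 1" | "2 \<le> i" by linarith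
  then show thesis
    by cases (auto simp: topspace_Euclidean_space intro: that)
qed

lemma aff_2_nonzero:
  assumes "x \<in> aff 2" "x \<noteq> (\<lambda>i. 0)"
  shows "x 0 \<noteq> 0 \<or> x 1 \<noteq> 0"
proof (rule ccontr)
  assume *: "\<not> (x 0 \<noteq> 0 \<or> x 1 \<noteq> 0)"
  have "x i = 0" for i
    by (rule aff_2_cases[of i]) (use * assms(1) in auto)
  then show False
    using assms(2) by blast
qed

text \<open>A continuous parametrization of the projective line by a closed interval, from which
  compactness and path connectedness are inherited.\<close>

definition angle_line :: "real \<Rightarrow> (nat \<Rightarrow> real) set" where
  "angle_line \<theta> = pline (\<lambda>i. if i = 0 then cos \<theta> else if i = 1 then sin \<theta> else 0)"

lemma continuous_map_angle_line: "continuous_map euclideanreal (proj_topology 1) angle_line"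
proof -
  let ?v = "\<lambda>\<theta> i. if i = (0::nat) then cos \<theta> else if i = 1 then sin \<theta> else (0::real)"
  have "continuous_map euclideanreal (subtopology (Euclidean_space (Suc 1)) (- {\<lambda>i. 0})) ?v"
    unfolding continuous_map_in_subtopology continuous_map_into_Euclidean_space
  proof (intro conjI allI)
    show "continuous_map euclideanreal euclideanreal (\<lambda>x. ?v x k)" for k
      by (cases "k = 0"; cases "k = 1") (auto intro!: continuous_intros)
    show "?v \<in> topspace euclideanreal \<rightarrow> - {\<lambda>i. 0}"
    proof (intro Pi_I ComplI notI)
      fix \<theta> assume "?v \<theta> \<in> {\<lambda>i. 0}"
      then have "cos \<theta> = 0" "sin \<theta> = 0"
        by (auto simp: fun_eq_iff split: if_splits)
      then show False
        using sin_cos_squared_add[of \<theta>] by simp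
    qed
    show "?v ` topspace euclideanreal \<subseteq> aff (Suc 1)"
      by (auto simp: topspace_Euclidean_space)
  qed
  from continuous_map_compose[OF this quotient_imp_continuous_map[OF quotient_map_pline[of 1]]]
  show ?thesis
    by (simp add: o_def angle_line_def[abs_def])
qed

lemma angle_line_surj: "angle_line ` {0..2 * pi} = pspace 1"
proof
  show "angle_line ` {0..2 * pi} \<subseteq> pspace 1"
    using continuous_map_angle_line by (auto simp: continuous_map_def topspace_proj_topology)
  show "pspace 1 \<subseteq> angle_line ` {0..2 * pi}"
  proof
    fix L assume "L \<in> pspace 1"
    then obtain x where x: "x \<in> aff 2" "x \<noteq> (\<lambda>i. 0)" "L = pline x"
      by (auto simp: pspace_def numeral_2_eq_2)
    define r where "r = sqrt ((x 0)\<^sup>2 + (x 1)\<^sup>2)"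
    have "x 0 \<noteq> 0 \<or> x 1 \<noteq> 0"
      using x by (intro aff_2_nonzero)
    then have r: "r > 0"
      by (simp add: r_def sum_power2_gt_zero_iff)
    have "(x 0 / r)\<^sup>2 + (x 1 / r)\<^sup>2 = ((x 0)\<^sup>2 + (x 1)\<^sup>2) / r\<^sup>2"
      by (simp add: power_divide add_divide_distrib)
    also have "\<dots> = r\<^sup>2 / r\<^sup>2"
      by (simp add: r_def)
    finally have "(x 0 / r)\<^sup>2 + (x 1 / r)\<^sup>2 = 1"
      using r by simp
    then obtain \<theta> where \<theta>: "0 \<le> \<theta>" "\<theta> < 2 * pi" "x 0 / r = cos \<theta>" "x 1 / r = sin \<theta>"
      by (rule sincos_total_2pi)
    have "pline x = angle_line \<theta>"
      unfolding angle_line_def pline_eq_iff[OF x(2)]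
    proof (intro exI conjI)
      show "1 / r \<noteq> 0" using r by simp
      show "(\<lambda>i. if i = 0 then cos \<theta> else if i = 1 then sin \<theta> else 0) = (\<lambda>i. 1 / r * x i)"
      proof
        fix i :: nat
        show "(if i = 0 then cos \<theta> else if i = 1 then sin \<theta> else 0) = 1 / r * x i"
          by (rule aff_2_cases[of i]) (use \<theta> x(1) in \<open>auto simp: topspace_Euclidean_space\<close>)
      qed
    qed
    then show "L \<in> angle_line ` {0..2 * pi}"
      using \<theta> x by auto
  qed
qed

lemma proj_topology_1_compact: "compactin (proj_topology 1) (pspace 1)"
  and proj_topology_1_path_connected: "path_connected_space (proj_topology 1)"
proof -
  show "compactin (proj_topology 1) (pspace 1)"
    unfolding angle_line_surj[symmetric]
    by (rule image_compactin[OF _ continuous_map_angle_line]) simp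
  have "path_connectedin euclideanreal {0..2 * pi}"
    by (simp add: convex_imp_path_connected)
  then have "path_connectedin (proj_topology 1) (angle_line ` {0..2 * pi})"
    by (rule path_connectedin_continuous_map_image[OF continuous_map_angle_line])
  then show "path_connected_space (proj_topology 1)"
    unfolding angle_line_surj
    by (metis path_connectedin_topspace topspace_proj_topology)
qed

text \<open>The homeomorphism doubles the angle of a line, which makes it independent of the direction
  chosen on the line.\<close>

lemma proj_topology_1_homeomorphic: "proj_topology 1 homeomorphic_space nsphere 1"
proof -
  let ?T = "subtopology (Euclidean_space (Suc 1)) (- {\<lambda>i. 0})"
  define N where "N x = (x 0)\<^sup>2 + (x 1)\<^sup>2" for x :: "nat \<Rightarrow> real"
  \<comment> \<open>These are the cosine and sine of the doubled angle of x, written as rational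
    functions that are invariant under scaling.\<close>
  define h where "h x = (\<lambda>i::nat. if i = 0 then ((x 0)\<^sup>2 - (x 1)\<^sup>2) / N x
      else if i = 1 then 2 * x 0 * x 1 / N x else 0)" for x :: "nat \<Rightarrow> real"
  have N: "N x \<noteq> 0" if "x \<in> topspace ?T" for x
  proof -
    have "x \<in> aff 2" "x \<noteq> (\<lambda>i. 0)"
      using that by (auto simp: numeral_2_eq_2)
    then have "x 0 \<noteq> 0 \<or> x 1 \<noteq> 0"
      by (intro aff_2_nonzero)
    then show ?thesis
      by (simp add: N_def)
  qed
  have sph: "h x \<in> topspace (nsphere 1)" if "x \<in> topspace ?T" for x
  proof -
    have "((x 0)\<^sup>2 - (x 1)\<^sup>2)\<^sup>2 + (2 * x 0 * x 1)\<^sup>2 = (N x)\<^sup>2"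
      by (simp add: N_def power2_eq_square algebra_simps)
    then have "(((x 0)\<^sup>2 - (x 1)\<^sup>2) / N x)\<^sup>2 + (2 * x 0 * x 1 / N x)\<^sup>2 = 1"
      using N[OF that] by (simp add: power_divide add_divide_distrib[symmetric])
    then show ?thesis
      by (simp add: h_def nsphere)
  qed
  have cont: "continuous_map ?T (nsphere 1) h"
    unfolding nsphere_def continuous_map_in_subtopology[of _ _ "{x. _ x}"] continuous_map_into_Euclidean_space
  proof (intro conjI allI)
    show "continuous_map ?T euclideanreal (\<lambda>x. h x k)" for k
      unfolding h_def N_def
      by (cases "k = 0"; cases "k = 1"; use N in \<open>auto simp: N_def intro!: continuous_intros
            continuous_map_Euclidean_space_coord simp del: topspace_subtopology\<close>)
    show "h \<in> topspace ?T \<rightarrow> {x. (\<Sum>i\<le>1. (x i)\<^sup>2) = 1}" "h ` topspace ?T \<subseteq> aff (Suc 1)"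
      using sph by (auto simp: nsphere_def)
  qed
  have fibre: "h x = h y \<longleftrightarrow> pline x = pline y" if x: "x \<in> topspace ?T" and y: "y \<in> topspace ?T" for x y
  proof
    have nz: "x \<noteq> (\<lambda>i. 0)" using x by auto
    assume "pline x = pline y"
    then obtain c where c: "c \<noteq> 0" "y = (\<lambda>i. c * x i)"
      unfolding pline_eq_iff[OF nz] by blast
    have "N y = c\<^sup>2 * N x"
      by (simp add: N_def c power_mult_distrib algebra_simps)
    moreover have "h y = (\<lambda>i. if i = 0 then c\<^sup>2 * ((x 0)\<^sup>2 - (x 1)\<^sup>2) / N y
        else if i = 1 then c\<^sup>2 * (2 * x 0 * x 1) / N y else 0)"
    proof -
      have "(y 0)\<^sup>2 - (y 1)\<^sup>2 = c\<^sup>2 * ((x 0)\<^sup>2 - (x 1)\<^sup>2)"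
        and "2 * y 0 * y 1 = c\<^sup>2 * (2 * x 0 * x 1)"
        by (simp_all add: c(2) power2_eq_square algebra_simps)
      then show ?thesis
        by (simp only: h_def)
    qed
    ultimately show "h x = h y"
      using c(1) by (simp add: h_def fun_eq_iff)
  next
    have nz: "x \<noteq> (\<lambda>i. 0)" using x by auto
    have aff: "x \<in> aff 2" "y \<in> aff 2" using x y by (auto simp: numeral_2_eq_2)
    assume eq: "h x = h y"
    have e0: "((x 0)\<^sup>2 - (x 1)\<^sup>2) / N x = ((y 0)\<^sup>2 - (y 1)\<^sup>2) / N y"
      using fun_cong[OF eq, of 0] by (simp add: h_def)
    have e1: "2 * x 0 * x 1 / N x = 2 * y 0 * y 1 / N y"
      using fun_cong[OF eq, of 1] by (simp add: h_def)
    define s where "s = N y / N x"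
    have "N x \<ge> 0" "N y \<ge> 0"
      by (simp_all add: N_def)
    then have s: "N y = s * N x" "s > 0"
      using N[OF x] N[OF y] by (simp_all add: s_def less_le)
    have y0: "(y 0)\<^sup>2 - (y 1)\<^sup>2 = s * ((x 0)\<^sup>2 - (x 1)\<^sup>2)"
    proof -
      have "(y 0)\<^sup>2 - (y 1)\<^sup>2 = ((x 0)\<^sup>2 - (x 1)\<^sup>2) / N x * N y"
        unfolding e0 using N[OF y] by simp
      then show ?thesis
        using s N[OF x] by simp
    qed
    have y01: "y 0 * y 1 = s * (x 0 * x 1)"
      using e1 s N[OF x] by (simp add: field_simps)
    have y02: "(y 0)\<^sup>2 = s * (x 0)\<^sup>2" and y12: "(y 1)\<^sup>2 = s * (x 1)\<^sup>2"
      using y0 s(1) by (auto simp: N_def algebra_simps)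
    \<comment> \<open>The number s is the square of the wanted factor. The squares of the
      coordinates determine c only up to sign on each coordinate; the product
      \<open>y 0 * y 1\<close> makes the two signs agree.\<close>
    obtain c where c: "c \<noteq> 0" "y 0 = c * x 0" "y 1 = c * x 1"
    proof (cases "x 0 = 0")
      case True
      then have "x 1 \<noteq> 0" using N[OF x] by (simp add: N_def)
      moreover have "y 0 = 0" using y02 True by simp
      moreover have "y 1 \<noteq> 0" using y12 s calculation by auto
      ultimately show ?thesis
        using True by (intro that[of "y 1 / x 1"]) auto
    next
      case False
      have y0': "y 0 \<noteq> 0" using y02 s False by auto
      have "y 1 = y 0 / x 0 * x 1"
      proof -
        have "y 0 * (y 1 * x 0) = (y 0 * y 1) * x 0" by simp
        also have "\<dots> = (s * (x 0)\<^sup>2) * x 1"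
          unfolding y01 by (simp add: power2_eq_square)
        also have "\<dots> = y 0 * (y 0 * x 1)"
          unfolding y02[symmetric] by (simp add: power2_eq_square)
        finally have "y 0 * (y 1 * x 0) = y 0 * (y 0 * x 1)" .
        then show ?thesis
          using y0' False by (simp add: field_simps)
      qed
      then show ?thesis using y0' False
        by (intro that[of "y 0 / x 0"]) simp_all
    qed
    have "y = (\<lambda>i. c * x i)"
    proof
      fix i :: nat
      consider "i = 0" | "i = 1" | "2 \<le> i" by linarith
      then show "y i = c * x i"
        using c aff by cases (auto simp: topspace_Euclidean_space)
    qed
    then show "pline x = pline y"
      using c unfolding pline_eq_iff[OF nz] by blast
  qed
  \<comment> \<open>Constancy of h on the fibres of \<open>pline\<close> yields a map on the
    quotient, and separation of the fibres makes it injective. A continuous bijection from a compact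
    space to a Hausdorff space is a homeomorphism.\<close>
  obtain g where g: "continuous_map (proj_topology 1) (nsphere 1) g"
    "g ` topspace (proj_topology 1) = h ` topspace ?T"
    "\<And>x. x \<in> topspace ?T \<Longrightarrow> g (pline x) = h x"
    by (rule quotient_map_lift_exists[OF quotient_map_pline cont fibre[THEN iffD2]])
      (assumption | rule that)+
  have "homeomorphic_map (proj_topology 1) (nsphere 1) g"
  proof (rule continuous_imp_homeomorphic_map[OF g(1)])
    show "compact_space (proj_topology 1)"
      using proj_topology_1_compact by (simp add: compact_space_def topspace_proj_topology)
    show "Hausdorff_space (nsphere 1)"
      unfolding nsphere_def by (intro Hausdorff_space_subtopology Hausdorff_Euclidean_space)
    show "inj_on g (topspace (proj_topology 1))"
    proof (rule inj_onI)
      fix K L assume KL: "K \<in> topspace (proj_topology 1)" "L \<in> topspace (proj_topology 1)" "g K = g L"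
      have "\<exists>x. x \<in> topspace ?T \<and> M = pline x" if "M \<in> topspace (proj_topology 1)" for M
        using that by (auto simp: topspace_proj_topology pspace_def)
      then obtain x y where "x \<in> topspace ?T" "K = pline x" "y \<in> topspace ?T" "L = pline y"
        using KL by meson
      then show "K = L"
        using g(3)[of x] g(3)[of y] fibre[of x y] KL(3) by metis
    qed
    show "g ` topspace (proj_topology 1) = topspace (nsphere 1)"
      unfolding g(2)
    proof
      show "h ` topspace ?T \<subseteq> topspace (nsphere 1)"
        using sph by blast
      show "topspace (nsphere 1) \<subseteq> h ` topspace ?T"
      proof
        fix z assume "z \<in> topspace (nsphere 1)"
        then have z: "(z 0)\<^sup>2 + (z 1)\<^sup>2 = 1" "z \<in> aff 2"
          by (auto simp: nsphere numeral_2_eq_2 topspace_Euclidean_space)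
        then obtain \<theta> where \<theta>: "z 0 = cos \<theta>" "z 1 = sin \<theta>"
          using sincos_total_2pi[OF z(1)] by metis
        \<comment> \<open>Halving the angle gives a preimage under the doubling map.\<close>
        let ?x = "\<lambda>i::nat. if i = 0 then cos (\<theta> / 2) else if i = 1 then sin (\<theta> / 2) else 0"
        have "cos (2 * (\<theta> / 2)) = (cos (\<theta> / 2))\<^sup>2 - (sin (\<theta> / 2))\<^sup>2"
          "sin (2 * (\<theta> / 2)) = 2 * sin (\<theta> / 2) * cos (\<theta> / 2)"
          by (rule cos_double, rule sin_double)
        then have dbl: "(cos (\<theta> / 2))\<^sup>2 - (sin (\<theta> / 2))\<^sup>2 = z 0"
          "2 * cos (\<theta> / 2) * sin (\<theta> / 2) = z 1"
          using \<theta> by simp_all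
        have "N ?x = 1"
          by (simp add: N_def)
        have "h ?x = z"
        proof
          fix i :: nat
          consider "i = 0" | "i = 1" | "2 \<le> i" by linarith
          then show "h ?x i = z i"
            using dbl \<open>N ?x = 1\<close> z(2) by cases (auto simp: h_def topspace_Euclidean_space)
        qed
        moreover have "?x \<noteq> (\<lambda>i. 0)"
        proof
          assume eq: "?x = (\<lambda>i. 0)"
          have "cos (\<theta> / 2) = 0" "sin (\<theta> / 2) = 0"
            using fun_cong[OF eq, of 0] fun_cong[OF eq, of 1] by simp_all
          then show False
            using sin_cos_squared_add[of "\<theta> / 2"] by simp
        qed
        then have "?x \<in> topspace ?T"
          by (auto simp: topspace_Euclidean_space)
        ultimately show "z \<in> h ` topspace ?T" by blast
      qed
    qed
  qed
  then show ?thesis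
    by (rule homeomorphic_map_imp_homeomorphic_space)
qed

lemma mod2_betti_singleton:
  assumes "topspace X = {a}"
  shows "mod2_betti p X = (if p = 0 then 1 else 0)"
proof -
  have Z: "homology_group (int 0) X \<cong> integer_group"
    using homology_coefficients[OF assms] by simp
  have T: "trivial_group (homology_group (int p) X)" if "p \<noteq> 0" for p
    using homology_dimension_axiom[OF assms] that by simp
  have "no_two_torsion p X" for p
    using Z T[of p] by (cases "p = 0") (auto intro: no_two_torsion_integer no_two_torsion_trivial)
  then show ?thesis
    using mod2_betti_integer[OF Z] mod2_betti_trivial[OF T] by auto
qed

lemma mod2_betti_proj_line:
  "mod2_betti p (proj_topology 1) = (if p \<le> 1 then 1 else 0)"
proof -
  let ?X = "proj_topology 1"
  have "pspace 1 \<noteq> {}"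
    unfolding angle_line_surj[symmetric] by simp
  then have Z0: "homology_group (int 0) ?X \<cong> integer_group"
    using isomorphic_integer_zeroth_homology_group[OF proj_topology_1_path_connected]
    by (simp add: topspace_proj_topology)
  have iso: "homology_group (int p) ?X \<cong> homology_group (int p) (nsphere 1)" for p
    by (rule homeomorphic_space_imp_isomorphic_homology_groups[OF proj_topology_1_homeomorphic])
  have Z1: "homology_group (int 1) ?X \<cong> integer_group"
    using iso[of 1] reduced_homology_group_nsphere(1)[of 1]
    by (simp add: un_reduced_homology_group iso_trans)
  have T: "trivial_group (homology_group (int p) ?X)" if "p > 1" for p
    using iso[of p] reduced_homology_group_nsphere(2)[of "int p" 1] that
    by (simp add: un_reduced_homology_group isomorphic_group_triviality)
  have "no_two_torsion p ?X" for p
  proof -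
    consider "p = 0" | "p = 1" | "p > 1" by linarith
    then show ?thesis
      using Z0 Z1 T[of p] by cases (auto intro: no_two_torsion_integer no_two_torsion_trivial)
  qed
  then show ?thesis
    by (cases "p = 0"; cases "p = 1") (use mod2_betti_integer[OF Z0] mod2_betti_integer[OF Z1] mod2_betti_trivial[OF T] in auto)
qed

section \<open>Constructible sets\<close>

lemma in_aff: "x \<in> aff N \<longleftrightarrow> (\<forall>i\<ge>N. x i = 0)"
  by (simp add: topspace_Euclidean_space)

lemma polyfun_minus: "f \<in> polyfun N \<Longrightarrow> (\<lambda>x. - f x) \<in> polyfun N"
  using polyfun.mult[OF polyfun.const[of "-1" N]] by simp

lemma polyfun_diff: "f \<in> polyfun N \<Longrightarrow> g \<in> polyfun N \<Longrightarrow> (\<lambda>x. f x - g x) \<in> polyfun N"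
  using polyfun.add[OF _ polyfun_minus] by simp

lemma polyfun_power: "f \<in> polyfun N \<Longrightarrow> (\<lambda>x. f x ^ k) \<in> polyfun N"
  by (induction k) (auto intro: polyfun.intros)

lemmas polyfun_intros = polyfun.intros polyfun_minus polyfun_diff polyfun_power

lemma polyfun_compose:
  assumes "f \<in> polyfun M" "\<And>j. j < M \<Longrightarrow> (\<lambda>x. \<Phi> x j) \<in> polyfun N"
  shows "(\<lambda>x. f (\<Phi> x)) \<in> polyfun N"
  using assms by (induction rule: polyfun.induct) (auto intro: polyfun.intros)

lemma hom_poly_raise:
  assumes "hom_poly (Suc N) k F"
  shows "hom_poly (Suc N) (j + k) (\<lambda>x. x 0 ^ j * F x)"
  using assms by (auto simp: hom_poly_def power_add power_mult_distrib intro!: polyfun_intros)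

lemma hom_poly_add: "hom_poly N k F \<Longrightarrow> hom_poly N k G \<Longrightarrow> hom_poly N k (\<lambda>x. F x + G x)"
  by (auto simp: hom_poly_def distrib_left intro: polyfun.intros)

text \<open>The exponent k is not claimed to be the degree of f. Summands are brought to a common
  degree by powers of \<open>x 0\<close>, which is harmless because the formula is used only off the
  hyperplane at infinity.\<close>

lemma homogenization:
  assumes "f \<in> polyfun N"
  shows "\<exists>k F. hom_poly (Suc N) k F \<and> (\<forall>x. x 0 \<noteq> 0 \<longrightarrow> F x = x 0 ^ k * f (\<lambda>i. x (Suc i) / x 0))"
  using assms
proof (induction rule: polyfun.induct)
  case (const c)
  show ?case
    by (rule exI[of _ 0], rule exI[of _ "\<lambda>x. c"]) (auto simp: hom_poly_def intro: polyfun_intros)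
next
  case (coord i)
  then show ?case
    by (intro exI[of _ 1] exI[of _ "\<lambda>x. x (Suc i)"]) (auto simp: hom_poly_def intro: polyfun_intros)
next
  case (add f g)
  then obtain k F l G where
    F: "hom_poly (Suc N) k F" "\<And>x. x 0 \<noteq> 0 \<Longrightarrow> F x = x 0 ^ k * f (\<lambda>i. x (Suc i) / x 0)" and
    G: "hom_poly (Suc N) l G" "\<And>x. x 0 \<noteq> 0 \<Longrightarrow> G x = x 0 ^ l * g (\<lambda>i. x (Suc i) / x 0)"
    by metis
  have "hom_poly (Suc N) (l + k) (\<lambda>x. x 0 ^ l * F x + x 0 ^ k * G x)"
    using hom_poly_add[OF hom_poly_raise[OF F(1)] hom_poly_raise[OF G(1), of k, unfolded add.commute[of k l]]]
    by simp
  then show ?case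
    by (intro exI[of _ "l + k"] exI[of _ "\<lambda>x. x 0 ^ l * F x + x 0 ^ k * G x"])
      (auto simp: F G power_add algebra_simps)
next
  case (mult f g)
  then obtain k F l G where
    F: "hom_poly (Suc N) k F" "\<And>x. x 0 \<noteq> 0 \<Longrightarrow> F x = x 0 ^ k * f (\<lambda>i. x (Suc i) / x 0)" and
    G: "hom_poly (Suc N) l G" "\<And>x. x 0 \<noteq> 0 \<Longrightarrow> G x = x 0 ^ l * g (\<lambda>i. x (Suc i) / x 0)"
    by metis
  have "hom_poly (Suc N) (k + l) (\<lambda>x. F x * G x)"
    using F G by (auto simp: hom_poly_def power_add intro: polyfun.intros)
  then show ?case
    by (intro exI[of _ "k + l"] exI[of _ "\<lambda>x. F x * G x"]) (auto simp: F G power_add)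
qed

text \<open>This class has an induction principle through which membership in \<open>AS\<close> is
  proved uniformly, and it is closed under Boolean operations and polynomial preimages.\<close>

inductive_set constructible :: "nat \<Rightarrow> (nat \<Rightarrow> real) set set" for N :: nat where
  zero: "f \<in> polyfun N \<Longrightarrow> {x \<in> aff N. f x = 0} \<in> constructible N"
| compl: "A \<in> constructible N \<Longrightarrow> aff N - A \<in> constructible N"
| union: "A \<in> constructible N \<Longrightarrow> B \<in> constructible N \<Longrightarrow> A \<union> B \<in> constructible N"

lemma constructible_subset: "A \<in> constructible N \<Longrightarrow> A \<subseteq> aff N"
  by (induction rule: constructible.induct) auto

lemma constructible_conj:
  assumes "{x \<in> aff N. P x} \<in> constructible N" "{x \<in> aff N. Q x} \<in> constructible N"
  shows "{x \<in> aff N. P x \<and> Q x} \<in> constructible N"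
proof -
  have "{x \<in> aff N. P x \<and> Q x} = aff N - ((aff N - {x \<in> aff N. P x}) \<union> (aff N - {x \<in> aff N. Q x}))"
    by blast
  then show ?thesis
    by (simp only:) (intro constructible.intros(2,3) assms)
qed

lemma constructible_not:
  assumes "{x \<in> aff N. P x} \<in> constructible N"
  shows "{x \<in> aff N. \<not> P x} \<in> constructible N"
proof -
  have "{x \<in> aff N. \<not> P x} = aff N - {x \<in> aff N. P x}"
    by blast
  then show ?thesis
    by (simp only:) (intro constructible.compl assms)
qed

lemma constructible_eq:
  assumes "f \<in> polyfun N" "g \<in> polyfun N"
  shows "{x \<in> aff N. f x = g x} \<in> constructible N"
  using constructible.zero[OF polyfun_diff[OF assms]] by simp

lemma constructible_const: "{x \<in> aff N. P} \<in> constructible N"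
proof (cases P)
  case True
  then show ?thesis
    using constructible_eq[OF polyfun.const[of 0] polyfun.const[of 0], of N] by simp
next
  case False
  then show ?thesis
    using constructible_eq[OF polyfun.const[of 0] polyfun.const[of 1], of N] by simp
qed

lemma constructible_ball:
  assumes "finite I" "\<And>i. i \<in> I \<Longrightarrow> {x \<in> aff N. P i x} \<in> constructible N"
  shows "{x \<in> aff N. \<forall>i\<in>I. P i x} \<in> constructible N"
  using assms
proof (induction I rule: finite_induct)
  case empty
  then show ?case using constructible_const[of N True] by (simp only: ball_simps)
next
  case (insert i I)
  then have "{x \<in> aff N. P i x \<and> (\<forall>i\<in>I. P i x)} \<in> constructible N"
    by (intro constructible_conj) simp_all
  then show ?case by (simp only: ball_simps)
qed

lemma constructible_preimage:
  assumes "A \<in> constructible M" "\<And>j. j < M \<Longrightarrow> (\<lambda>x. \<Phi> x j) \<in> polyfun N"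
    and "\<And>x. x \<in> aff N \<Longrightarrow> \<Phi> x \<in> aff M"
  shows "{x \<in> aff N. \<Phi> x \<in> A} \<in> constructible N"
  using assms(1)
proof (induction rule: constructible.induct)
  case (zero f)
  have "{x \<in> aff N. \<Phi> x \<in> {x \<in> aff M. f x = 0}} = {x \<in> aff N. f (\<Phi> x) = 0}"
    using assms(3) by blast
  then show ?case
    using constructible.zero[OF polyfun_compose[OF zero assms(2)]] by (simp only:)
next
  case (compl A)
  have "{x \<in> aff N. \<Phi> x \<in> aff M - A} = aff N - {x \<in> aff N. \<Phi> x \<in> A}"
    using assms(3) by blast
  then show ?case
    using constructible.compl[OF compl.IH] by (simp only:)
next
  case (union A B)
  have "{x \<in> aff N. \<Phi> x \<in> A \<union> B} = {x \<in> aff N. \<Phi> x \<in> A} \<union> {x \<in> aff N. \<Phi> x \<in> B}"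
    by blast
  then show ?case
    using constructible.union[OF union.IH] by (simp only:)
qed

lemma constructible_Diff:
  assumes A: "A \<in> constructible N" and B: "B \<in> constructible N"
  shows "A - B \<in> constructible N"
proof -
  have "A - B = aff N - ((aff N - A) \<union> B)"
    using constructible_subset[OF A] by blast
  then show ?thesis
    by (simp only:) (intro constructible.intros(2,3) A B)
qed

section \<open>The affine chart and homogeneous coordinates\<close>

lemma affine_chart_nonzero: "case_nat (1::real) x \<noteq> (\<lambda>i. 0)"
proof
  assume "case_nat (1::real) x = (\<lambda>i. 0)"
  from fun_cong[OF this, of 0] show False by simp
qed

lemma affine_chart_inj: "affine_chart x = affine_chart y \<longleftrightarrow> x = y"
proof
  assume "affine_chart x = affine_chart y"
  then obtain c where c: "case_nat 1 y = (\<lambda>i. c * case_nat (1::real) x i)"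
    unfolding affine_chart_def pline_eq_iff[OF affine_chart_nonzero] by blast
  have "c = 1"
    using fun_cong[OF c, of 0] by simp
  then show "x = y"
    using fun_cong[OF c, of "Suc _"] by (simp add: fun_eq_iff)
qed simp

lemma affine_chart_in_pspace: "x \<in> aff N \<Longrightarrow> affine_chart x \<in> pspace N"
  unfolding affine_chart_def pspace_def
  using affine_chart_nonzero by (auto intro!: imageI simp: in_aff split: nat.split)

lemma pline_eq_affine_chart:
  assumes "x 0 \<noteq> 0"
  shows "pline x = affine_chart (\<lambda>i. x (Suc i) / x 0)"
proof -
  have "x = (\<lambda>i. x 0 * (case i of 0 \<Rightarrow> 1 | Suc j \<Rightarrow> x (Suc j) / x 0))"
    using assms by (auto simp: fun_eq_iff split: nat.split)
  then show ?thesis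
    using assms pline_eq_iff[OF affine_chart_nonzero] unfolding affine_chart_def by metis
qed

lemma pline_in_affine_chart_iff:
  "pline x \<in> affine_chart ` A \<longleftrightarrow> x 0 \<noteq> 0 \<and> (\<lambda>i. x (Suc i) / x 0) \<in> A"
proof
  assume "pline x \<in> affine_chart ` A"
  then obtain a where a: "a \<in> A" "pline x = pline (case_nat 1 a)"
    by (auto simp: affine_chart_def)
  then obtain c where "c \<noteq> 0" "x = (\<lambda>i. c * case_nat 1 a i)"
    using pline_eq_iff[OF affine_chart_nonzero] by metis
  then show "x 0 \<noteq> 0 \<and> (\<lambda>i. x (Suc i) / x 0) \<in> A"
    using a by simp
qed (auto simp: pline_eq_affine_chart)

lemma vanishes_on_pline_iff:
  "hom_poly N k F \<Longrightarrow> vanishes_on F (pline x) \<longleftrightarrow> F x = 0"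
proof
  assume F: "hom_poly N k F"
  {
    assume "vanishes_on F (pline x)"
    then have "F (\<lambda>i. 1 * x i) = 0"
      unfolding vanishes_on_def pline_def by blast
    then show "F x = 0" by simp
  }
  assume "F x = 0"
  then show "vanishes_on F (pline x)"
    using F by (auto simp: vanishes_on_def pline_def hom_poly_def)
qed

lemma semialg_Int:
  assumes "A \<in> semialg N" "B \<in> semialg N" "A \<subseteq> aff N"
  shows "A \<inter> B \<in> semialg N"
proof -
  have "A \<inter> B = aff N - ((aff N - A) \<union> (aff N - B))"
    using assms(3) by blast
  then show ?thesis
    by (simp only:) (intro semialg.compl semialg.union assms)
qed

lemma semialg_nonzero:
  assumes "f \<in> polyfun N"
  shows "{x \<in> aff N. f x \<noteq> 0} \<in> semialg N"
proof -
  have "{x \<in> aff N. f x \<noteq> 0} = {x \<in> aff N. 0 < f x * f x}"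
    by (auto simp: zero_less_mult_iff)
  then show ?thesis
    using semialg.pos[OF polyfun.mult[OF assms assms]] by simp
qed

lemma semialg_zero:
  assumes "f \<in> polyfun N"
  shows "{x \<in> aff N. f x = 0} \<in> semialg N"
proof -
  have "{x \<in> aff N. f x = 0} = aff N - {x \<in> aff N. f x \<noteq> 0}"
    by blast
  then show ?thesis
    using semialg.compl[OF semialg_nonzero[OF assms]] by (simp only:)
qed

text \<open>Homogenization clears the denominators in a condition on the chart. The condition
  \<open>x 0 \<noteq> 0\<close> has to be carried through the induction, since complements are taken
  inside the chart and not in the whole cone.\<close>

lemma constructible_cone_semialg:
  assumes "A \<in> constructible N"
  shows "{x \<in> aff (Suc N). x 0 \<noteq> 0 \<and> (\<lambda>i. x (Suc i) / x 0) \<in> A} \<in> semialg (Suc N)"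
proof -
  have aff: "(\<lambda>i. x (Suc i) / x 0) \<in> aff N" if "x \<in> aff (Suc N)" for x :: "nat \<Rightarrow> real"
    using that by (simp add: in_aff)
  have X: "{x \<in> aff (Suc N). x 0 \<noteq> 0} \<in> semialg (Suc N)"
    by (rule semialg_nonzero) (simp add: polyfun_intros)
  show ?thesis
    using assms
  proof (induction rule: constructible.induct)
    case (zero f)
    obtain k F where F: "hom_poly (Suc N) k F"
      "\<And>x. x 0 \<noteq> 0 \<Longrightarrow> F x = x 0 ^ k * f (\<lambda>i. x (Suc i) / x 0)"
      using homogenization[OF zero] by metis
    have "{x \<in> aff (Suc N). x 0 \<noteq> 0 \<and> (\<lambda>i. x (Suc i) / x 0) \<in> {x \<in> aff N. f x = 0}}
        = {x \<in> aff (Suc N). x 0 \<noteq> 0} \<inter> {x \<in> aff (Suc N). F x = 0}"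
      using aff F(2) by auto
    moreover have "F \<in> polyfun (Suc N)"
      using F(1) by (simp add: hom_poly_def)
    ultimately show ?case
      using semialg_Int[OF X semialg_zero] by simp
  next
    case (compl A)
    have "{x \<in> aff (Suc N). x 0 \<noteq> 0 \<and> (\<lambda>i. x (Suc i) / x 0) \<in> aff N - A}
        = {x \<in> aff (Suc N). x 0 \<noteq> 0} \<inter>
          (aff (Suc N) - {x \<in> aff (Suc N). x 0 \<noteq> 0 \<and> (\<lambda>i. x (Suc i) / x 0) \<in> A})"
      using aff by auto
    then show ?case
      using semialg_Int[OF X semialg.compl[OF compl.IH]] by simp
  next
    case (union A B)
    have "{x \<in> aff (Suc N). x 0 \<noteq> 0 \<and> (\<lambda>i. x (Suc i) / x 0) \<in> A \<union> B}
        = {x \<in> aff (Suc N). x 0 \<noteq> 0 \<and> (\<lambda>i. x (Suc i) / x 0) \<in> A}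
        \<union> {x \<in> aff (Suc N). x 0 \<noteq> 0 \<and> (\<lambda>i. x (Suc i) / x 0) \<in> B}"
      by auto
    then show ?case
      using semialg.union[OF union.IH] by (simp only:)
  qed
qed

text \<open>A power series that is not identically zero has an isolated zero at its centre or none
  there.\<close>

lemma analytic_eventually_zero_or_nonzero:
  fixes f :: "real \<Rightarrow> real"
  assumes "f has_fps_expansion F"
  shows "(\<forall>\<^sub>F s in at 0. f s = 0) \<or> (\<forall>\<^sub>F s in at 0. f s \<noteq> 0)"
proof -
  have ev: "\<forall>\<^sub>F s in nhds 0. eval_fps F s = f s" and r: "fps_conv_radius F > 0"
    using assms by (auto simp: has_fps_expansion_def)
  have ev': "\<forall>\<^sub>F s in at 0. eval_fps F s = f s"
    using ev by (simp add: eventually_nhds_conv_at)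
  \<comment> \<open>\<open>powser_0_nonzero\<close> requires the value 0 at the centre, so a nonzero
    constant term is treated separately, by continuity.\<close>
  consider "F = 0" | "fps_nth F 0 \<noteq> 0" | m where "F \<noteq> 0" "fps_nth F 0 = 0" "fps_nth F m \<noteq> 0" "m > 0"
  proof (cases "fps_nth F 0 = 0 \<and> F \<noteq> 0")
    case True
    then obtain m where "fps_nth F m \<noteq> 0" by (auto simp: fps_eq_iff)
    then show ?thesis using True that(3)[of m] by (cases m) auto
  qed (use that in auto)
  then show ?thesis
  proof cases
    case 1
    then show ?thesis using ev' by (auto elim: eventually_mono)
  next
    case 2
    have "continuous (at 0) f"
      by (rule has_fps_expansion_imp_continuous[OF assms])
    moreover have "f 0 = fps_nth F 0"
      using eventually_nhds_x_imp_x[OF ev] by (simp add: eval_fps_at_0)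
    ultimately have "(f \<longlongrightarrow> fps_nth F 0) (at 0)"
      by (simp add: isCont_def)
    then show ?thesis
      using tendsto_imp_eventually_ne 2 by blast
  next
    case 3
    obtain \<epsilon> where \<epsilon>: "0 < \<epsilon>" "ereal \<epsilon> < fps_conv_radius F"
      using ereal_dense2[OF r] by (metis ereal_less(2))
    have sums: "(\<lambda>n. fps_nth F n * (x - 0) ^ n) sums eval_fps F x" if "norm (x - 0) < \<epsilon>" for x
      using that \<epsilon> sums_eval_fps[of x F] by (simp add: less_trans[of "ereal \<bar>x\<bar>" "ereal \<epsilon>"])
    have "eval_fps F 0 = 0"
      using 3(2) by (simp add: eval_fps_at_0)
    then obtain s where s: "0 < s" "\<And>z. z \<in> cball 0 s - {0} \<Longrightarrow> eval_fps F z \<noteq> 0"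
      using powser_0_nonzero[OF \<epsilon>(1) sums, of m] 3 by metis
    have "\<forall>\<^sub>F z in at 0. z \<in> cball 0 s - {0}"
      using s(1) by (auto simp: eventually_at dist_commute intro!: exI[of _ s])
    then have "\<forall>\<^sub>F z in at 0. f z \<noteq> 0"
      using ev' by eventually_elim (use s(2) in metis)
    then show ?thesis ..
  qed
qed

lemma real_analytic_at_0_has_fps_expansion:
  assumes "real_analytic_at f 0"
  shows "\<exists>F. f has_fps_expansion F"
proof -
  obtain r a where r: "r > 0" "\<And>s. \<bar>s\<bar> < r \<Longrightarrow> (\<lambda>k. a k * s ^ k) sums f s"
    using assms by (auto simp: real_analytic_at_def)
  have "\<forall>\<^sub>F s in nhds 0. (\<lambda>k. fps_nth (Abs_fps a) k * s ^ k) sums f s"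
    using r by (auto simp: eventually_nhds_metric dist_real_def)
  then show ?thesis
    using has_fps_expansionI by blast
qed

lemma polyfun_has_fps_expansion:
  fixes x :: "real \<Rightarrow> nat \<Rightarrow> real"
  assumes "f \<in> polyfun N" "\<And>i. \<exists>F. (\<lambda>s. x s i) has_fps_expansion F"
  shows "\<exists>F. (\<lambda>s. f (x s)) has_fps_expansion F"
  using assms(1)
proof (induction rule: polyfun.induct)
  case (add f g)
  then show ?case using has_fps_expansion_add by blast
next
  case (mult f g)
  then show ?case using has_fps_expansion_mult by blast
qed (use assms(2) in auto)

text \<open>Along an analytic arc a polynomial vanishes identically or nowhere in a punctured
  neighbourhood, so membership in a constructible set is eventually constant.\<close>

lemma constructible_eventually_const:
  fixes x :: "real \<Rightarrow> nat \<Rightarrow> real"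
  assumes "A \<in> constructible N"
    and an: "\<And>i. real_analytic_at (\<lambda>s. x s i) 0"
    and aff: "\<forall>\<^sub>F s in at 0. x s \<in> aff (Suc N)"
  shows "\<exists>b. \<forall>\<^sub>F s in at 0. (x s 0 \<noteq> 0 \<and> (\<lambda>i. x s (Suc i) / x s 0) \<in> A) = b"
  using assms(1)
proof (induction rule: constructible.induct)
  case (zero f)
  obtain k F where F: "hom_poly (Suc N) k F"
    "\<And>x. x 0 \<noteq> 0 \<Longrightarrow> F x = x 0 ^ k * f (\<lambda>i. x (Suc i) / x 0)"
    using homogenization[OF zero] by metis
  have ex: "\<exists>G. (\<lambda>s. x s i) has_fps_expansion G" for i
    using real_analytic_at_0_has_fps_expansion[OF an] .
  obtain G where "(\<lambda>s. F (x s)) has_fps_expansion G"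
    using polyfun_has_fps_expansion[of F "Suc N" x, OF _ ex] F(1) unfolding hom_poly_def by blast
  then have 1: "(\<forall>\<^sub>F s in at 0. F (x s) = 0) \<or> (\<forall>\<^sub>F s in at 0. F (x s) \<noteq> 0)"
    by (rule analytic_eventually_zero_or_nonzero)
  have 2: "(\<forall>\<^sub>F s in at 0. x s 0 = 0) \<or> (\<forall>\<^sub>F s in at 0. x s 0 \<noteq> 0)"
    using ex[of 0] analytic_eventually_zero_or_nonzero by blast
  have eq: "\<forall>\<^sub>F s in at 0. (x s 0 \<noteq> 0 \<and> (\<lambda>i. x s (Suc i) / x s 0) \<in> {x \<in> aff N. f x = 0})
      = (x s 0 \<noteq> 0 \<and> F (x s) = 0)"
    using aff by eventually_elim (auto simp: F(2) in_aff)
  have "\<exists>b. \<forall>\<^sub>F s in at 0. (x s 0 \<noteq> 0 \<and> F (x s) = 0) = b"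
  proof (cases "\<forall>\<^sub>F s in at 0. x s 0 = 0")
    case True
    then show ?thesis by (intro exI[of _ False]) (auto elim: eventually_mono)
  next
    case False
    then have ne: "\<forall>\<^sub>F s in at 0. x s 0 \<noteq> 0" using 2 by blast
    from 1 show ?thesis
    proof
      assume "\<forall>\<^sub>F s in at 0. F (x s) = 0"
      with ne show ?thesis
        by (intro exI[of _ True]) (auto elim: eventually_elim2)
    next
      assume "\<forall>\<^sub>F s in at 0. F (x s) \<noteq> 0"
      then show ?thesis
        by (intro exI[of _ False]) (auto elim: eventually_mono)
    qed
  qed
  then obtain b where "\<forall>\<^sub>F s in at 0. (x s 0 \<noteq> 0 \<and> F (x s) = 0) = b" ..
  with eq have "\<forall>\<^sub>F s in at 0. (x s 0 \<noteq> 0 \<and> (\<lambda>i. x s (Suc i) / x s 0) \<in> {x \<in> aff N. f x = 0}) = b"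
    by eventually_elim simp
  then show ?case ..
next
  case (compl A)
  \<comment> \<open>Whether the arc runs in the hyperplane at infinity must be decided first: there
    it meets neither the chart image of A nor that of the complement, so the answer is not simply
    negated.\<close>
  have 2: "(\<forall>\<^sub>F s in at 0. x s 0 = 0) \<or> (\<forall>\<^sub>F s in at 0. x s 0 \<noteq> 0)"
    using real_analytic_at_0_has_fps_expansion[OF an] analytic_eventually_zero_or_nonzero by blast
  obtain b where b: "\<forall>\<^sub>F s in at 0. (x s 0 \<noteq> 0 \<and> (\<lambda>i. x s (Suc i) / x s 0) \<in> A) = b"
    using compl.IH ..
  from 2 show ?case
  proof
    assume "\<forall>\<^sub>F s in at 0. x s 0 = 0"
    then show ?thesis
      by (intro exI[of _ False]) (auto elim: eventually_mono)
  next
    assume "\<forall>\<^sub>F s in at 0. x s 0 \<noteq> 0"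
    with b aff have "\<forall>\<^sub>F s in at 0. (x s 0 \<noteq> 0 \<and> (\<lambda>i. x s (Suc i) / x s 0) \<in> aff N - A) = (\<not> b)"
      by eventually_elim (auto simp: in_aff)
    then show ?thesis ..
  qed
next
  case (union A B)
  obtain b c where "\<forall>\<^sub>F s in at 0. (x s 0 \<noteq> 0 \<and> (\<lambda>i. x s (Suc i) / x s 0) \<in> A) = b"
    "\<forall>\<^sub>F s in at 0. (x s 0 \<noteq> 0 \<and> (\<lambda>i. x s (Suc i) / x s 0) \<in> B) = c"
    using union.IH by blast
  then have "\<forall>\<^sub>F s in at 0. (x s 0 \<noteq> 0 \<and> (\<lambda>i. x s (Suc i) / x s 0) \<in> A \<union> B) = (b \<or> c)"
    by eventually_elim blast
  then show ?case ..
qed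

lemma arc_symmetric_constructible:
  assumes A: "A \<in> constructible N"
  shows "arc_symmetric N (affine_chart ` A)"
  unfolding arc_symmetric_def
proof (intro conjI allI impI)
  have "{x \<in> aff (Suc N) - {\<lambda>i. 0}. pline x \<in> affine_chart ` A}
      = {x \<in> aff (Suc N). x 0 \<noteq> 0 \<and> (\<lambda>i. x (Suc i) / x 0) \<in> A}"
    by (auto simp: pline_in_affine_chart_iff)
  then show "proj_semialg N (affine_chart ` A)"
    using constructible_cone_semialg[OF A] constructible_subset[OF A] affine_chart_in_pspace
    unfolding proj_semialg_def by auto
next
  fix \<epsilon> :: real and \<gamma>
  assume \<epsilon>: "0 < \<epsilon>" and \<gamma>: "analytic_arc N \<epsilon> \<gamma>" "\<gamma> ` {-\<epsilon><..<0} \<subseteq> affine_chart ` A"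
  then have "0 \<in> {-\<epsilon><..<\<epsilon>}" by simp
  then obtain x :: "real \<Rightarrow> nat \<Rightarrow> real" where
    x: "\<And>i. real_analytic_at (\<lambda>s. x s i) 0"
    and ev: "\<forall>\<^sub>F s in nhds 0. x s \<in> aff (Suc N) - {\<lambda>i. 0} \<and> \<gamma> s = pline (x s)"
    using \<gamma>(1) unfolding analytic_arc_def by blast
  have ev': "\<forall>\<^sub>F s in at 0. x s \<in> aff (Suc N) - {\<lambda>i. 0} \<and> \<gamma> s = pline (x s)"
    using ev by (simp add: eventually_nhds_conv_at)
  then have aff: "\<forall>\<^sub>F s in at 0. x s \<in> aff (Suc N)"
    by eventually_elim simp
  obtain b where b: "\<forall>\<^sub>F s in at 0. (x s 0 \<noteq> 0 \<and> (\<lambda>i. x s (Suc i) / x s 0) \<in> A) = b"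
    using constructible_eventually_const[OF A x aff] ..
  have mem: "\<forall>\<^sub>F s in at 0. (\<gamma> s \<in> affine_chart ` A) = b"
    using b ev' by eventually_elim (simp add: pline_in_affine_chart_iff)
  then obtain d where d: "d > 0" "\<And>s. s \<noteq> 0 \<Longrightarrow> \<bar>s\<bar> < d \<Longrightarrow> (\<gamma> s \<in> affine_chart ` A) = b"
    unfolding eventually_at by (auto simp: dist_real_def)
  define e where "e = min d \<epsilon>"
  \<comment> \<open>A single parameter on the negative side, where the arc is known to lie in the
    set, shows that the constant truth value b is true.\<close>
  have "- (e / 2) \<in> {-\<epsilon><..<0}" "- (e / 2) \<noteq> 0" "\<bar>- (e / 2)\<bar> < d"
    using d(1) \<epsilon> by (auto simp: e_def)
  then have b
    using d(2) \<gamma>(2) by blast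
  then have "\<gamma> ` {0<..<e} \<subseteq> affine_chart ` A"
    using d(2) by (auto simp: e_def)
  moreover have "e > 0" "e \<le> \<epsilon>"
    using d(1) \<epsilon> by (auto simp: e_def)
  ultimately show "\<exists>\<epsilon>'>0. \<epsilon>' \<le> \<epsilon> \<and> \<gamma> ` {0<..<\<epsilon>'} \<subseteq> affine_chart ` A"
    by blast
qed

lemma AS_constructible: "A \<in> constructible N \<Longrightarrow> affine_chart ` A \<in> AS"
  using arc_symmetric_constructible unfolding AS_def by blast

section \<open>Polynomial isomorphisms\<close>

definition polymap :: "nat \<Rightarrow> nat \<Rightarrow> ((nat \<Rightarrow> real) \<Rightarrow> nat \<Rightarrow> real) \<Rightarrow> bool" where
  "polymap N M \<Phi> \<longleftrightarrow> (\<forall>j<M. (\<lambda>x. \<Phi> x j) \<in> polyfun N) \<and> (\<forall>x\<in>aff N. \<Phi> x \<in> aff M)"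

text \<open>The Zariski closure without its points at infinity. It is Zariski open in the closure
  and serves as the domain on which a polynomial map is regular.\<close>

definition affine_closure :: "nat \<Rightarrow> (nat \<Rightarrow> real) set \<Rightarrow> (nat \<Rightarrow> real) set set" where
  "affine_closure N A =
     zariski_closure N (affine_chart ` A) - {L \<in> pspace N. vanishes_on (\<lambda>x. x 0) L}"

lemma hom_poly_coord0: "hom_poly (Suc N) 1 (\<lambda>x. x 0)"
  by (simp add: hom_poly_def polyfun.coord)

lemma zariski_closed_single: "hom_poly (Suc N) k F \<Longrightarrow> zariski_closed N {L \<in> pspace N. vanishes_on F L}"
  unfolding zariski_closed_def by (rule exI[of _ "{F}"]) auto

lemma zariski_closed_pspace: "zariski_closed N (pspace N)"
  unfolding zariski_closed_def by (rule exI[of _ "{}"]) auto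

lemma zariski_closed_empty: "zariski_closed N {}"
proof -
  have "{L \<in> pspace N. vanishes_on (\<lambda>x. 1) L} = {}"
    by (auto simp: vanishes_on_def pspace_def pline_def)
  moreover have "zariski_closed N {L \<in> pspace N. vanishes_on (\<lambda>x. 1) L}"
    by (rule zariski_closed_single[of N 0]) (simp add: hom_poly_def polyfun.const)
  ultimately show ?thesis
    by (simp only:)
qed

lemma affine_closure_iff:
  assumes "A \<subseteq> aff N"
  shows "L \<in> affine_closure N A \<longleftrightarrow> (\<exists>y\<in>aff N. L = affine_chart y \<and> L \<in> zariski_closure N (affine_chart ` A))"
proof
  assume L: "L \<in> affine_closure N A"
  have "zariski_closure N (affine_chart ` A) \<subseteq> pspace N"
    unfolding zariski_closure_def using zariski_closed_pspace assms affine_chart_in_pspace by blast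
  then obtain x where x: "x \<in> aff (Suc N)" "L = pline x"
    using L unfolding affine_closure_def pspace_def by blast
  have "x 0 \<noteq> 0"
  proof
    assume "x 0 = 0"
    then have "vanishes_on (\<lambda>x. x 0) L"
      using vanishes_on_pline_iff[OF hom_poly_coord0] x by blast
    then show False
      using L x \<open>zariski_closure N (affine_chart ` A) \<subseteq> pspace N\<close> unfolding affine_closure_def by blast
  qed
  then have "L = affine_chart (\<lambda>i. x (Suc i) / x 0)"
    using x pline_eq_affine_chart by blast
  moreover have "(\<lambda>i. x (Suc i) / x 0) \<in> aff N"
    using x by (simp add: in_aff)
  ultimately show "\<exists>y\<in>aff N. L = affine_chart y \<and> L \<in> zariski_closure N (affine_chart ` A)"
    using L unfolding affine_closure_def by blast
next
  assume "\<exists>y\<in>aff N. L = affine_chart y \<and> L \<in> zariski_closure N (affine_chart ` A)"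
  then obtain y where y: "L = affine_chart y" "L \<in> zariski_closure N (affine_chart ` A)" by blast
  have "\<not> vanishes_on (\<lambda>x. x 0) (pline (case_nat 1 y))"
    unfolding vanishes_on_pline_iff[OF hom_poly_coord0] by simp
  then show "L \<in> affine_closure N A"
    using y unfolding affine_closure_def affine_chart_def by blast
qed

text \<open>The homogenization of f defines a closed set that contains the chart image of A, hence
  also its closure.\<close>

lemma zariski_closure_vanishes:
  assumes f: "f \<in> polyfun N" and A: "A \<subseteq> aff N" "\<And>a. a \<in> A \<Longrightarrow> f a = 0"
    and y: "affine_chart y \<in> zariski_closure N (affine_chart ` A)"
  shows "f y = 0"
proof -
  obtain k F where F: "hom_poly (Suc N) k F"
    "\<And>x. x 0 \<noteq> 0 \<Longrightarrow> F x = x 0 ^ k * f (\<lambda>i. x (Suc i) / x 0)"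
    using homogenization[OF f] by metis
  have Ff: "vanishes_on F (affine_chart a) \<longleftrightarrow> f a = 0" for a
    unfolding affine_chart_def vanishes_on_pline_iff[OF F(1)] by (simp add: F(2))
  have "affine_chart ` A \<subseteq> {L \<in> pspace N. vanishes_on F L}"
    using A Ff affine_chart_in_pspace by blast
  then have "affine_chart y \<in> {L \<in> pspace N. vanishes_on F L}"
    using y zariski_closed_single[OF F(1)] unfolding zariski_closure_def by blast
  then show ?thesis
    using Ff by blast
qed

lemma inv_affine_chart: "inv_into UNIV affine_chart (affine_chart x) = x"
  by (rule inv_f_f) (simp add: inj_on_def affine_chart_inj)

text \<open>Continuity in the Zariski topology: a form vanishing on B, restricted to the chart and
  composed with \<open>\<Phi>\<close>, is a polynomial vanishing on A, hence on the closure of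
  A.\<close>

lemma polymap_maps_closure:
  assumes \<Phi>: "polymap N M \<Phi>" and A: "A \<subseteq> aff N" and B: "B \<subseteq> aff M" and AB: "\<Phi> ` A \<subseteq> B"
    and y: "y \<in> aff N" "affine_chart y \<in> zariski_closure N (affine_chart ` A)"
  shows "affine_chart (\<Phi> y) \<in> zariski_closure M (affine_chart ` B)"
  unfolding zariski_closure_def
proof (rule InterI)
  fix Z assume "Z \<in> {Z. zariski_closed M Z \<and> affine_chart ` B \<subseteq> Z}"
  then obtain S where S: "\<And>f. f \<in> S \<Longrightarrow> \<exists>k. hom_poly (Suc M) k f"
    "Z = {L \<in> pspace M. \<forall>f\<in>S. vanishes_on f L}" and BZ: "affine_chart ` B \<subseteq> Z"
    unfolding zariski_closed_def by blast
  have "vanishes_on f (affine_chart (\<Phi> y))" if f: "f \<in> S" for f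
  proof -
    obtain k where k: "hom_poly (Suc M) k f" using S(1)[OF f] ..
    have van: "vanishes_on f (affine_chart b) \<longleftrightarrow> f (case_nat 1 b) = 0" for b
      unfolding affine_chart_def using vanishes_on_pline_iff[OF k] .
    have "(\<lambda>x. f (case_nat 1 (\<Phi> x))) \<in> polyfun N"
    proof (rule polyfun_compose[of f "Suc M"])
      show "f \<in> polyfun (Suc M)" using k by (simp add: hom_poly_def)
      show "(\<lambda>x. case_nat 1 (\<Phi> x) j) \<in> polyfun N" if "j < Suc M" for j
        using that \<Phi> by (cases j) (auto simp: polymap_def intro: polyfun.const)
    qed
    moreover have "f (case_nat 1 (\<Phi> a)) = 0" if "a \<in> A" for a
      using that AB BZ f S(2) van by blast
    ultimately have "f (case_nat 1 (\<Phi> y)) = 0"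
      using zariski_closure_vanishes[OF _ A _ y(2), of "\<lambda>x. f (case_nat 1 (\<Phi> x))"] by blast
    then show ?thesis using van by blast
  qed
  moreover have "affine_chart (\<Phi> y) \<in> pspace M"
    using \<Phi> y(1) affine_chart_in_pspace unfolding polymap_def by blast
  ultimately show "affine_chart (\<Phi> y) \<in> Z"
    using S(2) by blast
qed

lemma polymap_homogenization:
  assumes "polymap N M \<Phi>"
  shows "\<exists>K F. (\<forall>j\<le>M. hom_poly (Suc N) K (F j)) \<and> F 0 = (\<lambda>x. x 0 ^ K) \<and>
    (\<forall>j x. j < M \<longrightarrow> x 0 \<noteq> 0 \<longrightarrow> F (Suc j) x = x 0 ^ K * \<Phi> (\<lambda>i. x (Suc i) / x 0) j)"
proof -
  have "\<exists>k G. hom_poly (Suc N) k G \<and>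
      (\<forall>x. x 0 \<noteq> 0 \<longrightarrow> G x = x 0 ^ k * \<Phi> (\<lambda>i. x (Suc i) / x 0) j)" if "j < M" for j
    using homogenization[of "\<lambda>x. \<Phi> x j" N] assms that unfolding polymap_def by blast
  then obtain k G where g: "\<And>j. j < M \<Longrightarrow> hom_poly (Suc N) (k j) (G j)"
    "\<And>j x. j < M \<Longrightarrow> x 0 \<noteq> 0 \<Longrightarrow> G j x = x 0 ^ k j * \<Phi> (\<lambda>i. x (Suc i) / x 0) j"
    by metis
  \<comment> \<open>The sum bounds the degrees of all component homogenizations; each is raised to
    degree K by a power of \<open>x 0\<close>, and the constant first coordinate 1 becomes
    \<open>x 0 ^ K\<close>.\<close>
  define K where "K = (\<Sum>j<M. k j)"
  have K: "k j \<le> K" if "j < M" for j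
    unfolding K_def using that by (intro member_le_sum) auto
  define F where "F j = (case j of 0 \<Rightarrow> (\<lambda>x. x 0 ^ K)
    | Suc i \<Rightarrow> (\<lambda>x :: nat \<Rightarrow> real. x 0 ^ (K - k i) * G i x))" for j
  show ?thesis
  proof (intro exI[of _ K] exI[of _ F] conjI allI impI)
    show "F 0 = (\<lambda>x. x 0 ^ K)" by (simp add: F_def)
    show "hom_poly (Suc N) K (F j)" if "j \<le> M" for j
    proof (cases j)
      case 0
      then show ?thesis
        by (auto simp: F_def hom_poly_def power_mult_distrib intro!: polyfun_intros)
    next
      case (Suc i)
      then have "hom_poly (Suc N) (k i) (G i)"
        using g(1) that by simp
      from hom_poly_raise[OF this, of "K - k i"] show ?thesis
        using K[of i] that Suc by (simp add: F_def)
    qed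
    show "F (Suc j) x = x 0 ^ K * \<Phi> (\<lambda>i. x (Suc i) / x 0) j" if "j < M" "x 0 \<noteq> 0" for j x
    proof -
      have "x 0 ^ K = x 0 ^ (K - k j) * x 0 ^ k j"
        using K[OF that(1)] by (simp flip: power_add)
      then show ?thesis
        using g(2)[of j x] that by (simp add: F_def)
    qed
  qed
qed

text \<open>A single tuple of forms represents the map everywhere on the affine part, so the
  neighbourhood required at each point can be the whole domain.\<close>

lemma polymap_regular:
  assumes \<Phi>: "polymap N M \<Phi>" and A: "A \<subseteq> aff N" and B: "B \<subseteq> aff M" and AB: "\<Phi> ` A \<subseteq> B"
  shows "regular_map N M (affine_closure N A) (affine_closure M B)
    (\<lambda>L. affine_chart (\<Phi> (inv_into UNIV affine_chart L)))" (is "regular_map _ _ ?U ?V ?\<phi>")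
  unfolding regular_map_def
proof (intro conjI ballI)
  show "?\<phi> ` ?U \<subseteq> ?V"
  proof
    fix K assume "K \<in> ?\<phi> ` ?U"
    then obtain L where L: "K = ?\<phi> L" "L \<in> ?U" by (rule imageE)
    from L(2) obtain y where y: "y \<in> aff N" "affine_chart y \<in> zariski_closure N (affine_chart ` A)"
      and Ly: "L = affine_chart y"
      unfolding affine_closure_iff[OF A] by blast
    have "K = affine_chart (\<Phi> y)"
      by (simp add: L(1) Ly inv_affine_chart)
    moreover have "\<Phi> y \<in> aff M"
      using \<Phi> y(1) unfolding polymap_def by blast
    ultimately show "K \<in> ?V"
      using polymap_maps_closure[OF assms y] unfolding affine_closure_iff[OF B] by blast
  qed
  obtain K F where F: "\<forall>j\<le>M. hom_poly (Suc N) K (F j)" "F 0 = (\<lambda>x. x 0 ^ K)"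
    "\<forall>j x. j < M \<longrightarrow> x 0 \<noteq> 0 \<longrightarrow> F (Suc j) x = x 0 ^ K * \<Phi> (\<lambda>i. x (Suc i) / x 0) j"
    using polymap_homogenization[OF \<Phi>] by (elim exE conjE) (rule that)
  have open_U: "zariski_open_in N ?U ?U"
    unfolding zariski_open_in_def using zariski_closed_empty by blast
  have main: "(\<exists>j\<le>M. F j x \<noteq> 0) \<and> ?\<phi> (pline x) = pline (\<lambda>j. if j \<le> M then F j x else 0)"
    if "pline x \<in> ?U" for x
  proof -
    obtain y where y: "y \<in> aff N" "pline x = affine_chart y"
      using \<open>pline x \<in> ?U\<close> unfolding affine_closure_iff[OF A] by blast
    then have "pline x \<in> affine_chart ` {y}" by blast
    then have x0: "x 0 \<noteq> 0" and y': "y = (\<lambda>i. x (Suc i) / x 0)"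
      unfolding pline_in_affine_chart_iff by auto
    have "\<Phi> y \<in> aff M"
      using \<Phi> y(1) by (simp add: polymap_def)
    then have "(\<lambda>j. if j \<le> M then F j x else 0) = (\<lambda>j. x 0 ^ K * case_nat 1 (\<Phi> y) j)"
      using F(3) x0 by (auto simp: fun_eq_iff F(2) y' in_aff Suc_le_eq split: nat.split)
    moreover have "x 0 ^ K \<noteq> 0" using x0 by simp
    ultimately have "affine_chart (\<Phi> y) = pline (\<lambda>j. if j \<le> M then F j x else 0)"
      unfolding affine_chart_def pline_eq_iff[OF affine_chart_nonzero] by blast
    moreover have "?\<phi> (pline x) = affine_chart (\<Phi> y)"
      by (simp add: y(2) inv_affine_chart)
    moreover have "F 0 x \<noteq> 0" using x0 F(2) by simp
    ultimately show ?thesis by auto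
  qed
  fix L assume L: "L \<in> ?U"
  show "\<exists>W k F. zariski_open_in N ?U W \<and> L \<in> W \<and> (\<forall>j\<le>M. hom_poly (Suc N) k (F j)) \<and>
        (\<forall>x. pline x \<in> W \<longrightarrow> (\<exists>j\<le>M. F j x \<noteq> 0) \<and>
             ?\<phi> (pline x) = pline (\<lambda>j. if j \<le> M then F j x else 0))"
  proof (intro exI[of _ ?U] exI[of _ K] exI[of _ F] conjI[OF open_U] conjI[OF L] conjI[OF F(1)] allI impI)
    fix x assume "pline x \<in> ?U"
    then show "(\<exists>j\<le>M. F j x \<noteq> 0) \<and> ?\<phi> (pline x) = pline (\<lambda>j. if j \<le> M then F j x else 0)"
      by (rule main)
  qed
qed

lemma subset_affine_closure:
  assumes "A \<subseteq> aff N"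
  shows "affine_chart ` A \<subseteq> affine_closure N A"
proof
  fix L assume L: "L \<in> affine_chart ` A"
  then have "L \<in> zariski_closure N (affine_chart ` A)"
    unfolding zariski_closure_def by blast
  with L assms show "L \<in> affine_closure N A"
    unfolding affine_closure_iff[OF assms] by blast
qed

text \<open>In each coordinate, being inverse to one another is a polynomial equation; it holds on A
  and therefore on the closure.\<close>

lemma polymap_inverse_closure:
  assumes \<Phi>: "polymap N M \<Phi>" and \<Psi>: "polymap M N \<Psi>" and A: "A \<subseteq> aff N"
    and inverse: "\<And>a. a \<in> A \<Longrightarrow> \<Psi> (\<Phi> a) = a"
    and y: "y \<in> aff N" "affine_chart y \<in> zariski_closure N (affine_chart ` A)"
  shows "\<Psi> (\<Phi> y) = y"
proof
  fix i
  show "\<Psi> (\<Phi> y) i = y i"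
  proof (cases "i < N")
    case True
    have "(\<lambda>x. \<Psi> (\<Phi> x) i) \<in> polyfun N"
      using polyfun_compose[of "\<lambda>x. \<Psi> x i" M \<Phi> N] \<Phi> \<Psi> True unfolding polymap_def by blast
    then have "(\<lambda>x. \<Psi> (\<Phi> x) i - x i) \<in> polyfun N"
      using True by (intro polyfun_diff polyfun.coord)
    then have "\<Psi> (\<Phi> y) i - y i = 0"
      by (rule zariski_closure_vanishes[OF _ A _ y(2)]) (simp add: inverse)
    then show ?thesis by simp
  next
    case False
    \<comment> \<open>Coordinates from N on vanish on both sides by membership in the affine
      space.\<close>
    have "\<Psi> (\<Phi> y) \<in> aff N"
      using \<Phi> \<Psi> y(1) unfolding polymap_def by blast
    then show ?thesis
      using y(1) False by (simp add: in_aff)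
  qed
qed

lemma affine_closure_inverse:
  assumes \<Phi>: "polymap N M \<Phi>" and \<Psi>: "polymap M N \<Psi>" and A: "A \<subseteq> aff N"
    and inverse: "\<And>a. a \<in> A \<Longrightarrow> \<Psi> (\<Phi> a) = a" and L: "L \<in> affine_closure N A"
  shows "affine_chart (\<Psi> (inv_into UNIV affine_chart (affine_chart (\<Phi> (inv_into UNIV affine_chart L))))) = L"
proof -
  obtain y where "y \<in> aff N" "L = affine_chart y" "affine_chart y \<in> zariski_closure N (affine_chart ` A)"
    using L unfolding affine_closure_iff[OF A] by blast
  then show ?thesis
    using polymap_inverse_closure[OF \<Phi> \<Psi> A inverse] by (simp add: inv_affine_chart)
qed

text \<open>The polynomial maps need to be mutually inverse only between A and B. The identities
  then extend to the affine parts of the Zariski closures, which are the open sets demanded of an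
  isomorphism.\<close>

lemma AS_isomorphic_polymap:
  assumes A: "A \<in> constructible N" and B: "B \<in> constructible M"
    and \<Phi>: "polymap N M \<Phi>" and \<Psi>: "polymap M N \<Psi>"
    and AB: "\<And>a. a \<in> A \<Longrightarrow> \<Phi> a \<in> B" and BA: "\<And>b. b \<in> B \<Longrightarrow> \<Psi> b \<in> A"
    and inverse: "\<And>a. a \<in> A \<Longrightarrow> \<Psi> (\<Phi> a) = a" "\<And>b. b \<in> B \<Longrightarrow> \<Phi> (\<Psi> b) = b"
  shows "AS_isomorphic (affine_chart ` A) (affine_chart ` B)"
proof -
  let ?\<phi> = "\<lambda>L. affine_chart (\<Phi> (inv_into UNIV affine_chart L))"
  let ?\<psi> = "\<lambda>L. affine_chart (\<Psi> (inv_into UNIV affine_chart L))"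
  note sA = constructible_subset[OF A] and sB = constructible_subset[OF B]
  have op: "zariski_open_in N (zariski_closure N (affine_chart ` A)) (affine_closure N A)" for N A
    unfolding zariski_open_in_def affine_closure_def
    using zariski_closed_single[OF hom_poly_coord0] by blast
  have h1: "\<forall>L\<in>affine_closure N A. ?\<psi> (?\<phi> L) = L"
    using affine_closure_inverse[OF \<Phi> \<Psi> sA inverse(1)] by blast
  have h2: "\<forall>L\<in>affine_closure M B. ?\<phi> (?\<psi> L) = L"
    using affine_closure_inverse[OF \<Psi> \<Phi> sB inverse(2)] by blast
  have h3: "?\<phi> ` affine_chart ` A = affine_chart ` B"
  proof -
    have "\<Phi> ` A = B"
      using AB BA inverse by (metis image_eqI image_subsetI subsetI subset_antisym)
    then show ?thesis
      by (auto simp: image_image inv_affine_chart)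
  qed
  have h4: "regular_map N M (affine_closure N A) (affine_closure M B) ?\<phi>"
    using AB by (intro polymap_regular[OF \<Phi> sA sB]) blast
  have h5: "regular_map M N (affine_closure M B) (affine_closure N A) ?\<psi>"
    using BA by (intro polymap_regular[OF \<Psi> sB sA]) blast
  show ?thesis
    unfolding AS_isomorphic_def
    by (rule exI[of _ N], rule exI[of _ M], rule exI[of _ "affine_closure N A"],
        rule exI[of _ "affine_closure M B"], rule exI[of _ ?\<phi>], rule exI[of _ ?\<psi>])
      (intro conjI arc_symmetric_constructible[OF A] arc_symmetric_constructible[OF B] op
        subset_affine_closure[OF sA] subset_affine_closure[OF sB] h1 h2 h3 h4 h5)
qed

section \<open>Products and additivity\<close>

text \<open>The product by concatenation of coordinates: the first n belong to A, those from n on to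
  B. Unlike in the Segre image, no products of coordinates occur, so it fits the coordinates of
  arcs.\<close>

definition aff_prod :: "nat \<Rightarrow> (nat \<Rightarrow> real) set \<Rightarrow> (nat \<Rightarrow> real) set \<Rightarrow> (nat \<Rightarrow> real) set" where
  "aff_prod n A B = {z. (\<lambda>i. if i < n then z i else 0) \<in> A \<and> (\<lambda>i. z (n + i)) \<in> B}"

lemma constructible_aff_prod:
  assumes "A \<in> constructible n" "B \<in> constructible m"
  shows "aff_prod n A B \<in> constructible (n + m)"
proof -
  have "{z \<in> aff (n + m). (\<lambda>i. if i < n then z i else 0) \<in> A} \<in> constructible (n + m)"
    by (rule constructible_preimage[OF assms(1)]) (auto simp: in_aff intro: polyfun.coord)
  moreover have "{z \<in> aff (n + m). (\<lambda>i. z (n + i)) \<in> B} \<in> constructible (n + m)"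
    by (rule constructible_preimage[OF assms(2)]) (auto simp: in_aff intro: polyfun.coord)
  ultimately have "{z \<in> aff (n + m). (\<lambda>i. if i < n then z i else 0) \<in> A \<and> (\<lambda>i. z (n + i)) \<in> B}
      \<in> constructible (n + m)"
    by (rule constructible_conj)
  moreover have "aff_prod n A B \<subseteq> aff (n + m)"
  proof
    fix z assume "z \<in> aff_prod n A B"
    then have "(\<lambda>i. z (n + i)) \<in> aff m"
      using constructible_subset[OF assms(2)] by (auto simp: aff_prod_def)
    then have *: "z (n + j) = 0" if "j \<ge> m" for j
      using that unfolding in_aff by blast
    have "z i = 0" if "i \<ge> n + m" for i
      using *[of "i - n"] that by simp
    then show "z \<in> aff (n + m)"
      by (simp add: in_aff)
  qed
  then have "{z \<in> aff (n + m). (\<lambda>i. if i < n then z i else 0) \<in> A \<and> (\<lambda>i. z (n + i)) \<in> B}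
      = aff_prod n A B"
    unfolding aff_prod_def by blast
  ultimately show ?thesis by simp
qed

text \<open>The pair (0, 0) has code 0, so the Segre embedding takes a product of affine charts into
  the affine chart.\<close>

lemma segre_zero: "segre (case_nat 1 x) (case_nat 1 y) 0 = 1"
proof -
  have "prod_decode 0 = (0, 0)"
    using prod_encode_inverse[of "(0, 0)"] by (simp add: prod_encode_def)
  then show ?thesis by (simp add: segre_def)
qed

lemma segre_scale: "segre (\<lambda>i. c * x i) (\<lambda>i. d * y i) = (\<lambda>k. (c * d) * segre x y k)"
  by (auto simp: segre_def fun_eq_iff split: prod.split)

definition segre_chart :: "(nat \<Rightarrow> real) \<Rightarrow> (nat \<Rightarrow> real) \<Rightarrow> nat \<Rightarrow> real" where
  "segre_chart x y k = segre (case_nat 1 x) (case_nat 1 y) (Suc k)"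

lemma segre_prod_affine_chart:
  "segre_prod (affine_chart ` A) (affine_chart ` B) = affine_chart ` {segre_chart x y |x y. x \<in> A \<and> y \<in> B}"
proof -
  have cn: "segre (case_nat 1 x) (case_nat 1 y) = case_nat 1 (segre_chart x y)" for x y
    by (auto simp: fun_eq_iff segre_zero segre_chart_def split: nat.split)
  have rep: "\<exists>a\<in>A. \<exists>c. c \<noteq> 0 \<and> x = (\<lambda>i. c * case_nat 1 a i)" if "pline x \<in> affine_chart ` A" for A x
    using that pline_eq_iff[OF affine_chart_nonzero] unfolding affine_chart_def image_iff by metis
  show ?thesis
  proof
    show "segre_prod (affine_chart ` A) (affine_chart ` B)
        \<subseteq> affine_chart ` {segre_chart x y |x y. x \<in> A \<and> y \<in> B}"
    proof
      fix L assume "L \<in> segre_prod (affine_chart ` A) (affine_chart ` B)"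
      then obtain x y where xy: "L = pline (segre x y)" "pline x \<in> affine_chart ` A" "pline y \<in> affine_chart ` B"
        unfolding segre_prod_def by blast
      obtain a c where a: "a \<in> A" "c \<noteq> 0" "x = (\<lambda>i. c * case_nat 1 a i)"
        using rep[OF xy(2)] by blast
      obtain b d where b: "b \<in> B" "d \<noteq> 0" "y = (\<lambda>i. d * case_nat 1 b i)"
        using rep[OF xy(3)] by blast
      have eq: "segre x y = (\<lambda>k. (c * d) * case_nat 1 (segre_chart a b) k)"
        unfolding a(3) b(3) segre_scale cn ..
      have "affine_chart (segre_chart a b) = L"
        unfolding xy(1) affine_chart_def pline_eq_iff[OF affine_chart_nonzero]
        using eq a(2) b(2) by (intro exI[of _ "c * d"]) simp
      then show "L \<in> affine_chart ` {segre_chart x y |x y. x \<in> A \<and> y \<in> B}"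
        using a(1) b(1) by blast
    qed
    show "affine_chart ` {segre_chart x y |x y. x \<in> A \<and> y \<in> B}
        \<subseteq> segre_prod (affine_chart ` A) (affine_chart ` B)"
    proof
      fix L assume "L \<in> affine_chart ` {segre_chart x y |x y. x \<in> A \<and> y \<in> B}"
      then obtain x y where "x \<in> A" "y \<in> B" "L = affine_chart (segre_chart x y)"
        by blast
      then have "L = pline (segre (case_nat 1 x) (case_nat 1 y))"
        "pline (case_nat 1 x) \<in> affine_chart ` A" "pline (case_nat 1 y) \<in> affine_chart ` B"
        by (auto simp: cn affine_chart_def)
      then show "L \<in> segre_prod (affine_chart ` A) (affine_chart ` B)"
        unfolding segre_prod_def mem_Collect_eq by (intro exI conjI)
    qed
  qed
qed

lemma segre_chart_bound:
  "\<exists>M. (\<forall>i\<le>n. \<forall>j\<le>m. prod_encode (i, j) \<le> M) \<and> (\<forall>x\<in>aff n. \<forall>y\<in>aff m. segre_chart x y \<in> aff M)"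
proof -
  \<comment> \<open>The largest code of a pair with both indices in range. The chart coordinate k
    has code \<open>Suc k\<close>, which for \<open>M \<le> k\<close> exceeds M, so one of its two
    factors vanishes.\<close>
  define M where "M = Max (prod_encode ` ({..n} \<times> {..m}))"
  have le: "prod_encode (i, j) \<le> M" if "i \<le> n" "j \<le> m" for i j
    unfolding M_def using that by (intro Max_ge) auto
  have "segre_chart x y \<in> aff M" if x: "x \<in> aff n" and y: "y \<in> aff m" for x y
    unfolding in_aff
  proof (intro allI impI)
    fix k assume k: "M \<le> k"
    obtain i j where ij: "prod_decode (Suc k) = (i, j)" by (cases "prod_decode (Suc k)")
    then have "prod_encode (i, j) = Suc k"
      by (metis prod_decode_inverse)
    then have "n < i \<or> m < j"
      using le[of i j] k by fastforce
    then show "segre_chart x y k = 0"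
      using x y ij by (auto simp: segre_chart_def segre_def in_aff split: nat.split)
  qed
  with le show ?thesis by (intro exI[of _ M] conjI allI ballI impI)
qed

locale virtual_poincare_polynomial =
  fixes \<beta> :: "(nat \<Rightarrow> real) set set \<Rightarrow> int poly"
  assumes virtual_poincare: "virtual_poincare \<beta>"
begin

lemmas beta_AS_isomorphic = virtual_poincare[unfolded virtual_poincare_def, THEN conjunct1]
lemmas beta_AS_Diff = virtual_poincare[unfolded virtual_poincare_def, THEN conjunct2, THEN conjunct1]
lemmas beta_AS_prod =
  virtual_poincare[unfolded virtual_poincare_def, THEN conjunct2, THEN conjunct2, THEN conjunct1]
lemmas beta_component =
  virtual_poincare[unfolded virtual_poincare_def, THEN conjunct2, THEN conjunct2, THEN conjunct2]

definition aff_beta :: "(nat \<Rightarrow> real) set \<Rightarrow> int poly" where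
  "aff_beta A = \<beta> (affine_chart ` A)"

lemma aff_beta_iso:
  assumes A: "A \<in> constructible N" and B: "B \<in> constructible M"
    and \<Phi>: "polymap N M \<Phi>" and \<Psi>: "polymap M N \<Psi>"
    and AB: "\<And>a. a \<in> A \<Longrightarrow> \<Phi> a \<in> B" and BA: "\<And>b. b \<in> B \<Longrightarrow> \<Psi> b \<in> A"
    and inverse: "\<And>a. a \<in> A \<Longrightarrow> \<Psi> (\<Phi> a) = a" "\<And>b. b \<in> B \<Longrightarrow> \<Phi> (\<Psi> b) = b"
  shows "aff_beta A = aff_beta B"
  unfolding aff_beta_def
  using bspec[OF bspec[OF beta_AS_isomorphic AS_constructible[OF A]] AS_constructible[OF B]]
    AS_isomorphic_polymap[OF assms]
  by (rule mp)

lemma aff_beta_Diff: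
  assumes A: "A \<in> constructible N" and B: "B \<in> constructible N" and BA: "B \<subseteq> A"
  shows "aff_beta (A - B) = aff_beta A - aff_beta B"
proof -
  have "inj_on affine_chart A"
    by (simp add: inj_on_def affine_chart_inj)
  then have "affine_chart ` (A - B) = affine_chart ` A - affine_chart ` B"
    using BA by (rule inj_on_image_set_diff[OF _ Diff_subset])
  moreover have "\<beta> (affine_chart ` A) = \<beta> (affine_chart ` B) + \<beta> (affine_chart ` A - affine_chart ` B)"
    using bspec[OF bspec[OF beta_AS_Diff AS_constructible[OF A]] AS_constructible[OF B]] image_mono[OF BA]
    by (rule mp)
  ultimately show ?thesis
    unfolding aff_beta_def by simp
qed

lemma aff_beta_Un:
  assumes A: "A \<in> constructible N" and B: "B \<in> constructible N" and "A \<inter> B = {}"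
  shows "aff_beta (A \<union> B) = aff_beta A + aff_beta B"
proof -
  have "(A \<union> B) - A = B" using assms(3) by blast
  then show ?thesis
    using aff_beta_Diff[OF constructible.union[OF A B] A] by simp
qed

lemma aff_beta_empty: "aff_beta {} = 0"
proof -
  have "({} :: (nat \<Rightarrow> real) set) \<in> constructible 0"
    using constructible_const[of 0 False] by simp
  then show ?thesis
    using aff_beta_Un[of "{}" 0 "{}"] by simp
qed

text \<open>Multiplicativity is given for Segre products, so the concatenated product has to be
  shown isomorphic to the Segre image, and that image to be constructible.\<close>

lemma aff_beta_prod:
  assumes A: "A \<in> constructible n" and B: "B \<in> constructible m"
  shows "aff_beta (aff_prod n A B) = aff_beta A * aff_beta B"
proof -
  let ?Y = "{segre_chart x y |x y. x \<in> A \<and> y \<in> B}"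
  have sA: "A \<subseteq> aff n" and sB: "B \<subseteq> aff m"
    using constructible_subset A B by blast+
  obtain M where M: "\<And>i j. i \<le> n \<Longrightarrow> j \<le> m \<Longrightarrow> prod_encode (i, j) \<le> M"
    and affM: "\<And>x y. x \<in> aff n \<Longrightarrow> y \<in> aff m \<Longrightarrow> segre_chart x y \<in> aff M"
    using segre_chart_bound[of n m] by blast
  define p1 where "p1 z = (\<lambda>i. if i < n then z i else 0)" for z :: "nat \<Rightarrow> real"
  define p2 where "p2 z = (\<lambda>i. if i < m then z (n + i) else 0)" for z :: "nat \<Rightarrow> real"
  define \<Phi> where "\<Phi> z = segre_chart (p1 z) (p2 z)" for z
  \<comment> \<open>Since the 0-th homogeneous coordinates are 1, the coordinates of x and y occur
    unchanged at the codes of \<open>(Suc i, 0)\<close> and \<open>(0, Suc j)\<close>. The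
    subtraction of 1 passes from homogeneous to chart indices.\<close>
  define \<Psi> where "\<Psi> w = (\<lambda>i. if i < n then w (prod_encode (Suc i, 0) - 1)
    else if i < n + m then w (prod_encode (0, Suc (i - n)) - 1) else 0)" for w :: "nat \<Rightarrow> real"
  have pos: "prod_encode (Suc i, j) > 0" "prod_encode (i, Suc j) > 0" for i j
    by (auto simp: prod_encode_def)
  have p_aff: "p1 z \<in> aff n" "p2 z \<in> aff m" for z
    by (auto simp: p1_def p2_def in_aff)
  have polyp: "(\<lambda>z. case_nat 1 (p1 z) i) \<in> polyfun (n + m)" "(\<lambda>z. case_nat 1 (p2 z) i) \<in> polyfun (n + m)" for i
  proof -
    have "(\<lambda>z. p1 z j) \<in> polyfun (n + m)" "(\<lambda>z. p2 z j) \<in> polyfun (n + m)" for j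
      unfolding p1_def p2_def by (cases "j < n"; simp add: polyfun.const polyfun.coord)
        (cases "j < m"; simp add: polyfun.const polyfun.coord)
    then show "(\<lambda>z. case_nat 1 (p1 z) i) \<in> polyfun (n + m)"
      "(\<lambda>z. case_nat 1 (p2 z) i) \<in> polyfun (n + m)"
      by (cases i; simp add: polyfun.const)+
  qed
  have \<Phi>: "polymap (n + m) M \<Phi>"
    unfolding polymap_def
  proof (intro conjI allI impI ballI)
    show "(\<lambda>z. \<Phi> z j) \<in> polyfun (n + m)" for j
    proof -
      obtain a b where "prod_decode (Suc j) = (a, b)" by (cases "prod_decode (Suc j)")
      then show ?thesis
        using polyfun.mult[OF polyp(1)[of a] polyp(2)[of b]] by (simp add: \<Phi>_def segre_chart_def segre_def)
    qed
    show "\<Phi> z \<in> aff M" for z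
      unfolding \<Phi>_def by (intro affM p_aff)
  qed
  have \<Psi>: "polymap M (n + m) \<Psi>"
    unfolding polymap_def
  proof (intro conjI allI impI ballI)
    fix i assume "i < n + m"
    have "prod_encode (Suc i, 0) - 1 < M" if "i < n"
      using M[of "Suc i" 0] pos(1)[of i 0] that by simp
    moreover have "prod_encode (0, Suc (i - n)) - 1 < M" if "\<not> i < n"
    proof -
      have "Suc (i - n) \<le> m"
        using that \<open>i < n + m\<close> by linarith
      then show ?thesis
        using M[of 0 "Suc (i - n)"] pos(2)[of 0 "i - n"] by simp
    qed
    ultimately show "(\<lambda>w. \<Psi> w i) \<in> polyfun M"
      using \<open>i < n + m\<close> unfolding \<Psi>_def by (cases "i < n") (simp_all add: polyfun.coord)
  next
    show "\<Psi> w \<in> aff (n + m)" for w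
      by (simp add: \<Psi>_def in_aff)
  qed
  have \<Psi>\<Phi>: "\<Psi> (\<Phi> z) = z" if "z \<in> aff (n + m)" for z
  proof
    fix i
    have "segre_chart x y (prod_encode (Suc i, 0) - 1) = x i" for x y i
      using pos(1)[of i 0] by (simp add: segre_chart_def segre_def)
    moreover have "segre_chart x y (prod_encode (0, Suc i) - 1) = y i" for x y i
      using pos(2)[of 0 i] by (simp add: segre_chart_def segre_def)
    ultimately show "\<Psi> (\<Phi> z) i = z i"
      using that by (auto simp: \<Psi>_def \<Phi>_def p1_def p2_def in_aff)
  qed
  have mem: "z \<in> aff_prod n A B \<longleftrightarrow> z \<in> aff (n + m) \<and> p1 z \<in> A \<and> p2 z \<in> B" for z
  proof -
    have "p2 z = (\<lambda>i. z (n + i))" if "z \<in> aff (n + m)"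
      using that by (auto simp: p2_def in_aff fun_eq_iff)
    moreover have "aff_prod n A B \<subseteq> aff (n + m)"
      by (rule constructible_subset[OF constructible_aff_prod[OF A B]])
    ultimately show ?thesis
      unfolding aff_prod_def p1_def by auto
  qed
  have img: "?Y = \<Phi> ` aff_prod n A B"
  proof
    show "\<Phi> ` aff_prod n A B \<subseteq> ?Y"
      using mem unfolding \<Phi>_def by blast
    show "?Y \<subseteq> \<Phi> ` aff_prod n A B"
    proof
      fix w assume "w \<in> ?Y"
      then obtain x y where xy: "x \<in> A" "y \<in> B" "w = segre_chart x y" by blast
      define z where "z = (\<lambda>i. if i < n then x i else y (i - n))"
      have "p1 z = x" "p2 z = y" "z \<in> aff (n + m)"
        using sA sB xy by (auto simp: p1_def p2_def z_def in_aff fun_eq_iff subset_iff)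
      then show "w \<in> \<Phi> ` aff_prod n A B"
        using xy mem[of z] by (auto simp: \<Phi>_def)
    qed
  qed
  have sP: "aff_prod n A B \<subseteq> aff (n + m)"
    by (rule constructible_subset[OF constructible_aff_prod[OF A B]])
  \<comment> \<open>The image of \<open>\<Phi>\<close> is described without a quantifier: w lies in
    it iff \<open>\<Psi> w\<close> lies in the product and \<open>\<Phi>\<close> maps it back to w,
    which is finitely many polynomial equations.\<close>
  have Y: "?Y \<in> constructible M"
  proof -
    have "{w \<in> aff M. \<Psi> w \<in> aff_prod n A B} \<in> constructible M"
      using \<Psi> unfolding polymap_def
      by (intro constructible_preimage[OF constructible_aff_prod[OF A B], of \<Psi> M]) blast+
    moreover have "{w \<in> aff M. \<forall>k\<in>{..<M}. \<Phi> (\<Psi> w) k = w k} \<in> constructible M"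
    proof (rule constructible_ball)
      fix k assume k: "k \<in> {..<M}"
      have "(\<lambda>w. \<Phi> (\<Psi> w) k) \<in> polyfun M"
        using \<Phi> \<Psi> k unfolding polymap_def
        by (intro polyfun_compose[of "\<lambda>z. \<Phi> z k" "n + m" \<Psi> M]) blast+
      moreover have "(\<lambda>w. w k) \<in> polyfun M"
        using k by (simp add: polyfun.coord)
      ultimately show "{w \<in> aff M. \<Phi> (\<Psi> w) k = w k} \<in> constructible M"
        by (rule constructible_eq)
    qed simp
    ultimately have "{w \<in> aff M. \<Psi> w \<in> aff_prod n A B \<and> (\<forall>k\<in>{..<M}. \<Phi> (\<Psi> w) k = w k)} \<in> constructible M"
      by (rule constructible_conj)
    moreover have "{w \<in> aff M. \<Psi> w \<in> aff_prod n A B \<and> (\<forall>k\<in>{..<M}. \<Phi> (\<Psi> w) k = w k)} = ?Y"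
    proof (intro equalityI subsetI)
      fix w assume "w \<in> {w \<in> aff M. \<Psi> w \<in> aff_prod n A B \<and> (\<forall>k\<in>{..<M}. \<Phi> (\<Psi> w) k = w k)}"
      then have w: "w \<in> aff M" "\<Psi> w \<in> aff_prod n A B" "\<And>k. k < M \<Longrightarrow> \<Phi> (\<Psi> w) k = w k" by auto
      have "\<Phi> (\<Psi> w) \<in> aff M"
        unfolding \<Phi>_def by (intro affM p_aff)
      then have "\<Phi> (\<Psi> w) k = w k" for k
        using w by (cases "k < M") (auto simp: in_aff)
      then have "\<Phi> (\<Psi> w) = w" by blast
      then show "w \<in> ?Y"
        unfolding img using w(2) by (metis image_eqI)
    next
      fix w assume "w \<in> ?Y"
      then obtain z where z: "z \<in> aff_prod n A B" "w = \<Phi> z"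
        unfolding img by blast
      then have "\<Psi> w = z"
        using \<Psi>\<Phi> sP by blast
      moreover have "w \<in> aff M"
        using \<Phi> z sP unfolding polymap_def by blast
      ultimately show "w \<in> {w \<in> aff M. \<Psi> w \<in> aff_prod n A B \<and> (\<forall>k\<in>{..<M}. \<Phi> (\<Psi> w) k = w k)}"
        using z by simp
    qed
    ultimately show ?thesis by simp
  qed
  have "aff_beta (aff_prod n A B) = aff_beta ?Y"
  proof (rule aff_beta_iso[OF constructible_aff_prod[OF A B] Y \<Phi> \<Psi>])
    show "\<Psi> (\<Phi> a) = a" if "a \<in> aff_prod n A B" for a
      using that \<Psi>\<Phi> sP by blast
    then show "\<Phi> (\<Psi> b) = b" "\<Psi> b \<in> aff_prod n A B" if "b \<in> ?Y" for b
      using that unfolding img by auto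
  qed (simp add: img)
  also have "\<dots> = \<beta> (segre_prod (affine_chart ` A) (affine_chart ` B))"
    unfolding aff_beta_def segre_prod_affine_chart ..
  also have "\<dots> = aff_beta A * aff_beta B"
    unfolding aff_beta_def
    by (rule bspec[OF bspec[OF beta_AS_prod AS_constructible[OF A]] AS_constructible[OF B]])
  finally show ?thesis .
qed

end

section \<open>The affine line\<close>

lemma alg_variety_zariski_closed: "zariski_closed n X \<Longrightarrow> alg_variety n X"
  unfolding alg_variety_def zariski_open_in_def using zariski_closed_empty Diff_empty by metis

lemma nonsingular_pspace: "nonsingular n (pspace n)"
  unfolding nonsingular_def
proof (intro ballI impI)
  fix v assume "pline v \<in> pspace n"
  show "\<exists>d\<le>n. \<exists>P Z. zariski_closed n Z \<and> pline v \<notin> Z \<and>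
          (\<forall>i<n - d. (\<exists>k. hom_poly (Suc n) k (P i)) \<and> (\<forall>L\<in>pspace n. vanishes_on (P i) L)) \<and>
          pspace n - Z = {L \<in> pspace n - Z. \<forall>i<n - d. vanishes_on (P i) L} \<and>
          (\<forall>c :: nat \<Rightarrow> real.
             (\<forall>j\<le>n. (\<Sum>i<n - d. c i * partial_deriv (P i) j v) = 0) \<longrightarrow> (\<forall>i<n - d. c i = 0))"
    by (rule exI[of _ n], intro conjI, simp, rule exI[of _ "\<lambda>i x. 0"], rule exI[of _ "{}"])
      (simp add: zariski_closed_empty)
qed

definition pinfinity :: "(nat \<Rightarrow> real) set set" where
  "pinfinity = {L \<in> pspace 1. vanishes_on (\<lambda>x. x 0) L}"

lemma pinfinity_eq: "pinfinity = pspace 1 - affine_chart ` aff 1"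
proof -
  have "vanishes_on (\<lambda>x. x 0) (pline x) \<longleftrightarrow> pline x \<notin> affine_chart ` aff 1" if "x \<in> aff (Suc 1)" for x
  proof -
    have "(\<lambda>i. x (Suc i) / x 0) \<in> aff 1"
      using that by (simp add: in_aff)
    then show ?thesis
      unfolding vanishes_on_pline_iff[OF hom_poly_coord0] pline_in_affine_chart_iff by blast
  qed
  then have "vanishes_on (\<lambda>x. x 0) L \<longleftrightarrow> L \<notin> affine_chart ` aff 1" if "L \<in> pspace 1" for L
    using that unfolding pspace_def by (elim imageE) simp
  then show ?thesis
    unfolding pinfinity_def by blast
qed

lemma pinfinity_singleton: "\<exists>L. pinfinity = {L}"
proof -
  let ?e = "\<lambda>i::nat. if i = 1 then 1 else (0::real)"
  have e: "?e \<noteq> (\<lambda>i. 0)"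
    by (metis zero_neq_one)
  have van: "vanishes_on (\<lambda>x. x 0) (pline x) \<longleftrightarrow> x 0 = 0" for x
    by (rule vanishes_on_pline_iff[OF hom_poly_coord0])
  have "pline ?e \<in> pinfinity"
    using e van[of ?e] by (auto simp: pinfinity_def pspace_def in_aff)
  moreover have "L = pline ?e" if "L \<in> pinfinity" for L
  proof -
    obtain x where x: "x \<in> aff 2" "x \<noteq> (\<lambda>i. 0)" "L = pline x"
      using \<open>L \<in> pinfinity\<close> by (auto simp: pinfinity_def pspace_def numeral_2_eq_2)
    have "x 0 = 0"
      using \<open>L \<in> pinfinity\<close> van[of x] x(3) by (simp add: pinfinity_def)
    note x = x this
    then have "x 1 \<noteq> 0"
      using aff_2_nonzero by blast
    have "x = (\<lambda>i. x 1 * ?e i)"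
    proof
      fix i show "x i = x 1 * ?e i"
        by (rule aff_2_cases[of i]) (use x in auto)
    qed
    then have "pline ?e = pline x"
      unfolding pline_eq_iff[OF e] using \<open>x 1 \<noteq> 0\<close> by blast
    then show ?thesis
      using x by simp
  qed
  ultimately show ?thesis by blast
qed

lemma nonsingular_pinfinity: "nonsingular 1 pinfinity"
  unfolding nonsingular_def
proof (intro ballI impI)
  fix v
  \<comment> \<open>The point at infinity is nonsingular of dimension 0: the single form
    \<open>x 0\<close> cuts it out, with nonzero gradient, and the exceptional closed set is
    empty.\<close>
  have pd: "partial_deriv (\<lambda>x. x 0) 0 v = 1"
    by (simp add: partial_deriv_def)
  have "\<forall>i<1. c i = 0"
    if "\<forall>j\<le>1. (\<Sum>i<1. c i * partial_deriv (\<lambda>x. x 0) j v) = 0" for c :: "nat \<Rightarrow> real"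
    using that[rule_format, of 0] pd by simp
  then show "\<exists>d\<le>1. \<exists>P Z. zariski_closed 1 Z \<and> pline v \<notin> Z \<and>
          (\<forall>i<1 - d. (\<exists>k. hom_poly (Suc 1) k (P i)) \<and> (\<forall>L\<in>pinfinity. vanishes_on (P i) L)) \<and>
          pinfinity - Z = {L \<in> pspace 1 - Z. \<forall>i<1 - d. vanishes_on (P i) L} \<and>
          (\<forall>c :: nat \<Rightarrow> real.
             (\<forall>j\<le>1. (\<Sum>i<1 - d. c i * partial_deriv (P i) j v) = 0) \<longrightarrow> (\<forall>i<1 - d. c i = 0))"
  proof (rule_tac exI[of _ 0], intro conjI, simp, rule_tac exI[of _ "\<lambda>i x. x 0"],
      rule_tac exI[of _ "{}"], intro conjI allI impI)
    show "\<exists>k. hom_poly (Suc 1) k (\<lambda>x. x 0)"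
      using hom_poly_coord0 by blast
    show "pinfinity - {} = {L \<in> pspace 1 - {}. \<forall>i<(1::nat) - 0. vanishes_on (\<lambda>x. x 0) L}"
      by (simp add: pinfinity_def)
    show "zariski_closed 1 {}"
      by (rule zariski_closed_empty)
    show "\<forall>L\<in>pinfinity. vanishes_on (\<lambda>x. x 0) L"
      by (simp add: pinfinity_def)
  qed simp_all
qed

text \<open>The projective line is not contained in the affine chart, so the result for
  constructible sets does not apply. Its cone is where a sum of squares is positive, and an analytic
  arc never leaves the projective space.\<close>

lemma AS_pspace_1: "pspace 1 \<in> AS"
proof -
  have "{x \<in> aff (Suc 1) - {\<lambda>i. 0}. pline x \<in> pspace 1} = {x \<in> aff 2. 0 < x 0 * x 0 + x 1 * x 1}"
  proof -
    have "x \<noteq> (\<lambda>i. 0) \<longleftrightarrow> 0 < x 0 * x 0 + x 1 * x 1" if "x \<in> aff 2" for x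
      using aff_2_nonzero[OF that] by (auto simp: power2_eq_square[symmetric] sum_power2_gt_zero_iff)
    then show ?thesis
      unfolding pspace_def numeral_2_eq_2 One_nat_def by blast
  qed
  moreover have "{x \<in> aff 2. 0 < x 0 * x 0 + x 1 * x 1} \<in> semialg 2"
    by (rule semialg.pos) (intro polyfun.add polyfun.mult polyfun.coord; simp)
  ultimately have "proj_semialg 1 (pspace 1)"
    unfolding proj_semialg_def by (simp add: numeral_2_eq_2)
  have arc: "\<gamma> s \<in> pspace 1" if an: "analytic_arc 1 \<epsilon> \<gamma>" "s \<in> {-\<epsilon><..<\<epsilon>}" for \<gamma> \<epsilon> s
  proof -
    obtain x :: "real \<Rightarrow> nat \<Rightarrow> real" where
      "\<forall>\<^sub>F r in nhds s. x r \<in> aff (Suc 1) - {\<lambda>i. 0} \<and> \<gamma> r = pline (x r)"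
      using an unfolding analytic_arc_def by blast
    then have "x s \<in> aff (Suc 1) - {\<lambda>i. 0} \<and> \<gamma> s = pline (x s)"
      by (rule eventually_nhds_x_imp_x)
    then show ?thesis
      unfolding pspace_def by blast
  qed
  have "arc_symmetric 1 (pspace 1)"
    unfolding arc_symmetric_def
  proof (intro conjI allI impI)
    show "proj_semialg 1 (pspace 1)" by fact
    fix \<epsilon> :: real and \<gamma>
    assume "0 < \<epsilon>" and an: "analytic_arc 1 \<epsilon> \<gamma>"
    then show "\<exists>\<epsilon>'>0. \<epsilon>' \<le> \<epsilon> \<and> \<gamma> ` {0<..<\<epsilon>'} \<subseteq> pspace 1"
      using arc[OF an] by (intro exI[of _ \<epsilon>]) auto
  qed
  then show ?thesis
    unfolding AS_def by blast
qed

text \<open>This presents the affine point as a compact nonsingular variety, so that homology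
  determines its value.\<close>

lemma pspace_0: "pspace 0 = affine_chart ` aff 0"
proof
  show "affine_chart ` aff 0 \<subseteq> pspace 0"
    using affine_chart_in_pspace by blast
  show "pspace 0 \<subseteq> affine_chart ` aff 0"
  proof
    fix L assume "L \<in> pspace 0"
    then obtain x where x: "x \<in> aff 1" "x \<noteq> (\<lambda>i. 0)" "L = pline x"
      by (auto simp: pspace_def)
    have "x 0 \<noteq> 0"
    proof
      assume "x 0 = 0"
      then have "x i = 0" for i
        using x(1) by (cases i) (auto simp: in_aff)
      then show False using x(2) by blast
    qed
    moreover have "(\<lambda>i. x (Suc i) / x 0) \<in> aff 0"
      using x(1) by (simp add: in_aff)
    ultimately show "L \<in> affine_chart ` aff 0"
      unfolding x(3) pline_in_affine_chart_iff by blast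
  qed
qed

lemma aff_0: "aff 0 = {\<lambda>i. 0}"
  by (auto simp: in_aff)

lemma constructible_aff: "aff n \<in> constructible n"
  using constructible_const[of n True] by simp

context virtual_poincare_polynomial
begin

text \<open>The normalization of \<open>\<beta>\<close> speaks of connected components; a nonempty
  connected variety is a component of itself.\<close>

lemma coeff_beta_variety:
  assumes "zariski_closed n X" "compactin (proj_topology n) X" "nonsingular n X"
    and con: "connectedin (proj_topology n) X" and "X \<noteq> {}"
  shows "poly.coeff (\<beta> X) i = int (mod2_betti i (subtopology (proj_topology n) X))"
proof -
  let ?S = "subtopology (proj_topology n) X"
  have "X \<subseteq> topspace (proj_topology n)"
    using con by (rule connectedin_subset_topspace)
  then have top: "topspace ?S = X" by auto
  have conS: "connectedin ?S X"
    using con by (simp add: connectedin_subtopology)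
  obtain x where "x \<in> X" using assms(5) by blast
  have "connected_component_of_set ?S x = X"
  proof
    show "connected_component_of_set ?S x \<subseteq> X"
      using connected_component_of_subset_topspace[of ?S x] top by simp
    show "X \<subseteq> connected_component_of_set ?S x"
      using conS \<open>x \<in> X\<close> unfolding connected_component_of_def by blast
  qed
  then have "X \<in> connected_components_of ?S"
    unfolding connected_components_of_def top using \<open>x \<in> X\<close> by (intro image_eqI[of _ _ x]) simp_all
  then show ?thesis
    by (rule beta_component[rule_format, OF alg_variety_zariski_closed[OF assms(1)] assms(2,3)])
qed

lemma beta_singleton:
  assumes "zariski_closed n {L}" "nonsingular n {L}"
  shows "\<beta> {L} = 1"
proof -
  have "zariski_closed n X \<Longrightarrow> X \<subseteq> pspace n" for X
    unfolding zariski_closed_def by blast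
  then have L: "L \<in> topspace (proj_topology n)"
    using assms(1) by (auto simp: topspace_proj_topology)
  have "poly.coeff (\<beta> {L}) i = int (mod2_betti i (subtopology (proj_topology n) {L}))" for i
    using L by (intro coeff_beta_variety assms) auto
  moreover have "topspace (subtopology (proj_topology n) {L}) = {L}"
    using L by auto
  ultimately show ?thesis
    by (simp add: mod2_betti_singleton poly_eq_iff)
qed

lemma aff_beta_point: "aff_beta {\<lambda>i. 0} = 1"
proof -
  have "affine_chart ` {\<lambda>i. 0} = pspace 0"
    by (simp only: pspace_0 aff_0)
  moreover have "affine_chart ` {\<lambda>i. 0} = {affine_chart (\<lambda>i. 0)}" by simp
  ultimately show ?thesis
    unfolding aff_beta_def using beta_singleton[of 0 "affine_chart (\<lambda>i. 0)"]
      zariski_closed_pspace[of 0] nonsingular_pspace[of 0] by simp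
qed

lemma aff_beta_line: "aff_beta (aff 1) = [:0, 1:]"
proof -
  have zp: "zariski_closed 1 pinfinity"
    using zariski_closed_single[OF hom_poly_coord0] unfolding pinfinity_def by blast
  obtain L where L: "pinfinity = {L}"
    using pinfinity_singleton by blast
  have inf: "\<beta> pinfinity = 1"
    using beta_singleton zp nonsingular_pinfinity unfolding L by blast
  have "poly.coeff (\<beta> (pspace 1)) i = int (mod2_betti i (subtopology (proj_topology 1) (pspace 1)))" for i
  proof (rule coeff_beta_variety)
    show "connectedin (proj_topology 1) (pspace 1)"
      using path_connected_imp_connected_space[OF proj_topology_1_path_connected]
        connectedin_topspace[of "proj_topology 1"] topspace_proj_topology[of 1] by simp
    show "pspace 1 \<noteq> {}"
      unfolding angle_line_surj[symmetric] by simp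
  qed (rule zariski_closed_pspace nonsingular_pspace proj_topology_1_compact)+
  moreover have "subtopology (proj_topology 1) (pspace 1) = proj_topology 1"
    unfolding topspace_proj_topology[symmetric] by (rule subtopology_topspace)
  ultimately have "poly.coeff (\<beta> (pspace 1)) i = (if i \<le> 1 then 1 else 0)" for i
    using mod2_betti_proj_line[of i] by simp
  moreover have "\<beta> (pspace 1) = aff_beta (aff 1) + \<beta> pinfinity"
    unfolding aff_beta_def pinfinity_eq
    by (rule mp[OF bspec[OF bspec[OF beta_AS_Diff AS_pspace_1] AS_constructible[OF constructible_aff]]])
      (use affine_chart_in_pspace in blast)
  then have "aff_beta (aff 1) = \<beta> (pspace 1) - 1"
    by (simp add: inf)
  ultimately have "poly.coeff (aff_beta (aff 1)) i = (if i \<le> 1 then 1 else 0) - poly.coeff 1 i" for i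
    by simp
  then show ?thesis
    by (auto simp: poly_eq_iff coeff_pCons split: nat.split)
qed

lemma aff_beta_aff: "aff_beta (aff n) = [:0, 1:] ^ n"
proof (induction n)
  case 0
  then show ?case
    by (simp only: aff_0 aff_beta_point power_0)
next
  case (Suc n)
  have "aff_prod n (aff n) (aff 1) = aff (Suc n)"
  proof -
    have "(\<forall>i\<ge>1. z (n + i) = 0) \<longleftrightarrow> (\<forall>i\<ge>Suc n. z i = 0)" for z :: "nat \<Rightarrow> real"
    proof
      assume *: "\<forall>i\<ge>1. z (n + i) = 0"
      show "\<forall>i\<ge>Suc n. z i = 0"
      proof (intro allI impI)
        fix i assume "Suc n \<le> i"
        then show "z i = 0"
          using *[rule_format, of "i - n"] by simp
      qed
    qed simp
    then show ?thesis
      by (auto simp: aff_prod_def in_aff)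
  qed
  then show ?case
    using aff_beta_prod[OF constructible_aff constructible_aff, of n 1] Suc.IH aff_beta_line
    by (simp add: mult.commute)
qed

end

section \<open>Coefficients along truncated arcs\<close>

text \<open>Otherwise the zero function would be nonzero in a punctured neighbourhood of 0. This
  uniqueness is needed because \<open>chi\<close> allows an arbitrary coefficient sequence
  b.\<close>

lemma zero_power_series_coeffs:
  fixes c :: "nat \<Rightarrow> real"
  assumes "\<forall>\<^sub>F t in nhds 0. (\<lambda>k. c k * t ^ k) sums 0"
  shows "c = (\<lambda>k. 0)"
proof (rule ccontr)
  assume ne: "c \<noteq> (\<lambda>k. 0)"
  obtain r where r: "r > 0" "\<And>t. \<bar>t\<bar> < r \<Longrightarrow> (\<lambda>k. c k * t ^ k) sums 0"
    using assms by (auto simp: eventually_nhds_metric dist_real_def)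
  have "c 0 = 0"
    using r(2)[of 0] r(1) powser_sums_zero_iff[of c 0] by simp
  moreover obtain m where "c m \<noteq> 0" using ne by auto
  ultimately have m: "c m \<noteq> 0" "m > 0" by (cases m; auto)+
  show False
  proof (rule powser_0_nonzero[of r 0 c "\<lambda>_::real. 0" m])
    show "(\<lambda>k. c k * (t - 0) ^ k) sums 0" if "norm (t - 0) < r" for t
      using r(2) that by simp
    fix s :: real
    assume "0 < s" and "\<And>z::real. z \<in> cball 0 s - {0} \<Longrightarrow> (0::real) \<noteq> 0"
    from this(2)[of s] \<open>0 < s\<close> show False by simp
  qed (use r(1) m in auto)
qed

definition arc_poly :: "nat \<Rightarrow> nat \<Rightarrow> (nat \<Rightarrow> real) \<Rightarrow> nat \<Rightarrow> real poly" where
  "arc_poly d n a i = (\<Sum>k=1..n. Polynomial.monom (a ((k - 1) * d + i)) k)"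

lemma poly_arc_poly: "i < d \<Longrightarrow> poly (arc_poly d n a i) t = trunc_arc d n a t i"
  by (simp add: arc_poly_def trunc_arc_def poly_sum poly_monom)

lemma coeff_arc_poly:
  "poly.coeff (arc_poly d n a i) j = (if 1 \<le> j \<and> j \<le> n then a ((j - 1) * d + i) else 0)"
proof -
  have "poly.coeff (arc_poly d n a i) j = (\<Sum>k=1..n. if j = k then a ((j - 1) * d + i) else 0)"
    unfolding arc_poly_def coeff_sum by (intro sum.cong) (auto simp: coeff_monom)
  then show ?thesis
    by (simp add: sum.delta')
qed

text \<open>Along a truncated arc the function is a polynomial in t. By uniqueness of power series
  the sequence b in \<open>chi\<close> must be its coefficient sequence, so the analytic condition
  becomes algebraic.\<close>

lemma chi_eq_coeffs:
  assumes "\<And>a t. poly (Q a) t = f (trunc_arc d n a t)"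
  shows "chi d f n = {a \<in> aff (n * d). (\<forall>k<n. poly.coeff (Q a) k = 0) \<and> poly.coeff (Q a) n \<noteq> 0}"
proof -
  have sums: "(\<lambda>k. poly.coeff (Q a) k * t ^ k) sums f (trunc_arc d n a t)" for a t
  proof -
    have "(\<lambda>k. poly.coeff (Q a) k * t ^ k) sums (\<Sum>k\<le>degree (Q a). poly.coeff (Q a) k * t ^ k)"
      by (rule sums_finite) (auto simp: coeff_eq_0)
    then show ?thesis
      by (simp add: poly_altdef[symmetric] assms)
  qed
  have "(\<exists>b. (\<forall>k<n. b k = 0) \<and> b n \<noteq> 0 \<and> (\<forall>\<^sub>F t in nhds 0. (\<lambda>k. b k * t ^ k) sums f (trunc_arc d n a t)))
      \<longleftrightarrow> (\<forall>k<n. poly.coeff (Q a) k = 0) \<and> poly.coeff (Q a) n \<noteq> 0" for a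
  proof
    assume "\<exists>b. (\<forall>k<n. b k = 0) \<and> b n \<noteq> 0 \<and> (\<forall>\<^sub>F t in nhds 0. (\<lambda>k. b k * t ^ k) sums f (trunc_arc d n a t))"
    then obtain b where b: "\<forall>k<n. b k = 0" "b n \<noteq> 0"
      "\<forall>\<^sub>F t in nhds 0. (\<lambda>k. b k * t ^ k) sums f (trunc_arc d n a t)" by blast
    have "\<forall>\<^sub>F t in nhds 0. (\<lambda>k. (b k - poly.coeff (Q a) k) * t ^ k) sums 0"
      using b(3)
    proof eventually_elim
      case (elim t)
      show ?case
        using sums_diff[OF elim sums[of a t]] by (simp add: left_diff_distrib)
    qed
    from fun_cong[OF zero_power_series_coeffs[OF this]] have "b k = poly.coeff (Q a) k" for k
      by simp
    with b show "(\<forall>k<n. poly.coeff (Q a) k = 0) \<and> poly.coeff (Q a) n \<noteq> 0" by simp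
  next
    assume "(\<forall>k<n. poly.coeff (Q a) k = 0) \<and> poly.coeff (Q a) n \<noteq> 0"
    then show "\<exists>b. (\<forall>k<n. b k = 0) \<and> b n \<noteq> 0 \<and> (\<forall>\<^sub>F t in nhds 0. (\<lambda>k. b k * t ^ k) sums f (trunc_arc d n a t))"
      using sums by (intro exI[of _ "poly.coeff (Q a)"]) simp
  qed
  then show ?thesis
    unfolding chi_def by blast
qed

section \<open>Low order coefficients of powers of polynomials\<close>

lemma coeff_power_0: "poly.coeff (Y ^ p) 0 = poly.coeff Y 0 ^ p" for Y :: "real poly"
  by (simp flip: poly_0_coeff_0)

lemma coeff_power_1:
  fixes Y :: "real poly"
  shows "poly.coeff (Y ^ p) 1 = of_nat p * poly.coeff Y 0 ^ (p - 1) * poly.coeff Y 1"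
proof (induction p)
  case (Suc p)
  have "poly.coeff (Y ^ Suc p) 1 = poly.coeff Y 0 * poly.coeff (Y ^ p) 1 + poly.coeff Y 1 * poly.coeff (Y ^ p) 0"
    by (simp add: coeff_mult)
  then show ?case
    unfolding Suc.IH coeff_power_0 by (cases p) (simp_all add: algebra_simps)
qed simp

text \<open>Factoring X as the m-th power of the variable times Y reduces all three claims to the
  coefficients 0 and 1 of the p-th power of Y.\<close>

lemma coeff_power_low_order:
  fixes X :: "real poly"
  assumes "\<forall>j<m. poly.coeff X j = 0"
  shows "k < m * p \<Longrightarrow> poly.coeff (X ^ p) k = 0"
    and "poly.coeff (X ^ p) (m * p) = poly.coeff X m ^ p"
    and "poly.coeff (X ^ p) (m * p + 1) = of_nat p * poly.coeff X m ^ (p - 1) * poly.coeff X (m + 1)"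
proof -
  have "Polynomial.monom 1 m dvd X"
    using assms by (simp add: monom_1_dvd_iff')
  then obtain Y where Y: "X = Polynomial.monom 1 m * Y" by (auto elim: dvdE)
  have "X ^ p = Polynomial.monom 1 (m * p) * Y ^ p"
    by (simp add: Y power_mult_distrib monom_power)
  then have c: "poly.coeff (X ^ p) k = (if k < m * p then 0 else poly.coeff (Y ^ p) (k - m * p))" for k
    by (simp add: coeff_monom_mult)
  have d: "poly.coeff X (m + j) = poly.coeff Y j" for j
    by (simp add: Y coeff_monom_mult)
  show "k < m * p \<Longrightarrow> poly.coeff (X ^ p) k = 0"
    by (simp add: c)
  show "poly.coeff (X ^ p) (m * p) = poly.coeff X m ^ p"
    using d[of 0] by (simp add: c coeff_power_0)
  show "poly.coeff (X ^ p) (m * p + 1) = of_nat p * poly.coeff X m ^ (p - 1) * poly.coeff X (m + 1)"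
    using d[of 0] d[of 1] coeff_power_1[of Y p] by (simp add: c)
qed

text \<open>The lowest nonzero coefficient of X, at j, produces its p-th power at position
  \<open>j * p\<close>, the lowest position where the power of X can be nonzero. Strong induction on
  j extracts the coefficients of X one by one.\<close>

lemma coeff_power_zero_below_iff:
  fixes X :: "real poly"
  assumes "0 < p"
  shows "(\<forall>k<n. poly.coeff (X ^ p) k = 0) \<longleftrightarrow> (\<forall>j. j * p < n \<longrightarrow> poly.coeff X j = 0)"
proof
  assume *: "\<forall>k<n. poly.coeff (X ^ p) k = 0"
  have "j * p < n \<longrightarrow> poly.coeff X j = 0" for j
  proof (induction j rule: less_induct)
    case (less j)
    show ?case
    proof
      assume j: "j * p < n"
      have "i * p < n" if "i < j" for i
        using that j by (meson less_le_trans less_imp_le mult_le_mono1 order_le_less_trans)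
      then have "\<forall>i<j. poly.coeff X i = 0"
        using less.IH by blast
      from coeff_power_low_order(2)[OF this, of p] show "poly.coeff X j = 0"
        using * j assms by simp
    qed
  qed
  then show "\<forall>j. j * p < n \<longrightarrow> poly.coeff X j = 0" by blast
next
  assume *: "\<forall>j. j * p < n \<longrightarrow> poly.coeff X j = 0"
  show "\<forall>k<n. poly.coeff (X ^ p) k = 0"
  proof (intro allI impI)
    fix k assume k: "k < n"
    have "\<forall>j<k div p + 1. poly.coeff X j = 0"
    proof (intro allI impI)
      fix j assume "j < k div p + 1"
      then have "j * p \<le> k div p * p"
        by (intro mult_le_mono1) simp
      also have "\<dots> \<le> k" by simp
      finally show "poly.coeff X j = 0" using * k by simp
    qed
    then show "poly.coeff (X ^ p) k = 0"
      by (rule coeff_power_low_order(1)) (use assms dividend_less_div_times[of p k] in simp)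
  qed
qed

text \<open>The order of a p-th power is a multiple of p: if it is at least n and p does not divide
  n, it exceeds n.\<close>

lemma coeff_power_zero_at:
  fixes X :: "real poly"
  assumes "0 < p" "\<not> p dvd n" "\<forall>k<n. poly.coeff (X ^ p) k = 0"
  shows "poly.coeff (X ^ p) n = 0"
proof (rule coeff_power_low_order(1))
  have n: "n div p * p < n"
    using assms(2) by (metis dvd_triv_right div_times_less_eq_dividend le_neq_implies_less)
  show "\<forall>j<n div p + 1. poly.coeff X j = 0"
  proof (intro allI impI)
    fix j assume "j < n div p + 1"
    then have "j * p \<le> n div p * p" by (intro mult_le_mono1) simp
    then have "j * p < n" using n by (rule le_less_trans)
    then show "poly.coeff X j = 0"
      using coeff_power_zero_below_iff[OF assms(1), of n X] assms(3) by blast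
  qed
  show "n < (n div p + 1) * p"
    using dividend_less_div_times[of p n] assms(1) by simp
qed

lemma coeff_power_exact_order_iff:
  fixes X :: "real poly"
  assumes "0 < p"
  shows "(\<forall>k<n. poly.coeff (X ^ p) k = 0) \<and> poly.coeff (X ^ p) n \<noteq> 0 \<longleftrightarrow>
    p dvd n \<and> (\<forall>j<n div p. poly.coeff X j = 0) \<and> poly.coeff X (n div p) \<noteq> 0"
proof (cases "p dvd n")
  case False
  then show ?thesis using coeff_power_zero_at[OF assms False] by blast
next
  case True
  then obtain m where n: "n = m * p" by (metis dvdE mult.commute)
  have "(\<forall>k<n. poly.coeff (X ^ p) k = 0) \<longleftrightarrow> (\<forall>j<m. poly.coeff X j = 0)"
    unfolding coeff_power_zero_below_iff[OF assms] n using assms by simp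
  then show ?thesis
    using coeff_power_low_order(2)[of m X p] assms by (auto simp: n)
qed

section \<open>Values on elementary sets\<close>

lemma ex_bij_betw_lessThan_card: "finite F \<Longrightarrow> \<exists>h. bij_betw h {..<card F} F"
  using ex_bij_betw_nat_finite[of F] by (simp add: atLeast0LessThan)

lemma constructible_coords:
  assumes S: "S \<in> constructible r" and J: "J ` {..<r} \<subseteq> {..<N}" and Z: "Z \<subseteq> {..<N}"
  shows "{a \<in> aff N. (\<forall>i\<in>Z. a i = 0) \<and> (\<lambda>j. if j < r then a (J j) else 0) \<in> S} \<in> constructible N"
proof (rule constructible_conj)
  show "{a \<in> aff N. \<forall>i\<in>Z. a i = 0} \<in> constructible N"
  proof (rule constructible_ball)
    show "finite Z" using Z finite_subset by blast
    show "{a \<in> aff N. a i = 0} \<in> constructible N" if "i \<in> Z" for i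
      using that Z by (intro constructible.zero polyfun.coord) auto
  qed
  show "{a \<in> aff N. (\<lambda>j. if j < r then a (J j) else 0) \<in> S} \<in> constructible N"
  proof (rule constructible_preimage[OF S])
    show "(\<lambda>a. if j < r then a (J j) else 0) \<in> polyfun N" if "j < r" for j
    proof -
      have "J j < N" using J that by auto
      then show ?thesis using that by (simp add: polyfun.coord)
    qed
    show "(\<lambda>j. if j < r then a (J j) else 0) \<in> aff r" for a :: "nat \<Rightarrow> real"
      by (simp add: in_aff)
  qed
qed

definition nonzero_line :: "(nat \<Rightarrow> real) set" where
  "nonzero_line = {x \<in> aff 1. x 0 \<noteq> 0}"

definition graph_curve :: "real \<Rightarrow> nat \<Rightarrow> (nat \<Rightarrow> real) set" where
  "graph_curve c k = {z \<in> aff 2. z 0 = c * z 1 ^ k}"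

lemma constructible_nonzero_line: "nonzero_line \<in> constructible 1"
  unfolding nonzero_line_def
  by (rule constructible_not[OF constructible.zero]) (simp add: polyfun.coord)

lemma polyfun_graph: "(\<lambda>z. c * z 1 ^ k) \<in> polyfun 2"
  by (rule polyfun.mult[OF polyfun.const polyfun_power[OF polyfun.coord]]) simp

lemma constructible_graph_curve: "graph_curve c k \<in> constructible 2"
  unfolding graph_curve_def
  by (rule constructible_eq[OF _ polyfun_graph]) (simp add: polyfun.coord)

context virtual_poincare_polynomial
begin

text \<open>The common shape of all coefficient sets: the coordinates in Z vanish, those selected by
  J form a point of S, and each of the remaining ones contributes a factor u.\<close>

lemma aff_beta_coords:
  assumes S: "S \<in> constructible r" and J: "J ` {..<r} \<subseteq> {..<N}" "inj_on J {..<r}"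
    and Z: "Z \<subseteq> {..<N}" "Z \<inter> J ` {..<r} = {}"
  shows "aff_beta {a \<in> aff N. (\<forall>i\<in>Z. a i = 0) \<and> (\<lambda>j. if j < r then a (J j) else 0) \<in> S}
    = aff_beta S * [:0, 1:] ^ (N - card Z - r)"
proof -
  let ?X = "{a \<in> aff N. (\<forall>i\<in>Z. a i = 0) \<and> (\<lambda>j. if j < r then a (J j) else 0) \<in> S}"
  define F where "F = {..<N} - Z - J ` {..<r}"
  define f where "f = card F"
  have finZ: "finite Z" using Z finite_subset by blast
  have cF: "f = N - card Z - r"
    unfolding f_def F_def using J Z finZ
    by (subst card_Diff_subset; (subst card_Diff_subset)?) (auto simp: card_image)
  obtain h where h: "bij_betw h {..<f} F"
    using ex_bij_betw_lessThan_card[of F] unfolding f_def F_def by auto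
  have hF: "h j \<in> F" if "j < f" for j
    using h that by (auto simp: bij_betw_def)
  \<comment> \<open>The coordinates are rearranged: the constrained ones first, then the free ones
    as enumerated by h, while the vanishing ones are dropped. \<open>\<Psi>\<close> puts them
    back.\<close>
  define \<Phi> where "\<Phi> a = (\<lambda>j. if j < r then a (J j) else if j < r + f then a (h (j - r)) else 0)"
    for a :: "nat \<Rightarrow> real"
  define \<Psi> where "\<Psi> z = (\<lambda>i. if i \<in> J ` {..<r} then z (the_inv_into {..<r} J i)
     else if i \<in> F then z (r + the_inv_into {..<f} h i) else 0)" for z :: "nat \<Rightarrow> real"
  have FN: "F \<subseteq> {..<N}" "F \<inter> J ` {..<r} = {}" "F \<inter> Z = {}" by (auto simp: F_def)
  have inv_h: "the_inv_into {..<f} h (h j) = j" if "j < f" for j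
    using h that by (simp add: bij_betw_def the_inv_into_f_f)
  have h_inv: "the_inv_into {..<f} h i < f \<and> h (the_inv_into {..<f} h i) = i" if iF: "i \<in> F" for i
  proof -
    obtain j where "j < f" "i = h j" using h iF by (auto simp: bij_betw_def)
    then show ?thesis using inv_h by simp
  qed
  have inv_J: "the_inv_into {..<r} J (J j) = j" if "j < r" for j
    using J that by (simp add: the_inv_into_f_f)
  have P: "aff_prod r S (aff f) \<in> constructible (r + f)"
    by (rule constructible_aff_prod[OF S constructible_aff])
  have sP: "aff_prod r S (aff f) \<subseteq> aff (r + f)"
    by (rule constructible_subset[OF P])
  have "aff_beta ?X = aff_beta (aff_prod r S (aff f))"
  proof (rule aff_beta_iso[OF constructible_coords[OF S J(1) Z(1)] P, of \<Phi> \<Psi>])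
    show "polymap N (r + f) \<Phi>"
      unfolding polymap_def
    proof (intro conjI allI impI ballI)
      fix j assume "j < r + f"
      then have "h (j - r) < N" if "\<not> j < r"
      proof -
        have "j - r < f"
          using \<open>j < r + f\<close> that by linarith
        then show ?thesis
          using hF FN(1) by blast
      qed
      then show "(\<lambda>a. \<Phi> a j) \<in> polyfun N"
        using J(1) \<open>j < r + f\<close> by (cases "j < r") (auto simp: \<Phi>_def intro!: polyfun.coord)
    qed (simp add: \<Phi>_def in_aff)
    show "polymap (r + f) N \<Psi>"
      unfolding polymap_def
    proof (intro conjI allI impI ballI)
      fix i assume "i < N"
      consider j where "j < r" "i = J j" | "i \<notin> J ` {..<r}" "i \<in> F" | "i \<notin> J ` {..<r}" "i \<notin> F" by blast
      then show "(\<lambda>z. \<Psi> z i) \<in> polyfun (r + f)"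
        by cases (use h_inv[of i] in \<open>auto simp: \<Psi>_def inv_J intro!: polyfun.coord polyfun.const\<close>)
    next
      show "\<Psi> z \<in> aff N" for z
        using J(1) FN(1) by (auto simp: \<Psi>_def in_aff)
    qed
  next
    fix a assume a: "a \<in> ?X"
    have "(\<lambda>i. if i < r then \<Phi> a i else 0) = (\<lambda>j. if j < r then a (J j) else 0)"
      by (auto simp: \<Phi>_def)
    then show "\<Phi> a \<in> aff_prod r S (aff f)"
      using a by (simp add: aff_prod_def in_aff) (simp add: \<Phi>_def)
    show "\<Psi> (\<Phi> a) = a"
    proof
      fix i
      consider j where "j < r" "i = J j" | "i \<notin> J ` {..<r}" "i \<in> F" | "i \<notin> J ` {..<r}" "i \<notin> F" by blast
      then show "\<Psi> (\<Phi> a) i = a i"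
      proof cases
        case 3
        then have "i \<in> Z \<or> i \<ge> N" by (auto simp: F_def)
        then have "a i = 0" using a by (auto simp: in_aff)
        then show ?thesis using 3 by (simp add: \<Psi>_def)
      qed (use h_inv[of i] in \<open>auto simp: \<Psi>_def \<Phi>_def inv_J\<close>)
    qed
  next
    fix z assume z: "z \<in> aff_prod r S (aff f)"
    show "\<Phi> (\<Psi> z) = z"
    proof
      fix j
      consider "j < r" | "r \<le> j" "j < r + f" | "r + f \<le> j" by linarith
      then show "\<Phi> (\<Psi> z) j = z j"
      proof cases
        case 2
        then have lt: "j - r < f" by linarith
        then have "h (j - r) \<in> F" "h (j - r) \<notin> J ` {..<r}"
          using hF[OF lt] FN(2) by blast+
        then show ?thesis using 2 lt inv_h[of "j - r"] by (simp add: \<Phi>_def \<Psi>_def)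
      next
        case 3
        then show ?thesis using z sP by (auto simp: \<Phi>_def in_aff)
      qed (auto simp: \<Phi>_def \<Psi>_def inv_J)
    qed
    have "(\<lambda>j. if j < r then \<Psi> z (J j) else 0) = (\<lambda>i. if i < r then z i else 0)"
      by (auto simp: \<Psi>_def inv_J)
    moreover have "\<Psi> z i = 0" if "i \<in> Z" for i
      using that FN(3) Z(2) by (auto simp: \<Psi>_def)
    moreover have "\<Psi> z \<in> aff N"
      using J(1) FN(1) by (auto simp: \<Psi>_def in_aff)
    ultimately show "\<Psi> z \<in> ?X"
      using z by (simp add: aff_prod_def)
  qed
  then show ?thesis
    using aff_beta_prod[OF S constructible_aff, of f] by (simp add: aff_beta_aff cF)
qed

lemma aff_beta_nonzero_line: "aff_beta nonzero_line = [:-1, 1:]"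
proof -
  have "{x \<in> aff 1. x 0 = 0} = {\<lambda>i. 0}"
  proof -
    have "x = (\<lambda>i. 0)" if "x \<in> aff 1" "x 0 = 0" for x
    proof
      show "x i = 0" for i using that by (cases i) (auto simp: in_aff)
    qed
    then show ?thesis by (auto simp: in_aff)
  qed
  then have "{\<lambda>i. 0} \<in> constructible 1" and eq: "nonzero_line = aff 1 - {\<lambda>i. 0}"
    using constructible.zero[of "\<lambda>x. x 0" 1] polyfun.coord[of 0 1] by (auto simp: nonzero_line_def)
  then have "aff_beta nonzero_line = aff_beta (aff 1) - aff_beta {\<lambda>i. 0}"
    unfolding eq by (intro aff_beta_Diff[OF constructible_aff]) (auto simp: in_aff)
  then show ?thesis
    by (simp add: aff_beta_line[unfolded One_nat_def] aff_beta_point one_pCons)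
qed

lemma aff_beta_graph_curve: "aff_beta (graph_curve c k) = [:0, 1:]"
proof -
  have "aff_beta (graph_curve c k) = aff_beta (aff 1)"
  proof (rule aff_beta_iso[OF constructible_graph_curve constructible_aff])
    let ?\<Phi> = "\<lambda>z i. if i = (0::nat) then z (1::nat) else (0::real)"
    let ?\<Psi> = "\<lambda>y i. if i = (0::nat) then c * y 0 ^ k else if i = 1 then y (0::nat) else (0::real)"
    show "polymap 2 1 ?\<Phi>"
      by (auto simp: polymap_def in_aff intro!: polyfun.coord)
    show "polymap 1 2 ?\<Psi>"
      unfolding polymap_def
    proof (intro conjI allI impI ballI)
      fix j :: nat assume "j < 2"
      then consider "j = 0" | "j = 1" by linarith
      then show "(\<lambda>y. ?\<Psi> y j) \<in> polyfun 1"
        by cases (simp_all add: polyfun.intros polyfun_power)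
    qed (auto simp: in_aff)
    show "?\<Phi> a \<in> aff 1" for a by (simp add: in_aff)
    show "?\<Psi> b \<in> graph_curve c k" for b by (simp add: graph_curve_def in_aff)
    show "?\<Psi> (?\<Phi> a) = a" if "a \<in> graph_curve c k" for a
    proof
      fix i
      show "?\<Psi> (?\<Phi> a) i = a i"
        by (rule aff_2_cases[of i]) (use that in \<open>auto simp: graph_curve_def in_aff\<close>)
    qed
    show "?\<Phi> (?\<Psi> b) = b" if "b \<in> aff 1" for b
    proof
      show "?\<Phi> (?\<Psi> b) i = b i" for i
        using that by (cases i) (auto simp: in_aff)
    qed
  qed
  then show ?thesis by (simp only: aff_beta_line)
qed

end

lemma odd_power_eq_iff:
  fixes x y :: real
  assumes "odd p"
  shows "x ^ p = y ^ p \<longleftrightarrow> x = y"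
  using odd_real_root_power_cancel[OF assms] by metis

lemma even_power_eq_iff:
  fixes x y :: real
  assumes "even p" "0 < p"
  shows "x ^ p = y ^ p \<longleftrightarrow> x = y \<or> x = - y"
proof -
  have "x ^ p = y ^ p \<longleftrightarrow> \<bar>x\<bar> ^ p = \<bar>y\<bar> ^ p"
    using assms(1) by (simp add: power_even_abs)
  also have "\<dots> \<longleftrightarrow> \<bar>x\<bar> = \<bar>y\<bar>"
    using assms(2) by (intro power_eq_iff_eq_base) auto
  finally show ?thesis by (simp add: abs_eq_iff)
qed

text \<open>Here \<open>z 0\<close> and \<open>z 1\<close> stand for x_k and y_1; for q = k p the
  expression is the coefficient of the arc at t^q once the earlier x_j vanish.\<close>

definition binomial_complement :: "real \<Rightarrow> nat \<Rightarrow> real \<Rightarrow> nat \<Rightarrow> (nat \<Rightarrow> real) set" where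
  "binomial_complement \<sigma> p \<tau> k = {z \<in> aff 2. \<sigma> * z 0 ^ p + \<tau> * z 1 ^ (k * p) \<noteq> 0}"

lemma polyfun_binomial: "(\<lambda>z. \<sigma> * z 0 ^ p + \<tau> * z 1 ^ m) \<in> polyfun 2"
  by (intro polyfun.add polyfun.mult polyfun.const polyfun_power polyfun.coord) auto

lemma constructible_binomial_complement: "binomial_complement \<sigma> p \<tau> k \<in> constructible 2"
  unfolding binomial_complement_def
  by (rule constructible_not[OF constructible.zero[OF polyfun_binomial]])

lemma constructible_origin: "{\<lambda>i. 0} \<in> constructible N"
proof -
  have "{x \<in> aff N. \<forall>i\<in>{..<N}. x i = 0} \<in> constructible N"
    by (rule constructible_ball) (auto intro!: constructible.zero polyfun.coord)
  moreover have "{x \<in> aff N. \<forall>i\<in>{..<N}. x i = 0} = {\<lambda>i. 0}"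
  proof -
    have "x = (\<lambda>i. 0)" if "x \<in> aff N" "\<forall>i\<in>{..<N}. x i = 0" for x
    proof
      show "x i = 0" for i using that by (cases "i < N") (auto simp: in_aff)
    qed
    then show ?thesis by (auto simp: in_aff)
  qed
  ultimately show ?thesis by simp
qed

text \<open>
  The coordinates stand for \<open>x\<^sub>k\<close>, \<open>y\<^sub>1\<close>, \<open>x\<^sub>k\<^sub>+\<^sub>1\<close>, \<open>y\<^sub>2\<close>.  For odd \<open>p\<close> the coefficient at \<open>t\<^sup>q\<close> vanishes on
  the graph; there the coefficient at \<open>t\<^sup>q\<^sup>+\<^sup>1\<close> is \<open>y\<^sub>1\<close> to the power \<open>k (p - 1)\<close> times the linear form in
  \<open>x\<^sub>k\<^sub>+\<^sub>1\<close> and \<open>y\<^sub>2\<close> appearing here, with \<open>l = k - 1\<close>.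
\<close>

definition jet_curve :: "real \<Rightarrow> nat \<Rightarrow> real \<Rightarrow> real \<Rightarrow> nat \<Rightarrow> (nat \<Rightarrow> real) set" where
  "jet_curve c k A B l = {z \<in> aff 4. z 0 = c * z 1 ^ k \<and> z 1 \<noteq> 0 \<and> A * z 2 + B * z 1 ^ l * z 3 \<noteq> 0}"

lemma constructible_jet_curve: "jet_curve c k A B l \<in> constructible 4"
  unfolding jet_curve_def
proof (intro constructible_conj)
  show "{z \<in> aff 4. z 0 = c * z 1 ^ k} \<in> constructible 4"
    by (rule constructible_eq) (intro polyfun.mult polyfun.const polyfun_power polyfun.coord; simp)+
  show "{z \<in> aff 4. z 1 \<noteq> 0} \<in> constructible 4"
    by (rule constructible_not[OF constructible.zero]) (intro polyfun.coord; simp)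
  show "{z \<in> aff 4. A * z 2 + B * z 1 ^ l * z 3 \<noteq> 0} \<in> constructible 4"
    by (rule constructible_not[OF constructible.zero])
      (intro polyfun.add polyfun.mult polyfun.const polyfun_power polyfun.coord; simp)
qed

context virtual_poincare_polynomial
begin

lemma aff_beta_binomial_complement:
  assumes \<sigma>: "\<sigma> \<in> {1, -1}" and \<tau>: "\<tau> \<in> {1, -1}" and p: "0 < p" and k: "0 < k"
  shows "aff_beta (binomial_complement \<sigma> p \<tau> k) =
    (if odd p then [:0, -1, 1:] else if \<sigma> = \<tau> then [:-1, 0, 1:] else [:1, -2, 1:])"
proof -
  let ?Z = "{z \<in> aff 2. \<sigma> * z 0 ^ p + \<tau> * z 1 ^ (k * p) = 0}"
  have Z: "?Z \<in> constructible 2"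
    by (rule constructible.zero[OF polyfun_binomial])
  have "binomial_complement \<sigma> p \<tau> k = aff 2 - ?Z"
    unfolding binomial_complement_def by blast
  then have *: "aff_beta (binomial_complement \<sigma> p \<tau> k) = [:0, 0, 1:] - aff_beta ?Z"
    using aff_beta_Diff[OF constructible_aff Z] by (simp add: aff_beta_aff power2_eq_square)
  \<comment> \<open>Each sign is its own inverse, so the quotient of the two coefficients is the
    product \<open>\<sigma> * \<tau>\<close>.\<close>
  have zero_iff: "\<sigma> * x ^ p + \<tau> * y ^ (k * p) = 0 \<longleftrightarrow> x ^ p = - (\<sigma> * \<tau>) * (y ^ k) ^ p" for x y :: real
    using \<sigma> \<tau> by (auto simp: power_mult)
  show ?thesis
  proof (cases "odd p")
    case True
    have "\<sigma> * x ^ p + \<tau> * y ^ (k * p) = 0 \<longleftrightarrow> x = - (\<sigma> * \<tau>) * y ^ k" for x y :: real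
    proof -
      \<comment> \<open>An odd power absorbs the sign, so the curve is the graph of one function of
        \<open>z 1\<close>.\<close>
      have "- (\<sigma> * \<tau>) * (y ^ k) ^ p = (- (\<sigma> * \<tau>) * y ^ k) ^ p"
        using \<sigma> \<tau> True by (auto simp: power_mult_distrib)
      then show ?thesis
        unfolding zero_iff by (simp only: odd_power_eq_iff[OF True])
    qed
    then have "?Z = graph_curve (- (\<sigma> * \<tau>)) k"
      unfolding graph_curve_def by simp
    then show ?thesis
      using True by (simp add: * aff_beta_graph_curve)
  next
    case even: False
    show ?thesis
    proof (cases "\<sigma> = \<tau>")
      case True
      have "x = 0 \<and> y = 0" if "\<sigma> * x ^ p + \<tau> * y ^ (k * p) = 0" for x y :: real
      proof -
        have "x ^ p = - ((y ^ k) ^ p)"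
          using that \<sigma> True unfolding zero_iff by auto
        moreover have "x ^ p \<ge> 0" "(y ^ k) ^ p \<ge> 0"
          using even by (auto simp: zero_le_even_power)
        ultimately have "x ^ p = 0" "(y ^ k) ^ p = 0" by linarith+
        then show ?thesis by simp
      qed
      then have "z = (\<lambda>i. 0)" if "z \<in> ?Z" for z
      proof -
        have "z 0 = 0" "z 1 = 0" "z \<in> aff 2"
          using that \<open>\<And>y x. \<sigma> * x ^ p + \<tau> * y ^ (k * p) = 0 \<Longrightarrow> x = 0 \<and> y = 0\<close> by blast+
        then show ?thesis using aff_2_nonzero by blast
      qed
      moreover have "(\<lambda>i. 0) \<in> ?Z" using p k by (simp add: in_aff power_0_left)
      ultimately have Z0: "?Z = {\<lambda>i. 0}" by blast
      have "aff_beta (binomial_complement \<sigma> p \<tau> k) = [:0, 0, 1:] - 1"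
        unfolding * Z0 aff_beta_point ..
      then show ?thesis
        using even True by (simp add: one_pCons)
    next
      case False
      then have st: "- (\<sigma> * \<tau>) = 1" using \<sigma> \<tau> by auto
      have "?Z = graph_curve 1 k \<union> graph_curve (-1) k"
        unfolding graph_curve_def zero_iff st using even_power_eq_iff[OF _ p] even by auto
      \<comment> \<open>The two graphs meet only at the origin, which is removed from one of them to
        obtain a disjoint union.\<close>
      also have "\<dots> = graph_curve 1 k \<union> (graph_curve (-1) k - {\<lambda>i. 0})"
        using k by (auto simp: graph_curve_def in_aff)
      finally have eq: "?Z = graph_curve 1 k \<union> (graph_curve (-1) k - {\<lambda>i. 0})" .
      have or: "{\<lambda>i. 0} \<subseteq> graph_curve (-1) k"
        using k by (simp add: graph_curve_def in_aff)
      have "graph_curve 1 k \<inter> (graph_curve (-1) k - {\<lambda>i. 0}) = {}"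
      proof -
        have "z = (\<lambda>i. 0)" if "z \<in> graph_curve 1 k" "z \<in> graph_curve (-1) k" for z
        proof -
          have "z 1 ^ k = 0" "z 0 = z 1 ^ k" "z \<in> aff 2"
            using that by (auto simp: graph_curve_def)
          then have "z 0 = 0" "z 1 = 0" by auto
          then show ?thesis using aff_2_nonzero \<open>z \<in> aff 2\<close> by blast
        qed
        then show ?thesis by blast
      qed
      then have "aff_beta ?Z = [:0, 1:] + ([:0, 1:] - 1)"
        unfolding eq using aff_beta_Diff[OF constructible_graph_curve constructible_origin or]
        by (simp only: aff_beta_Un[OF constructible_graph_curve
              constructible_Diff[OF constructible_graph_curve constructible_origin]]
            aff_beta_graph_curve aff_beta_point)
      then show ?thesis
        using even False by (simp add: * one_pCons)
    qed
  qed
qed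

text \<open>The graph condition eliminates \<open>z 0\<close>. As A is nonzero, the linear form can
  replace \<open>z 2\<close> as a coordinate, so the set becomes two punctured lines, for
  \<open>z 1\<close> and the form, times a line for \<open>z 3\<close>.\<close>

lemma aff_beta_jet_curve:
  assumes "A \<noteq> 0"
  shows "aff_beta (jet_curve c k A B l) = [:-1, 1:] ^ 2 * [:0, 1:]"
proof -
  let ?Y = "aff_prod 1 nonzero_line (aff_prod 1 nonzero_line (aff 1))"
  have "(1::nat) + (1 + 1) = 3" by simp
  then have Y: "?Y \<in> constructible 3"
    using constructible_aff_prod[OF constructible_nonzero_line
        constructible_aff_prod[OF constructible_nonzero_line constructible_aff[of 1]]]
    by (simp only:)
  have memY: "w \<in> ?Y \<longleftrightarrow> w \<in> aff 3 \<and> w 0 \<noteq> 0 \<and> w 1 \<noteq> 0" for w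
  proof -
    have "w \<in> aff 3 \<longleftrightarrow> (\<forall>i\<ge>1. w (Suc (Suc i)) = 0)"
    proof
      assume *: "\<forall>i\<ge>1. w (Suc (Suc i)) = 0"
      show "w \<in> aff 3"
        unfolding in_aff
      proof (intro allI impI)
        fix i :: nat assume "3 \<le> i"
        then have "i = Suc (Suc (i - 2))" "1 \<le> i - 2" by auto
        then show "w i = 0" using * by metis
      qed
    qed (simp add: in_aff)
    then show ?thesis
      by (auto simp: aff_prod_def nonzero_line_def in_aff)
  qed
  define \<Phi> where "\<Phi> z = (\<lambda>i::nat. if i = 0 then z 1 else if i = 1 then A * z 2 + B * z 1 ^ l * z 3
    else if i = 2 then z 3 else 0)" for z :: "nat \<Rightarrow> real"
  define \<Psi> where "\<Psi> w = (\<lambda>i::nat. if i = 0 then c * w 0 ^ k else if i = 1 then w 0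
    else if i = 2 then (1 / A) * (w 1 - B * w 0 ^ l * w 2) else if i = 3 then w 2 else 0)"
    for w :: "nat \<Rightarrow> real"
  have "aff_beta (jet_curve c k A B l) = aff_beta ?Y"
  proof (rule aff_beta_iso[OF constructible_jet_curve Y, of \<Phi> \<Psi>])
    show "polymap 4 3 \<Phi>"
      unfolding polymap_def
    proof (intro conjI allI impI ballI)
      fix j :: nat assume "j < 3"
      then consider "j = 0" | "j = 1" | "j = 2" by linarith
      then show "(\<lambda>z. \<Phi> z j) \<in> polyfun 4"
      proof cases
        case 2
        have "(\<lambda>z. A * z 2 + B * z 1 ^ l * z 3) \<in> polyfun 4"
          by (intro polyfun.add polyfun.mult polyfun.const polyfun_power polyfun.coord; simp)
        then show ?thesis by (simp add: \<Phi>_def 2)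
      qed (simp_all add: \<Phi>_def polyfun.coord)
    qed (simp add: \<Phi>_def in_aff)
    show "polymap 3 4 \<Psi>"
      unfolding polymap_def
    proof (intro conjI allI impI ballI)
      fix j :: nat assume "j < 4"
      then consider "j = 0" | "j = 1" | "j = 2" | "j = 3" by linarith
      then show "(\<lambda>w. \<Psi> w j) \<in> polyfun 3"
      proof cases
        case 1
        have "(\<lambda>w. c * w 0 ^ k) \<in> polyfun 3"
          by (intro polyfun.mult polyfun.const polyfun_power polyfun.coord; simp)
        then show ?thesis by (simp add: \<Psi>_def 1)
      next
        case 3
        have "(\<lambda>w. (1 / A) * (w 1 - B * w 0 ^ l * w 2)) \<in> polyfun 3"
          by (intro polyfun_diff polyfun.mult polyfun.const polyfun_power polyfun.coord; simp)
        then show ?thesis by (simp add: \<Psi>_def 3)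
      qed (simp_all add: \<Psi>_def polyfun.coord)
    qed (simp add: \<Psi>_def in_aff)
    show "\<Phi> z \<in> ?Y" if "z \<in> jet_curve c k A B l" for z
      using that unfolding memY jet_curve_def by (simp add: \<Phi>_def in_aff)
    show "\<Psi> w \<in> jet_curve c k A B l" if "w \<in> ?Y" for w
      using that assms unfolding memY jet_curve_def by (simp add: \<Psi>_def in_aff)
    show "\<Psi> (\<Phi> z) = z" if z: "z \<in> jet_curve c k A B l" for z
    proof
      fix i :: nat
      consider "i = 0" | "i = 1" | "i = 2" | "i = 3" | "4 \<le> i" by linarith
      then show "\<Psi> (\<Phi> z) i = z i"
        using z assms by cases (auto simp: \<Psi>_def \<Phi>_def jet_curve_def in_aff)
    qed
    show "\<Phi> (\<Psi> w) = w" if w: "w \<in> ?Y" for w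
    proof
      fix i :: nat
      consider "i = 0" | "i = 1" | "i = 2" | "3 \<le> i" by linarith
      then show "\<Phi> (\<Psi> w) i = w i"
        using w assms unfolding memY by cases (auto simp: \<Psi>_def \<Phi>_def in_aff)
    qed
  qed
  also have "\<dots> = [:-1, 1:] * ([:-1, 1:] * [:0, 1:])"
    by (simp only: aff_beta_prod[OF constructible_nonzero_line
          constructible_aff_prod[OF constructible_nonzero_line constructible_aff]]
        aff_beta_prod[OF constructible_nonzero_line constructible_aff] aff_beta_nonzero_line aff_beta_line)
  finally show ?thesis by (simp only: power2_eq_square mult.assoc)
qed

end

section \<open>The coefficients of the zeta functions\<close>

text \<open>The positions, in the encoding used by \<^const>\<open>trunc_arc\<close>, of the coefficients of
  \<open>t, \<dots>, t\<^sup>m\<^sup>-\<^sup>1\<close> in component \<open>0\<close>.\<close>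

definition leading_coords :: "nat \<Rightarrow> nat \<Rightarrow> nat set" where
  "leading_coords d m = (\<lambda>j. (j - 1) * d) ` {1..<m}"

lemma leading_coords_subset: "0 < d \<Longrightarrow> m \<le> n + 1 \<Longrightarrow> leading_coords d m \<subseteq> {..<n * d}"
  by (auto simp: leading_coords_def)

lemma card_leading_coords:
  assumes "0 < d"
  shows "card (leading_coords d m) = m - 1"
proof -
  have "inj_on (\<lambda>j. (j - 1) * d) {1..<m}"
    using assms by (auto simp: inj_on_def)
  then show ?thesis
    by (simp add: leading_coords_def card_image)
qed

lemma coeff_arc_poly_zero_below:
  assumes "m \<le> n + 1"
  shows "(\<forall>j<m. poly.coeff (arc_poly d n a 0) j = 0) \<longleftrightarrow> (\<forall>i\<in>leading_coords d m. a i = 0)"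
  using assms by (auto simp: coeff_arc_poly leading_coords_def)

lemma in_nonzero_line: "(\<lambda>j. if j < 1 then a (J j) else 0) \<in> nonzero_line \<longleftrightarrow> a (J 0) \<noteq> 0"
  by (auto simp: nonzero_line_def in_aff)

lemma in_binomial_complement:
  "(\<lambda>j. if j < 2 then a (J j) else 0) \<in> binomial_complement \<sigma> p \<tau> k \<longleftrightarrow>
    \<sigma> * a (J 0) ^ p + \<tau> * a (J 1) ^ (k * p) \<noteq> 0"
  by (auto simp: binomial_complement_def in_aff)

lemma in_jet_curve:
  "(\<lambda>j. if j < 4 then a (J j) else 0) \<in> jet_curve c k A B l \<longleftrightarrow>
    a (J 0) = c * a (J 1) ^ k \<and> a (J 1) \<noteq> 0 \<and> A * a (J 2) + B * a (J 1) ^ l * a (J 3) \<noteq> 0"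
  by (auto simp: jet_curve_def in_aff)

lemma chi_monomial:
  assumes "\<sigma> \<noteq> 0"
  shows "chi 1 (\<lambda>x. \<sigma> * x 0 ^ p) n = {a \<in> aff (n * 1).
    (\<forall>k<n. poly.coeff (arc_poly 1 n a 0 ^ p) k = 0) \<and> poly.coeff (arc_poly 1 n a 0 ^ p) n \<noteq> 0}"
  using chi_eq_coeffs[of "\<lambda>a. Polynomial.smult \<sigma> (arc_poly 1 n a 0 ^ p)" "\<lambda>x. \<sigma> * x 0 ^ p" 1 n] assms
  by (simp add: poly_arc_poly)

definition brieskorn_coeff :: "real \<Rightarrow> nat \<Rightarrow> real \<Rightarrow> nat \<Rightarrow> nat \<Rightarrow> (nat \<Rightarrow> real) \<Rightarrow> nat \<Rightarrow> real" where
  "brieskorn_coeff \<sigma> p \<tau> q n a k =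
    \<sigma> * poly.coeff (arc_poly 2 n a 0 ^ p) k + \<tau> * poly.coeff (arc_poly 2 n a 1 ^ q) k"

lemma chi_brieskorn:
  "chi 2 (brieskorn \<sigma> p \<tau> q) n = {a \<in> aff (n * 2).
    (\<forall>k<n. brieskorn_coeff \<sigma> p \<tau> q n a k = 0) \<and> brieskorn_coeff \<sigma> p \<tau> q n a n \<noteq> 0}"
  using chi_eq_coeffs[of "\<lambda>a. Polynomial.smult \<sigma> (arc_poly 2 n a 0 ^ p) + Polynomial.smult \<tau> (arc_poly 2 n a 1 ^ q)"
      "brieskorn \<sigma> p \<tau> q" 2 n]
  by (simp add: poly_arc_poly brieskorn_def brieskorn_coeff_def)

text \<open>The case m = 1 of \<open>coeff_power_low_order\<close>, as arcs start at the origin. The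
  entries \<open>a i\<close> and \<open>a (d + i)\<close> are the coefficients of t and t^2 in
  component i.\<close>

lemma coeff_arc_poly_power:
  shows "k < q \<Longrightarrow> poly.coeff (arc_poly d n a i ^ q) k = 0"
    and "1 \<le> n \<Longrightarrow> poly.coeff (arc_poly d n a i ^ q) q = a i ^ q"
    and "2 \<le> n \<Longrightarrow> poly.coeff (arc_poly d n a i ^ q) (q + 1) = of_nat q * a i ^ (q - 1) * a (d + i)"
proof -
  have *: "\<forall>j<1. poly.coeff (arc_poly d n a i) j = 0"
    by (simp add: coeff_arc_poly)
  show "k < q \<Longrightarrow> poly.coeff (arc_poly d n a i ^ q) k = 0"
    using coeff_power_low_order(1)[OF *, of k q] by simp
  show "1 \<le> n \<Longrightarrow> poly.coeff (arc_poly d n a i ^ q) q = a i ^ q"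
    using coeff_power_low_order(2)[OF *, of q] by (simp add: coeff_arc_poly)
  show "2 \<le> n \<Longrightarrow> poly.coeff (arc_poly d n a i ^ q) (q + 1) = of_nat q * a i ^ (q - 1) * a (d + i)"
    using coeff_power_low_order(3)[OF *, of q] by (simp add: coeff_arc_poly)
qed

context virtual_poincare_polynomial
begin

text \<open>With m = n/p, the power has order exactly n iff the first m - 1 coefficients of
  component 0 vanish and the m-th does not; the other n d - m coordinates are free. The dimension d
  is left general to serve both x^p alone (d = 1) and g below q (d = 2).\<close>

lemma aff_beta_exact_order:
  assumes d: "0 < d" and p: "0 < p" and n: "0 < n"
  shows "aff_beta {a \<in> aff (n * d). (\<forall>k<n. poly.coeff (arc_poly d n a 0 ^ p) k = 0)
      \<and> poly.coeff (arc_poly d n a 0 ^ p) n \<noteq> 0}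
    = (if p dvd n then [:-1, 1:] * [:0, 1:] ^ (n * d - n div p) else 0)"
proof (cases "p dvd n")
  case False
  then show ?thesis
    by (simp only: coeff_power_exact_order_iff[OF p]) (simp add: aff_beta_empty)
next
  case True
  define m where "m = n div p"
  have m: "1 \<le> m" "m \<le> n"
    using True n p by (auto simp: m_def div_greater_zero_iff dvd_imp_le Suc_le_eq)
  define J where "J j = (m - 1) * d" for j :: nat
  have "{a \<in> aff (n * d). (\<forall>k<n. poly.coeff (arc_poly d n a 0 ^ p) k = 0)
      \<and> poly.coeff (arc_poly d n a 0 ^ p) n \<noteq> 0}
    = {a \<in> aff (n * d). (\<forall>i\<in>leading_coords d m. a i = 0)
      \<and> (\<lambda>j. if j < 1 then a (J j) else 0) \<in> nonzero_line}"
    unfolding coeff_power_exact_order_iff[OF p] in_nonzero_line m_def[symmetric]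
    using True m coeff_arc_poly_zero_below[of m n d] by (simp add: coeff_arc_poly J_def)
  moreover have "aff_beta \<dots> = aff_beta nonzero_line * [:0, 1:] ^ (n * d - card (leading_coords d m) - 1)"
  proof (rule aff_beta_coords[OF constructible_nonzero_line])
    have "(m - 1) * d < n * d" using m d by simp
    then show "J ` {..<1} \<subseteq> {..<n * d}" by (auto simp: J_def)
    show "leading_coords d m \<subseteq> {..<n * d}"
      using d m by (intro leading_coords_subset) auto
    show "leading_coords d m \<inter> J ` {..<1} = {}"
      using d by (auto simp: leading_coords_def J_def)
  qed (simp add: inj_on_def)
  moreover have "n * d - card (leading_coords d m) - 1 = n * d - m"
    using m by (simp add: card_leading_coords[OF d])
  ultimately show ?thesis
    using True by (simp add: aff_beta_nonzero_line m_def)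
qed

lemma aff_beta_chi_monomial:
  assumes "\<sigma> \<noteq> 0" "0 < p" "0 < n"
  shows "aff_beta (chi 1 (\<lambda>x. \<sigma> * x 0 ^ p) n) = (if p dvd n then [:-1, 1:] * [:0, 1:] ^ (n - n div p) else 0)"
  unfolding chi_monomial[OF assms(1)]
  using aff_beta_exact_order[of 1 p n] assms by simp

lemma aff_beta_chi_brieskorn_below:
  assumes "\<sigma> \<noteq> 0" "0 < p" "0 < n" "n < q"
  shows "aff_beta (chi 2 (brieskorn \<sigma> p \<tau> q) n)
    = (if p dvd n then [:-1, 1:] * [:0, 1:] ^ (2 * n - n div p) else 0)"
proof -
  have "brieskorn_coeff \<sigma> p \<tau> q n a k = \<sigma> * poly.coeff (arc_poly 2 n a 0 ^ p) k" if "k \<le> n" for a k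
    using that assms coeff_arc_poly_power(1)[of k q] by (simp add: brieskorn_coeff_def)
  then have "chi 2 (brieskorn \<sigma> p \<tau> q) n = {a \<in> aff (n * 2).
      (\<forall>k<n. poly.coeff (arc_poly 2 n a 0 ^ p) k = 0) \<and> poly.coeff (arc_poly 2 n a 0 ^ p) n \<noteq> 0}"
    unfolding chi_brieskorn using assms(1) by auto
  then show ?thesis
    using aff_beta_exact_order[of 2 p n] assms by (simp add: mult.commute)
qed

lemma brieskorn_coeff_zero_below:
  assumes "\<sigma> \<noteq> 0" "0 < p"
  shows "(\<forall>k<q. brieskorn_coeff \<sigma> p \<tau> q n a k = 0) \<longleftrightarrow>
    (\<forall>k<q. poly.coeff (arc_poly 2 n a 0 ^ p) k = 0)"
  using assms coeff_arc_poly_power(1)[of _ q 2 n a 1] by (simp add: brieskorn_coeff_def)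

lemma aff_beta_chi_brieskorn_not_dvd:
  assumes \<sigma>: "\<sigma> \<noteq> 0" and \<tau>: "\<tau> \<noteq> 0" and p: "0 < p" and q: "0 < q" and ndvd: "\<not> p dvd q"
  shows "\<exists>e. aff_beta (chi 2 (brieskorn \<sigma> p \<tau> q) q) = [:-1, 1:] * [:0, 1:] ^ e"
proof -
  \<comment> \<open>This is q/p rounded up, so the indices below m are exactly the j with
    \<open>j * p < q\<close>, whose coefficients x_j must vanish.\<close>
  define m where "m = q div p + 1"
  have less: "j * p < q \<longleftrightarrow> j < m" for j
  proof
    assume "j * p < q"
    then have "j * p div p \<le> q div p" by (intro div_le_mono) simp
    then show "j < m" using p by (simp add: m_def)
  next
    assume "j < m"
    then have "j * p \<le> q div p * p" by (intro mult_le_mono1) (simp add: m_def)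
    also have "\<dots> < q"
      using ndvd by (metis dvd_triv_right div_times_less_eq_dividend le_neq_implies_less)
    finally show "j * p < q" .
  qed
  have mq: "m \<le> q + 1" by (simp add: m_def)
  have "chi 2 (brieskorn \<sigma> p \<tau> q) q = {a \<in> aff (q * 2). (\<forall>i\<in>leading_coords 2 m. a i = 0)
      \<and> (\<lambda>j. if j < 1 then a ((\<lambda>_. 1) j) else 0) \<in> nonzero_line}"
  proof -
    have "(\<forall>k<q. brieskorn_coeff \<sigma> p \<tau> q q a k = 0) \<and> brieskorn_coeff \<sigma> p \<tau> q q a q \<noteq> 0 \<longleftrightarrow>
        (\<forall>i\<in>leading_coords 2 m. a i = 0) \<and> a 1 \<noteq> 0" for a
    proof -
      have below: "(\<forall>k<q. poly.coeff (arc_poly 2 q a 0 ^ p) k = 0) \<longleftrightarrow> (\<forall>i\<in>leading_coords 2 m. a i = 0)"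
        unfolding coeff_power_zero_below_iff[OF p] less using coeff_arc_poly_zero_below[OF mq] by blast
      show ?thesis
        unfolding brieskorn_coeff_zero_below[OF \<sigma> p] below
        using coeff_power_zero_at[OF p ndvd, of "arc_poly 2 q a 0"] below
          coeff_arc_poly_power(2)[of q 2 a 1 q] q \<tau> by (auto simp: brieskorn_coeff_def)
    qed
    then show ?thesis
      unfolding chi_brieskorn in_nonzero_line[of _ "\<lambda>_. 1"] by (simp only:)
  qed
  moreover have "aff_beta \<dots> = aff_beta nonzero_line * [:0, 1:] ^ (q * 2 - card (leading_coords 2 m) - 1)"
  proof (rule aff_beta_coords[OF constructible_nonzero_line])
    show "(\<lambda>_::nat. 1) ` {..<1::nat} \<subseteq> {..<q * 2}" using q by auto
    show "leading_coords 2 m \<subseteq> {..<q * 2}"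
      using mq by (intro leading_coords_subset) auto
    \<comment> \<open>Position 1 holds y_1, whereas the coefficients of x sit at even
      positions.\<close>
    have "1 \<notin> leading_coords 2 m"
    proof
      assume "1 \<in> leading_coords 2 m"
      then obtain j :: nat where "1 = (j - 1) * 2" unfolding leading_coords_def by blast
      then show False by presburger
    qed
    then show "leading_coords 2 m \<inter> (\<lambda>_. 1) ` {..<1::nat} = {}" by auto
  qed (simp add: inj_on_def)
  ultimately show ?thesis
    unfolding aff_beta_nonzero_line by auto
qed

lemma aff_beta_chi_brieskorn_dvd:
  assumes \<sigma>: "\<sigma> \<in> {1, -1}" and \<tau>: "\<tau> \<in> {1, -1}" and p: "0 < p" and k: "0 < k"
  defines "q \<equiv> k * p"
  shows "aff_beta (chi 2 (brieskorn \<sigma> p \<tau> q) q) =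
    (if odd p then [:0, -1, 1:] else if \<sigma> = \<tau> then [:-1, 0, 1:] else [:1, -2, 1:]) * [:0, 1:] ^ (2 * q - k - 1)"
proof -
  have q: "1 \<le> q" "k \<le> q" using p k by (auto simp: q_def Suc_le_eq)
  have \<sigma>0: "\<sigma> \<noteq> 0" using \<sigma> by auto
  \<comment> \<open>The positions of x_k and y_1 in the interleaved encoding of the two
    components.\<close>
  define J where "J j = (if j = 0 then (k - 1) * 2 else 1)" for j :: nat
  have kq: "k \<le> q + 1" using q by simp
  have below: "(\<forall>i<q. poly.coeff (arc_poly 2 q a 0 ^ p) i = 0) \<longleftrightarrow> (\<forall>i\<in>leading_coords 2 k. a i = 0)" for a
    unfolding coeff_power_zero_below_iff[OF p] using p coeff_arc_poly_zero_below[OF kq] by (simp add: q_def)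
  have "chi 2 (brieskorn \<sigma> p \<tau> q) q = {a \<in> aff (q * 2). (\<forall>i\<in>leading_coords 2 k. a i = 0)
      \<and> (\<lambda>j. if j < 2 then a (J j) else 0) \<in> binomial_complement \<sigma> p \<tau> k}"
  proof -
    have "(\<forall>i<q. brieskorn_coeff \<sigma> p \<tau> q q a i = 0) \<and> brieskorn_coeff \<sigma> p \<tau> q q a q \<noteq> 0 \<longleftrightarrow>
        (\<forall>i\<in>leading_coords 2 k. a i = 0) \<and> \<sigma> * a (J 0) ^ p + \<tau> * a (J 1) ^ (k * p) \<noteq> 0" for a
    proof -
      have "poly.coeff (arc_poly 2 q a 0 ^ p) q = a (J 0) ^ p" if "\<forall>i\<in>leading_coords 2 k. a i = 0"
        using coeff_power_low_order(2)[of k "arc_poly 2 q a 0" p] that coeff_arc_poly_zero_below[OF kq] q k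
        by (simp add: q_def[symmetric] coeff_arc_poly J_def)
      moreover have "poly.coeff (arc_poly 2 q a 1 ^ q) q = a (J 1) ^ (k * p)"
        using coeff_arc_poly_power(2)[of q 2 a 1 q] q by (simp add: J_def q_def)
      ultimately show ?thesis
        unfolding brieskorn_coeff_zero_below[OF \<sigma>0 p] below by (auto simp: brieskorn_coeff_def)
    qed
    then show ?thesis
      unfolding chi_brieskorn in_binomial_complement by (simp only:)
  qed
  moreover have "aff_beta \<dots> = aff_beta (binomial_complement \<sigma> p \<tau> k) *
      [:0, 1:] ^ (q * 2 - card (leading_coords 2 k) - 2)"
  proof (rule aff_beta_coords[OF constructible_binomial_complement])
    show "J ` {..<2} \<subseteq> {..<q * 2}" using q k by (auto simp: J_def)
    show "inj_on J {..<2}"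
      by (auto simp: inj_on_def J_def)
    show "leading_coords 2 k \<subseteq> {..<q * 2}"
      using kq by (intro leading_coords_subset) auto
    show "leading_coords 2 k \<inter> J ` {..<2} = {}"
    proof -
      have "(j - 1) * 2 \<noteq> J i" if "j \<in> {1..<k}" for i j
        using that by (auto simp: J_def)
      then show ?thesis by (auto simp: leading_coords_def)
    qed
  qed
  moreover have "q * 2 - card (leading_coords 2 k) - 2 = 2 * q - k - 1"
    using k by (simp add: card_leading_coords)
  ultimately show ?thesis
    by (simp only: aff_beta_binomial_complement[OF \<sigma> \<tau> p k])
qed

lemma aff_beta_chi_brieskorn_Suc:
  assumes \<sigma>: "\<sigma> \<in> {1, -1}" and \<tau>: "\<tau> \<in> {1, -1}" and p: "odd p" "2 \<le> p" and k: "0 < k"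
  defines "q \<equiv> k * p"
  shows "\<exists>e. aff_beta (chi 2 (brieskorn \<sigma> p \<tau> q) (q + 1)) = [:-1, 1:] ^ 2 * [:0, 1:] ^ e"
proof -
  have p0: "0 < p" using p by simp
  have q: "2 \<le> q" "k \<le> q" using p k by (auto simp: q_def intro: order_trans[OF p(2)])
  have \<sigma>0: "\<sigma> \<noteq> 0" using \<sigma> by auto
  \<comment> \<open>The zero set of the coefficient at t^q is the graph
    \<open>x = c * y ^ k\<close>.\<close>
  define c where "c = - (\<sigma> * \<tau>)"
  \<comment> \<open>The positions of x_k, y_1, x_(k+1) and y_2: x-coefficients are at even,
    y-coefficients at odd places.\<close>
  define J where "J j = (if j = 0 then (k - 1) * 2 else if j = 1 then 1 else if j = 2 then k * 2 else 3)" for j :: nat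
  have kq: "k \<le> (q + 1) + 1" using q by simp
  let ?X = "\<lambda>a. arc_poly 2 (q + 1) a 0"
  have below: "(\<forall>i<q. poly.coeff (?X a ^ p) i = 0) \<longleftrightarrow> (\<forall>i\<in>leading_coords 2 k. a i = 0)" for a
    unfolding coeff_power_zero_below_iff[OF p0] using p0 coeff_arc_poly_zero_below[OF kq] by (simp add: q_def)
  have key: "\<sigma> * x ^ p + \<tau> * y ^ q = 0 \<and>
      \<sigma> * (of_nat p * x ^ (p - 1) * x') + \<tau> * (of_nat q * y ^ (q - 1) * y') \<noteq> 0 \<longleftrightarrow>
    x = c * y ^ k \<and> y \<noteq> 0 \<and> (\<sigma> * of_nat p) * x' + (\<tau> * of_nat q) * y ^ (k - 1) * y' \<noteq> 0"
    for x y x' y' :: real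
  proof -
    have "\<sigma> * x ^ p + \<tau> * y ^ q = 0 \<longleftrightarrow> x ^ p = c * (y ^ k) ^ p"
      using \<sigma> \<tau> by (auto simp: c_def q_def power_mult)
    also have "c * (y ^ k) ^ p = (c * y ^ k) ^ p"
      using \<sigma> \<tau> p(1) by (auto simp: c_def power_mult_distrib)
    also have "x ^ p = (c * y ^ k) ^ p \<longleftrightarrow> x = c * y ^ k"
      by (rule odd_power_eq_iff[OF p(1)])
    finally have 1: "\<sigma> * x ^ p + \<tau> * y ^ q = 0 \<longleftrightarrow> x = c * y ^ k" .
    have "q - 1 = k * (p - 1) + (k - 1)"
      using k p0 unfolding q_def by (cases p; cases k) simp_all
    then have 2: "y ^ (q - 1) = y ^ (k * (p - 1)) * y ^ (k - 1)"
      by (simp add: power_add)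
    have "c ^ (p - 1) = 1"
      using \<sigma> \<tau> p(1) by (auto simp: c_def)
    then have 3: "(c * y ^ k) ^ (p - 1) = y ^ (k * (p - 1))"
      by (simp add: power_mult_distrib power_mult)
    \<comment> \<open>Positivity of this exponent makes the common factor vanish exactly when y
      does, which is where the condition \<open>y \<noteq> 0\<close> comes from.\<close>
    have "k * (p - 1) > 0" using k p by simp
    then have 4: "y ^ (k * (p - 1)) \<noteq> 0 \<longleftrightarrow> y \<noteq> 0" by simp
    have "\<sigma> * (of_nat p * (c * y ^ k) ^ (p - 1) * x') + \<tau> * (of_nat q * y ^ (q - 1) * y')
      = y ^ (k * (p - 1)) * ((\<sigma> * of_nat p) * x' + (\<tau> * of_nat q) * y ^ (k - 1) * y')"
      unfolding 2 3 by (simp add: algebra_simps)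
    then show ?thesis
      unfolding 1 using 4 by (metis mult_eq_0_iff)
  qed
  have "chi 2 (brieskorn \<sigma> p \<tau> q) (q + 1) = {a \<in> aff ((q + 1) * 2). (\<forall>i\<in>leading_coords 2 k. a i = 0)
      \<and> (\<lambda>j. if j < 4 then a (J j) else 0) \<in> jet_curve c k (\<sigma> * of_nat p) (\<tau> * of_nat q) (k - 1)}"
  proof -
    have "(\<forall>i<q + 1. brieskorn_coeff \<sigma> p \<tau> q (q + 1) a i = 0) \<and> brieskorn_coeff \<sigma> p \<tau> q (q + 1) a (q + 1) \<noteq> 0 \<longleftrightarrow>
        (\<forall>i\<in>leading_coords 2 k. a i = 0) \<and> a (J 0) = c * a (J 1) ^ k \<and> a (J 1) \<noteq> 0 \<and>
        (\<sigma> * of_nat p) * a (J 2) + (\<tau> * of_nat q) * a (J 1) ^ (k - 1) * a (J 3) \<noteq> 0" for a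
    proof -
      have X: "poly.coeff (?X a ^ p) q = a (J 0) ^ p"
        "poly.coeff (?X a ^ p) (q + 1) = of_nat p * a (J 0) ^ (p - 1) * a (J 2)"
        if "\<forall>i\<in>leading_coords 2 k. a i = 0"
      proof -
        have "\<forall>j<k. poly.coeff (?X a) j = 0"
          using that coeff_arc_poly_zero_below[OF kq] by blast
        from coeff_power_low_order(2,3)[OF this, of p]
        show "poly.coeff (?X a ^ p) q = a (J 0) ^ p"
          "poly.coeff (?X a ^ p) (q + 1) = of_nat p * a (J 0) ^ (p - 1) * a (J 2)"
          using q k by (simp_all add: q_def[symmetric] coeff_arc_poly J_def)
      qed
      have Y: "poly.coeff (arc_poly 2 (q + 1) a 1 ^ q) q = a (J 1) ^ q"
        "poly.coeff (arc_poly 2 (q + 1) a 1 ^ q) (q + 1) = of_nat q * a (J 1) ^ (q - 1) * a (J 3)"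
        using coeff_arc_poly_power(2,3)[of "q + 1" 2 a 1 q] q by (simp_all add: J_def)
      have split: "(\<forall>i<q + 1. brieskorn_coeff \<sigma> p \<tau> q (q + 1) a i = 0) \<longleftrightarrow>
          (\<forall>i\<in>leading_coords 2 k. a i = 0) \<and> brieskorn_coeff \<sigma> p \<tau> q (q + 1) a q = 0"
        using brieskorn_coeff_zero_below[OF \<sigma>0 p0, of q \<tau> "q + 1" a] below[of a]
        by (auto simp: less_Suc_eq)
      show ?thesis
        unfolding split key[symmetric] using X Y by (auto simp: brieskorn_coeff_def)
    qed
    then show ?thesis
      unfolding chi_brieskorn in_jet_curve by (simp only:)
  qed
  moreover have "aff_beta \<dots> = aff_beta (jet_curve c k (\<sigma> * of_nat p) (\<tau> * of_nat q) (k - 1)) *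
      [:0, 1:] ^ ((q + 1) * 2 - card (leading_coords 2 k) - 4)"
  proof (rule aff_beta_coords[OF constructible_jet_curve])
    show "J ` {..<4} \<subseteq> {..<(q + 1) * 2}" using q k by (auto simp: J_def)
    show "inj_on J {..<4}"
      unfolding inj_on_def J_def using k by (auto split: if_splits) presburger+
    show "leading_coords 2 k \<subseteq> {..<(q + 1) * 2}"
      using kq by (intro leading_coords_subset) auto
    show "leading_coords 2 k \<inter> J ` {..<4} = {}"
    proof -
      have "(j - 1) * 2 \<noteq> J i" if "j \<in> {1..<k}" for i j
        using that by (auto simp: J_def split: if_splits) presburger+
      then show ?thesis by (auto simp: leading_coords_def)
    qed
  qed
  moreover have "aff_beta (jet_curve c k (\<sigma> * of_nat p) (\<tau> * of_nat q) (k - 1)) = [:-1, 1:] ^ 2 * [:0, 1:]"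
    using \<sigma>0 p0 by (intro aff_beta_jet_curve) simp
  ultimately have "aff_beta (chi 2 (brieskorn \<sigma> p \<tau> q) (q + 1))
      = [:-1, 1:] ^ 2 * [:0, 1:] ^ Suc ((q + 1) * 2 - card (leading_coords 2 k) - 4)"
    by (simp only: power_Suc mult.assoc)
  then show ?thesis ..
qed

end

section \<open>Recovering the exponents\<close>

text \<open>An injective ring homomorphism into Laurent series: equations between cleared
  coefficients are decided among polynomials.\<close>

definition poly_to_fls :: "int poly \<Rightarrow> int fls" where
  "poly_to_fls P = fps_to_fls (fps_of_poly P)"

lemma poly_to_fls_mult: "poly_to_fls (P * Q) = poly_to_fls P * poly_to_fls Q"
  by (simp add: poly_to_fls_def fps_of_poly_mult fls_times_fps_to_fls)

lemma poly_to_fls_power: "poly_to_fls (P ^ n) = poly_to_fls P ^ n"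
  by (simp add: poly_to_fls_def fps_of_poly_power fps_to_fls_power)

lemma poly_to_fls_X: "poly_to_fls [:0, 1:] = fls_X"
  by (simp add: poly_to_fls_def)

lemma poly_to_fls_X_minus_1: "poly_to_fls [:-1, 1:] = fls_X - 1"
proof -
  have "[:-1, 1:] = [:0, 1:] - (1 :: int poly)"
    by (simp add: one_pCons)
  then show ?thesis
    by (simp add: poly_to_fls_def fps_of_poly_diff)
qed

lemma poly_to_fls_eq_iff: "poly_to_fls P = poly_to_fls Q \<longleftrightarrow> P = Q"
  by (simp add: poly_to_fls_def fps_of_poly_eq_iff)

context virtual_poincare_polynomial
begin

lemma fps_nth_naive_zeta:
  "fps_nth (naive_zeta \<beta> d f) n =
    (if n = 0 then 0 else poly_to_fls (aff_beta (chi d f n)) * fls_X_intpow (- int (n * d)))"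
  by (simp add: naive_zeta_def poly_to_fls_def aff_beta_def)

lemma cleared_coeff_naive_zeta:
  "cleared_coeff d (naive_zeta \<beta> d f) n = (if n = 0 then 0 else poly_to_fls (aff_beta (chi d f n)))"
proof -
  have *: "fls_X ^ m * (F * fls_X_intpow (- int m)) = F" for m and F :: "int fls"
  proof -
    have "fls_X ^ m * fls_X_intpow (- int m) = (1 :: int fls)"
      using fls_X_intpow_times_fls_X_intpow[of "int m" "- int m", where 'a = int]
      by (simp add: fls_X_power_conv_shift_1)
    then show ?thesis
      by (simp only: mult.left_commute[of _ F] mult_1_right)
  qed
  then show ?thesis
    unfolding cleared_coeff_def fps_nth_naive_zeta
    by (cases "n = 0") (simp_all only: * if_True if_False simp_thms mult_zero_right)
qed

lemma naive_zeta_nonzero_iff: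
  "fps_nth (naive_zeta \<beta> d f) n \<noteq> 0 \<longleftrightarrow> 0 < n \<and> aff_beta (chi d f n) \<noteq> 0"
  using fls_mult_fls_X_intpow_nonzero poly_to_fls_eq_iff[of "aff_beta (chi d f n)" 0]
  unfolding fps_nth_naive_zeta by (auto simp: poly_to_fls_def fls_X_intpow_times_conv_shift fls_shift_eq0_iff)

text \<open>Here l is computed from p and q. The first two claims identify it later with the least
  index of deviation, the next two tell the cases of the formula for q apart, and the last two
  locate p.\<close>

lemma aff_beta_chi_brieskorn_first_deviation:
  assumes p: "2 \<le> p" "p \<le> q" and \<sigma>: "\<sigma> \<in> {1, -1}" and \<tau>: "\<tau> \<in> {1, -1}"
  defines "G \<equiv> \<lambda>n. aff_beta (chi 2 (brieskorn \<sigma> p \<tau> q) n)"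
    and "A \<equiv> \<lambda>n. aff_beta (chi 1 (\<lambda>x. \<sigma> * x 0 ^ p) n)"
    and "l \<equiv> if odd p \<and> p dvd q then q + 1 else q"
  shows "0 < n \<Longrightarrow> n < l \<Longrightarrow> G n = A n * [:0, 1:] ^ n"
    and "G l \<noteq> A l * [:0, 1:] ^ l"
    and "odd p \<Longrightarrow> p dvd q \<Longrightarrow> G l \<noteq> [:-1, 1:] * [:0, 1:] ^ m"
    and "\<not> p dvd q \<Longrightarrow> \<exists>m. G l = [:-1, 1:] * [:0, 1:] ^ m"
    and "0 < n \<Longrightarrow> n < p \<Longrightarrow> G n = 0"
    and "G p \<noteq> 0"
proof -
  have p0: "0 < p" and q0: "0 < q" using p by auto
  have s0: "\<sigma> \<noteq> 0" "\<tau> \<noteq> 0" using \<sigma> \<tau> by auto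
  have A: "A n = (if p dvd n then [:-1, 1:] * [:0, 1:] ^ (n - n div p) else 0)" if "0 < n" for n
    unfolding A_def using aff_beta_chi_monomial[OF s0(1) p0 that] .
  have G_low: "G n = (if p dvd n then [:-1, 1:] * [:0, 1:] ^ (2 * n - n div p) else 0)"
    if "0 < n" "n < q" for n
    unfolding G_def by (rule aff_beta_chi_brieskorn_below[OF s0(1) p0 that])
  have low: "G n = A n * [:0, 1:] ^ n" if "0 < n" "n < q" for n
  proof -
    \<comment> \<open>The exponent for two components exceeds that for one by exactly n;
      \<open>n div p \<le> n\<close> makes the truncated subtraction exact.\<close>
    have "2 * n - n div p = (n - n div p) + n"
      using div_le_dividend[of n p] by linarith
    then show ?thesis
      unfolding G_low[OF that] A[OF that(1)]
      by (cases "p dvd n") (simp_all only: if_True if_False power_add mult.assoc mult_zero_left)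
  qed
  have dvd: "\<exists>e. G q = (if odd p then [:0, -1, 1:] else if \<sigma> = \<tau> then [:-1, 0, 1:] else [:1, -2, 1:]) * [:0, 1:] ^ e
      \<and> A q * [:0, 1:] ^ q = [:0, -1, 1:] * [:0, 1:] ^ e" if pq: "p dvd q"
  proof -
    obtain k where q: "q = k * p" using pq by (metis dvdE mult.commute)
    have k: "0 < k" "k \<le> q" using q q0 p0 by auto
    have "A q * [:0, 1:] ^ q = [:-1, 1:] * ([:0, 1:] ^ (q - k) * [:0, 1:] ^ q)"
    proof -
      have "q div p = k" using p0 q by simp
      then show ?thesis
        using pq unfolding A[OF q0] by (simp only: if_True mult.assoc)
    qed
    \<comment> \<open>One factor u is split off and joined to u - 1, so that both sides carry the
      same power of u and only quadratic factors remain to be compared.\<close>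
    also have "\<dots> = [:-1, 1:] * [:0, 1:] ^ Suc (2 * q - k - 1)"
    proof -
      have "q - k + q = Suc (2 * q - k - 1)" using k q0 by linarith
      then show ?thesis by (simp only: power_add[symmetric])
    qed
    also have "\<dots> = ([:-1, 1:] * [:0, 1:]) * [:0, 1:] ^ (2 * q - k - 1)"
      by (simp only: power_Suc mult.assoc)
    also have "[:-1, 1:] * [:0, 1:] = [:0, -1, 1 :: int:]"
      by simp
    finally have "A q * [:0, 1:] ^ q = [:0, -1, 1:] * [:0, 1:] ^ (2 * q - k - 1)" .
    moreover have "G q = (if odd p then [:0, -1, 1:] else if \<sigma> = \<tau> then [:-1, 0, 1:] else [:1, -2, 1:])
        * [:0, 1:] ^ (2 * q - k - 1)"
      unfolding G_def q by (rule aff_beta_chi_brieskorn_dvd[OF \<sigma> \<tau> p0 k(1)])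
    ultimately show ?thesis by blast
  qed
  have next_coeff: "\<exists>e. G (q + 1) = [:-1, 1:] ^ 2 * [:0, 1:] ^ e" if op: "odd p" and pq: "p dvd q"
  proof -
    obtain k where q: "q = k * p" using pq by (metis dvdE mult.commute)
    have "0 < k" using q q0 by simp
    then show ?thesis
      unfolding G_def q by (rule aff_beta_chi_brieskorn_Suc[OF \<sigma> \<tau> op p(1)])
  qed
  have not_dvd: "\<exists>e. G q = [:-1, 1:] * [:0, 1:] ^ e" if "\<not> p dvd q"
    unfolding G_def by (rule aff_beta_chi_brieskorn_not_dvd[OF s0 p0 q0 that])
  have X0: "[:0, 1:] ^ e \<noteq> (0 :: int poly)" for e
    by simp
  have nz: "[:-1, 1:] * [:0, 1:] ^ e \<noteq> (0 :: int poly)" for e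
    by (rule no_zero_divisors) simp_all
  show "G n = A n * [:0, 1:] ^ n" if "0 < n" "n < l"
  proof (cases "n < q")
    case False
    then have "n = q" "odd p" "p dvd q" using that by (auto simp: l_def split: if_splits)
    then show ?thesis using dvd by auto
  qed (rule low[OF that(1)])
  show "G l \<noteq> A l * [:0, 1:] ^ l"
  proof -
    consider "odd p" "p dvd q" | "\<not> p dvd q" | "even p" "p dvd q" by blast
    then show ?thesis
    proof cases
      case 1
      then obtain e where "G (q + 1) = [:-1, 1:] ^ 2 * [:0, 1:] ^ e" using next_coeff by blast
      \<comment> \<open>Hence the coefficient of x^p at q + 1 is 0, while that of g is a nonzero
        product.\<close>
      moreover have "\<not> p dvd q + 1"
        using 1(2) p(1) by (metis dvd_add_right_iff nat_dvd_1_iff_1 numeral_le_one_iff semiring_norm(69))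
      ultimately show ?thesis
        using 1 A[of "q + 1"] by (simp add: l_def)
    next
      case 2
      then obtain e where "G q = [:-1, 1:] * [:0, 1:] ^ e" using not_dvd by blast
      moreover have "l = q" "A q = 0"
        using 2 A[OF q0] by (simp_all add: l_def)
      ultimately show ?thesis
        using nz[of e] by (simp only: mult_zero_left not_False_eq_True)
    next
      case 3
      then obtain e where e: "G q = (if \<sigma> = \<tau> then [:-1, 0, 1:] else [:1, -2, 1:]) * [:0, 1:] ^ e"
        "A q * [:0, 1:] ^ q = [:0, -1, 1:] * [:0, 1:] ^ e"
        using dvd by auto
      have "l = q" using 3 by (simp add: l_def)
      moreover have "(if \<sigma> = \<tau> then [:-1, 0, 1:] else [:1, -2, 1:]) \<noteq> [:0, -1, 1 :: int:]"
        by simp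
      ultimately show ?thesis
        unfolding \<open>l = q\<close> e using X0[of e] by (simp only: mult_cancel_right simp_thms)
    qed
  qed
  show "G l \<noteq> [:-1, 1:] * [:0, 1:] ^ m" if op: "odd p" and pq: "p dvd q"
  proof
    assume *: "G l = [:-1, 1:] * [:0, 1:] ^ m"
    obtain e where e: "G (q + 1) = [:-1, 1:] ^ 2 * [:0, 1:] ^ e" using next_coeff[OF op pq] by blast
    have "l = q + 1" using op pq by (simp add: l_def)
    then have "[:-1, 1:] * ([:-1, 1:] * [:0, 1:] ^ e) = [:-1, 1:] * ([:0, 1:] ^ m :: int poly)"
      using * e by (simp only: power2_eq_square mult.assoc)
    then have "[:-1, 1:] * [:0, 1:] ^ e = ([:0, 1:] ^ m :: int poly)"
      by (subst (asm) mult_left_cancel) simp_all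
    \<comment> \<open>At u = 1 the left side vanishes because of its remaining factor u - 1, whereas
      the right side is 1.\<close>
    from arg_cong[OF this, of "\<lambda>P. poly P 1"] show False by simp
  qed
  show "\<exists>m. G l = [:-1, 1:] * [:0, 1:] ^ m" if "\<not> p dvd q"
    using not_dvd[OF that] that by (simp add: l_def)
  show "G n = 0" if "0 < n" "n < p"
    using G_low[of n] that p by (auto dest: dvd_imp_le)
  show "G p \<noteq> 0"
  proof (cases "p = q")
    case True
    then obtain e where "G p = (if odd p then [:0, -1, 1:] else if \<sigma> = \<tau> then [:-1, 0, 1:] else [:1, -2, 1:])
        * [:0, 1:] ^ e"
      using dvd by auto
    moreover have "(if odd p then [:0, -1, 1:] else if \<sigma> = \<tau> then [:-1, 0, 1:] else [:1, -2, 1:]) \<noteq> (0 :: int poly)"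
      by simp
    ultimately show ?thesis
      using X0[of e] by (simp only: mult_eq_0_iff simp_thms)
  next
    case False
    then have "G p = [:-1, 1:] * [:0, 1:] ^ (2 * p - p div p)"
      using G_low[of p] p p0 by simp
    then show ?thesis using nz by (simp only: not_False_eq_True)
  qed
qed

text \<open>The two existence claims guarantee that each \<open>LEAST\<close> denotes an actual
  index. Apart from a, the formula for q depends only on Z and p, which is what uniqueness rests
  on.\<close>

lemma brieskorn_exponents_from_zeta:
  assumes p: "2 \<le> p" "p \<le> q" and \<sigma>: "\<sigma> \<in> {1, -1}" and \<tau>: "\<tau> \<in> {1, -1}"
  defines "Z \<equiv> naive_zeta \<beta> 2 (brieskorn \<sigma> p \<tau> q)"
  defines "g \<equiv> cleared_coeff 2 Z"
    and "a \<equiv> cleared_coeff 1 (naive_zeta \<beta> 1 (\<lambda>x. \<sigma> * x 0 ^ p))"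
  defines "l \<equiv> LEAST n. g n \<noteq> a n * fls_X ^ n"
  shows "\<exists>n. fps_nth Z n \<noteq> 0" and "p = (LEAST n. fps_nth Z n \<noteq> 0)"
    and "\<exists>n. g n \<noteq> a n * fls_X ^ n"
    and "q = (if odd p \<and> p dvd l - 1 \<and> \<not> (\<exists>k::nat. g l = (fls_X - 1) * fls_X ^ k) then l - 1 else l)"
proof -
  note dev = aff_beta_chi_brieskorn_first_deviation[OF assms(1-4)]
  have p0: "0 < p" using p by simp
  have Zp: "fps_nth Z p \<noteq> 0"
    unfolding Z_def naive_zeta_nonzero_iff using p0 dev(6) by simp
  then show "\<exists>n. fps_nth Z n \<noteq> 0" ..
  show "p = (LEAST n. fps_nth Z n \<noteq> 0)"
  proof (rule Least_equality[symmetric])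
    show "fps_nth Z p \<noteq> 0" by fact
    show "p \<le> n" if "fps_nth Z n \<noteq> 0" for n
      using that dev(5)[of n] unfolding Z_def naive_zeta_nonzero_iff by (meson not_le)
  qed
  define L where "L = (if odd p \<and> p dvd q then q + 1 else q)"
  have L0: "0 < L" using p by (auto simp: L_def)
  have eq_iff: "g n = a n * fls_X ^ n \<longleftrightarrow>
    aff_beta (chi 2 (brieskorn \<sigma> p \<tau> q) n) = aff_beta (chi 1 (\<lambda>x. \<sigma> * x 0 ^ p) n) * [:0, 1:] ^ n"
    if "0 < n" for n
    using that unfolding g_def a_def Z_def cleared_coeff_naive_zeta
    by (simp add: poly_to_fls_X[symmetric] poly_to_fls_power[symmetric] poly_to_fls_mult[symmetric]
        poly_to_fls_eq_iff)
  have gL: "g L \<noteq> a L * fls_X ^ L"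
    unfolding eq_iff[OF L0] unfolding L_def by (rule dev(2))
  then show "\<exists>n. g n \<noteq> a n * fls_X ^ n" ..
  have l: "l = L"
    unfolding l_def
  proof (rule Least_equality)
    show "g L \<noteq> a L * fls_X ^ L" by fact
    fix n assume n: "g n \<noteq> a n * fls_X ^ n"
    \<comment> \<open>Both series have coefficient 0 at index 0, so the minimum over all naturals is
      the minimum over positive n.\<close>
    have "n \<noteq> 0"
    proof
      assume "n = 0"
      then show False using n by (simp add: g_def a_def Z_def cleared_coeff_naive_zeta)
    qed
    then show "L \<le> n"
      using n eq_iff[of n] dev(1)[of n, folded L_def] by (meson not_le neq0_conv)
  qed
  have form: "(\<exists>k. g L = (fls_X - 1) * fls_X ^ k) \<longleftrightarrow>
      (\<exists>k. aff_beta (chi 2 (brieskorn \<sigma> p \<tau> q) L) = [:-1, 1:] * [:0, 1:] ^ k)"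
  proof -
    have "g L = poly_to_fls (aff_beta (chi 2 (brieskorn \<sigma> p \<tau> q) L))"
      using L0 by (simp add: g_def Z_def cleared_coeff_naive_zeta)
    then show ?thesis
      unfolding poly_to_fls_X_minus_1[symmetric]
      by (simp only: poly_to_fls_X[symmetric] poly_to_fls_power[symmetric]
        poly_to_fls_mult[symmetric] poly_to_fls_eq_iff)
  qed
  show "q = (if odd p \<and> p dvd l - 1 \<and> \<not> (\<exists>k::nat. g l = (fls_X - 1) * fls_X ^ k) then l - 1 else l)"
  proof (cases "odd p \<and> p dvd q")
    case True
    then have "L = q + 1" by (simp add: L_def)
    moreover have "\<not> (\<exists>k. g L = (fls_X - 1) * fls_X ^ k)"
      unfolding form using dev(3)[folded L_def] True by blast
    ultimately show ?thesis
      using True unfolding l by simp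
  next
    case False
    then have Lq: "L = q" by (auto simp: L_def)
    \<comment> \<open>For odd p this case means that p does not divide q, and then the shape of g_l
      selects the value l; for even p the first conjunct fails.\<close>
    have "\<exists>k. g L = (fls_X - 1) * fls_X ^ k" if "odd p"
      unfolding form using dev(4)[folded L_def] False that by blast
    then show ?thesis
      unfolding l Lq[symmetric] by auto
  qed
qed

text \<open>A competing polynomial may have a different sign at x^p; this makes its reference series
  a coincide with the original one.\<close>

lemma cleared_coeff_monomial_sign:
  assumes "\<sigma> \<noteq> 0" "\<sigma>' \<noteq> 0" "0 < p"
  shows "cleared_coeff 1 (naive_zeta \<beta> 1 (\<lambda>x. \<sigma> * x 0 ^ p))
    = cleared_coeff 1 (naive_zeta \<beta> 1 (\<lambda>x. \<sigma>' * x 0 ^ p))"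
  using aff_beta_chi_monomial[OF assms(1,3)] aff_beta_chi_monomial[OF assms(2,3)]
  by (simp add: fun_eq_iff cleared_coeff_naive_zeta)

end

theorem proposition4p12:
  fixes \<beta> :: "(nat \<Rightarrow> real) set set \<Rightarrow> int poly" and p q :: nat and \<sigma> \<tau> :: real
  assumes "virtual_poincare \<beta>"
    and "2 \<le> p" and "p \<le> q"
    and "\<sigma> \<in> {1, -1}" and "\<tau> \<in> {1, -1}"
  shows
    "let Z = naive_zeta \<beta> 2 (brieskorn \<sigma> p \<tau> q);
         g = cleared_coeff 2 Z;
         a = cleared_coeff 1 (naive_zeta \<beta> 1 (\<lambda>x. \<sigma> * x 0 ^ p));
         l = (LEAST n. g n \<noteq> a n * fls_X ^ n)
     in (\<forall>p' q' \<sigma>' \<tau>'. 2 \<le> p' \<longrightarrow> p' \<le> q' \<longrightarrow> \<sigma>' \<in> {1, -1} \<longrightarrow> \<tau>' \<in> {1, -1} \<longrightarrow>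
           naive_zeta \<beta> 2 (brieskorn \<sigma>' p' \<tau>' q') = Z \<longrightarrow> p' = p \<and> q' = q) \<and>
        (\<exists>n. fps_nth Z n \<noteq> 0) \<and> p = (LEAST n. fps_nth Z n \<noteq> 0) \<and>
        (\<exists>n. g n \<noteq> a n * fls_X ^ n) \<and>
        q = (if odd p \<and> p dvd l - 1 \<and> \<not> (\<exists>k::nat. g l = (fls_X - 1) * fls_X ^ k)
             then l - 1 else l)"
proof -
  interpret virtual_poincare_polynomial \<beta>
    by unfold_locales (rule assms(1))
  note recover = brieskorn_exponents_from_zeta[OF assms(2-5)]
  have unique: "p' = p \<and> q' = q"
    if *: "2 \<le> p'" "p' \<le> q'" "\<sigma>' \<in> {1, -1}" "\<tau>' \<in> {1, -1}"
      and Z: "naive_zeta \<beta> 2 (brieskorn \<sigma>' p' \<tau>' q') = naive_zeta \<beta> 2 (brieskorn \<sigma> p \<tau> q)"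
    for p' q' \<sigma>' \<tau>'
  proof -
    note recover' = brieskorn_exponents_from_zeta[OF *, unfolded Z]
    have p: "p' = p"
      using recover'(2) recover(2) by (rule trans[OF _ sym])
    have "\<sigma>' \<noteq> 0" "\<sigma> \<noteq> 0" "0 < p" using *(3) assms(2,4) by auto
    note sign = cleared_coeff_monomial_sign[OF this]
    \<comment> \<open>Once p' = p and the sign is replaced, both exponents are given by the same
      expression in the common zeta function.\<close>
    have "q' = q"
      using recover'(4)[unfolded p sign] recover(4) by (rule trans[OF _ sym])
    with p show ?thesis ..
  qed
  show ?thesis
    unfolding Let_def by (intro conjI allI impI recover) (use unique in blast)+
qed

end
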